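(* Let $d\ge 1$ and let $\mu$ be any integer partition. Then each of the functions $(\mathbf p,\mathbf r)\mapsto S^\star_\mu(\mathbf r^{\mathbf p})$ and $(\mathbf p,\mathbf r)\mapsto \mathrm{Ko}_\mu(\mathbf r^{\mathbf p})$, defined for $\mathbf p=(p_1,\dots,p_d)$ and $\mathbf r=(r_1,\dots,r_d)$ in $\mathbb Z_{\ge0}^d$, is given by a polynomial in $\mathbb Q[p_1,\dots,p_d,r_1,\dots,r_d]$ whose expansion in the falling factorial basis has only non-negative rational coefficients.
   Context: Partitions and Young diagrams are identified. For a Young diagram $\lambda$ with $\ell$ rows and a family $F=(F_N)_{N\ge1}$ of polynomials with $F_{N+1}(x_1,\dots,x_N,0)=F_N(x_1,\dots,x_N)$, write $F(\lambda)=F_\ell(\lambda_1,\dots,\lambda_\ell)$. Multirectangular coordinates: for $\mathbf p=(p_1,\dots,p_d)$ and $\mathbf r=(r_1,\dots,r_d)$ with non-negative integer entries, $\mathbf r^{\mathbf p}$ denotes the Young diagram which, for $s=1,\dots,d$ in this order from top to bottom, has $p_s$ rows of length $r_s+r_{s+1}+\dots+r_d$. Falling factorials: $(x)_a=x(x-1)\cdots(x-a+1)$, with $(x)_0=1$. The falling factorial basis of $\mathbb Q[p_1,\dots,p_d,r_1,\dots,r_d]$ consists of the products $(p_1)_{a_1}\cdots(p_d)_{a_d}(r_1)_{b_1}\cdots(r_d)_{b_d}$ with $a_i,b_i\ge 0$. Shifted Schur function: for a partition $\mu$ and $n\ge \ell(\mu)$ (with $\mu_j=0$ for $j>\ell(\mu)$),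 $S^\star_\mu(x_1,\dots,x_n)=\det\big((x_i+n-i)_{\mu_j+n-j}\big)_{i,j\le n}/\det\big((x_i+n-i)_{n-j}\big)_{i,j\le n}$. Kostka numbers: $K^\lambda_\tau$ is the number of semi-standard Young tableaux of shape $\lambda$ and type $\tau$, i.e. with exactly $\tau_i$ entries equal to $i$. For $\mu\vdash k$, $\mu1^{n-k}$ denotes the partition of $n$ obtained from $\mu$ by appending $n-k$ parts equal to $1$. For a Young diagram $\lambda$ with $|\lambda|=n$, $\mathrm{Ko}_\mu(\lambda)=(n)_k\,K^\lambda_{\mu1^{n-k}}/K^\lambda_{1^n}$ if $n\ge k$, and $\mathrm{Ko}_\mu(\lambda)=0$ if $n<k$. *)

theory Defs
  imports Main "HOL.Rat" "Jordan_Normal_Form.Determinant"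
begin

definition ff :: "rat \<Rightarrow> nat \<Rightarrow> rat" where
  "ff x a = (\<Prod>i<a. x - of_nat i)"

definition is_partition :: "nat list \<Rightarrow> bool" where
  "is_partition mu \<longleftrightarrow> (\<forall>i. Suc i < length mu \<longrightarrow> mu ! Suc i \<le> mu ! i) \<and> 0 \<notin> set mu"

definition multirect :: "nat list \<Rightarrow> nat list \<Rightarrow> nat list" where
  "multirect p r = filter (\<lambda>x. 0 < x)
     (concat (map (\<lambda>s. replicate (p ! s) (sum_list (drop s r))) [0..<length p]))"

text \<open>Shifted Schur function in n variables (n \<ge> length mu), x given as a function on 0..n-1.\<close>
definition shifted_schur_n :: "nat list \<Rightarrow> nat \<Rightarrow> (nat \<Rightarrow> nat) \<Rightarrow> rat" where
  "shifted_schur_n mu n x =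
     det (mat n n (\<lambda>(i,j). ff (of_nat (x i + n - Suc i))
                           ((if j < length mu then mu ! j else 0) + n - Suc j)))
   / det (mat n n (\<lambda>(i,j). ff (of_nat (x i + n - Suc i)) (n - Suc j)))"

definition shifted_schur :: "nat list \<Rightarrow> nat list \<Rightarrow> rat" where
  "shifted_schur mu lam =
     shifted_schur_n mu (max (length lam) (length mu))
       (\<lambda>i. if i < length lam then lam ! i else 0)"

definition ssyt :: "nat list \<Rightarrow> nat list \<Rightarrow> (nat \<Rightarrow> nat \<Rightarrow> nat) set" where
  "ssyt lam tau = {T.
     (\<forall>i j. i < length lam \<and> j < lam ! i \<longrightarrow> 1 \<le> T i j \<and> T i j \<le> length tau) \<and>
     (\<forall>i j. \<not> (i < length lam \<and> j < lam ! i) \<longrightarrow> T i j = 0) \<and>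
     (\<forall>i j. i < length lam \<and> Suc j < lam ! i \<longrightarrow> T i j \<le> T i (Suc j)) \<and>
     (\<forall>i j. Suc i < length lam \<and> j < lam ! Suc i \<longrightarrow> T i j < T (Suc i) j) \<and>
     (\<forall>k < length tau. card {(i,j). i < length lam \<and> j < lam ! i \<and> T i j = Suc k} = tau ! k)}"

definition kostka :: "nat list \<Rightarrow> nat list \<Rightarrow> nat" where
  "kostka lam tau = card (ssyt lam tau)"

definition Ko :: "nat list \<Rightarrow> nat list \<Rightarrow> rat" where
  "Ko mu lam = (let n = sum_list lam; k = sum_list mu in
     if k \<le> n then ff (of_nat n) k * of_nat (kostka lam (mu @ replicate (n - k) 1))
                   / of_nat (kostka lam (replicate n 1))
     else 0)"

definition nonneg_ff_poly :: "nat \<Rightarrow> (nat list \<Rightarrow> nat list \<Rightarrow> rat) \<Rightarrow> bool" where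
  "nonneg_ff_poly d f \<longleftrightarrow>
     (\<exists>C :: (nat list \<times> nat list) set. \<exists>c :: nat list \<times> nat list \<Rightarrow> rat.
        finite C \<and>
        (\<forall>(a,b)\<in>C. length a = d \<and> length b = d \<and> 0 \<le> c (a,b)) \<and>
        (\<forall>p r. length p = d \<longrightarrow> length r = d \<longrightarrow>
           f p r = (\<Sum>(a,b)\<in>C. c (a,b) *
                      (\<Prod>i<d. ff (of_nat (p ! i)) (a ! i)) *
                      (\<Prod>i<d. ff (of_nat (r ! i)) (b ! i)))))"

end

theory Submission
  imports Defs "HOL-Combinatorics.Orbits"
begin

text \<open>
  Writing \<open>f\<close> for numbers of standard tableaux, \<open>S\<^sup>\<star>\<^sub>\<mu>(\<lambda>) = (n)\<^sub>k f(\<lambda>/\<mu>) / f(\<lambda>)\<close> for \<open>|\<lambda>| = n\<close> and \<open>|\<mu>| = k\<close>,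
  because both sides satisfy the same recursion under removal of a corner of \<open>\<lambda>\<close>; likewise
  \<open>Ko\<^sub>\<mu> = \<Sum> K(\<nu>,\<mu>) S\<^sup>\<star>\<^sub>\<nu>\<close> over the partitions \<open>\<nu>\<close> of \<open>k\<close>, so it suffices to treat \<open>S\<^sup>\<star>\<^sub>\<mu>\<close>.

  For a set \<open>M\<close> of \<open>k\<close> boxes let \<open>a(M)\<close> and \<open>b(M)\<close> be its row symmetrizer and column antisymmetrizer. For a
  Young diagram \<open>\<lambda>\<close> the class function obtained by averaging \<open>b(\<lambda>) a(\<lambda>)\<close> over conjugation is proportional to the
  irreducible character \<open>\<chi>(\<lambda>)\<close>. Restricting it to the symmetric groups of the \<open>k\<close>-subsets \<open>M\<close> of \<open>\<lambda>\<close>, where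
  \<open>\<chi>(\<lambda>)\<close> becomes \<open>\<Sum> f(\<lambda>/\<nu>) \<chi>(\<nu>)\<close>, and pairing with \<open>\<chi>(\<mu>)\<close> expresses \<open>S\<^sup>\<star>\<^sub>\<mu>(\<lambda>)\<close> as a positive multiple of
  \<open>\<Sum> \<chi>(\<mu>)(b(M) a(M))\<close> over these \<open>M\<close>. Each summand is non-negative, since \<open>a(M)\<close> and \<open>b(M)\<close> are positive multiples
  of orthogonal projections and \<open>\<chi>(\<mu>)\<close> is positive definite. It depends only on \<open>M\<close> up to permutations of
  rows and of columns, so grouping the \<open>M\<close> by the rows and columns which they meet gives products of binomial
  coefficients in the multirectangular coordinates.
\<close>

text \<open>The irreducible character appears in two guises because each property is visible in only
  one of them. Frobenius' formula \<open>frob\<close> yields branching and the value at the identity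
  by bookkeeping of exponents; the averaged symmetrizer \<open>young_class\<close> yields
  positivity. The crux is that both agree up to a factor. No representation is constructed:
  everything is a rational sum over permutations, and irreducibility is replaced by two orthogonal
  families that are triangular to each other in the dominance order. That alone does not identify
  them, so \<open>frob\<close> is also shown to be complete: a class function orthogonal to the
  whole family has zero sum over every Young subgroup, and therefore vanishes. Completeness needs at
  least as many variables \<open>l\<close> as there are points, so \<open>l\<close> is a free
  parameter, chosen large at the end, and not the number of rows of the partition.\<close>

subsection \<open>Frobenius characters\<close>

text \<open>The coefficient of \<open>x\<^sup>\<theta>\<close> in the Vandermonde product of the \<open>x\<^sub>i - x\<^sub>j\<close> with \<open>i < j < l\<close>.\<close>

definition vdm_coeff :: "nat \<Rightarrow> (nat \<Rightarrow> int) \<Rightarrow> rat" where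
  "vdm_coeff l \<theta> = (\<Sum>w | w permutes {..<l}.
     of_int (sign w) * of_bool (\<forall>i<l. \<theta> i = int l - 1 - int (w i)))"

definition color_count :: "'a set \<Rightarrow> ('a \<Rightarrow> nat) \<Rightarrow> nat \<Rightarrow> nat" where
  "color_count A c i = card {x \<in> A. c x = i}"

definition fixed_colorings :: "nat \<Rightarrow> 'a set \<Rightarrow> ('a \<Rightarrow> 'a) \<Rightarrow> ('a \<Rightarrow> nat) set" where
  "fixed_colorings l A p = {c \<in> A \<rightarrow>\<^sub>E {..<l}. \<forall>x\<in>A. c (p x) = c x}"

text \<open>Frobenius' formula: the coefficient of \<open>x\<^sup>\<kappa>\<close> in the Vandermonde product times the power sum
  of the cycle type of \<open>p\<close>. For \<open>\<kappa> = shifted l L\<close> it is the irreducible character of the partition \<open>L\<close>.\<close>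

definition frob :: "nat \<Rightarrow> (nat \<Rightarrow> int) \<Rightarrow> 'a set \<Rightarrow> ('a \<Rightarrow> 'a) \<Rightarrow> rat" where
  "frob l \<kappa> A p = (\<Sum>c\<in>fixed_colorings l A p. vdm_coeff l (\<lambda>i. \<kappa> i - int (color_count A c i)))"

lemma vdm_coeff_cong: "(\<And>i. i < l \<Longrightarrow> \<theta> i = \<theta>' i) \<Longrightarrow> vdm_coeff l \<theta> = vdm_coeff l \<theta>'"
  unfolding vdm_coeff_def by (auto intro!: sum.cong)

lemma vdm_coeff_permute:
  assumes "t permutes {..<l}"
  shows "vdm_coeff l (\<lambda>i. \<theta> (t i)) = of_int (sign t) * vdm_coeff l \<theta>"
proof -
  have eq: "(\<forall>i<l. \<theta> (t i) = int l - 1 - int (w (t i))) \<longleftrightarrow> (\<forall>i<l. \<theta> i = int l - 1 - int (w i))" for w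
  proof -
    have "(\<forall>i\<in>{..<l}. \<theta> (t i) = int l - 1 - int (w (t i))) \<longleftrightarrow>
      (\<forall>i\<in>t ` {..<l}. \<theta> i = int l - 1 - int (w i))" by blast
    then show ?thesis unfolding permutes_image[OF assms] by auto
  qed
  have sg: "sign (w \<circ> t) = sign t * sign w" if "w permutes {..<l}" for w
    using that assms by (metis finite_lessThan mult.commute permutes_imp_permutation sign_compose)
  have "vdm_coeff l (\<lambda>i. \<theta> (t i)) = (\<Sum>w | w permutes {..<l}.
     of_int (sign (w \<circ> t)) * of_bool (\<forall>i<l. \<theta> (t i) = int l - 1 - int ((w \<circ> t) i)))"
    unfolding vdm_coeff_def by (rule sum_permutations_compose_right[OF assms])
  also have "\<dots> = of_int (sign t) * vdm_coeff l \<theta>"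
    unfolding vdm_coeff_def sum_distrib_left
    by (rule sum.cong) (auto simp: eq sg)
  finally show ?thesis .
qed

lemma vdm_coeff_nonzeroD:
  assumes "vdm_coeff l \<theta> \<noteq> 0"
  obtains w where "w permutes {..<l}" "\<And>i. i < l \<Longrightarrow> \<theta> i = int l - 1 - int (w i)"
proof -
  have "\<exists>w\<in>{w. w permutes {..<l}}. of_int (sign w) * of_bool (\<forall>i<l. \<theta> i = int l - 1 - int (w i)) \<noteq> (0::rat)"
    using assms unfolding vdm_coeff_def by (meson sum.neutral)
  then show ?thesis using that by (auto split: if_splits)
qed

lemma vdm_coeff_neg: "i < l \<Longrightarrow> \<theta> i < 0 \<Longrightarrow> vdm_coeff l \<theta> = 0"
  by (rule ccontr, erule vdm_coeff_nonzeroD)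
     (metis diff_ge_0_iff_ge int_ops(6) lessThan_iff linorder_not_less permutes_in_image
       verit_comp_simplify1(3) zle_diff1_eq of_nat_less_iff)

lemma frob_cong: "(\<And>i. i < l \<Longrightarrow> \<kappa> i = \<kappa>' i) \<Longrightarrow> frob l \<kappa> A p = frob l \<kappa>' A p"
  unfolding frob_def by (intro sum.cong refl vdm_coeff_cong) auto

lemma frob_neg:
  assumes "i < l" "\<kappa> i < 0"
  shows "frob l \<kappa> A p = 0"
  unfolding frob_def using assms by (intro sum.neutral ballI vdm_coeff_neg[of i]) auto

text \<open>The ground set is immaterial. Taking one of two permutations as \<open>h\<close> gives
  the class function property; other bijections move characters between sets of boxes.\<close>

lemma frob_transport:
  assumes h: "bij_betw h A B" and p: "\<And>x. x \<in> A \<Longrightarrow> p x \<in> A"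
    and eq: "\<And>x. x \<in> A \<Longrightarrow> h (p x) = q (h x)"
  shows "frob l \<kappa> A p = frob l \<kappa> B q"
proof -
  let ?g = "inv_into A h"
  have g1: "\<And>x. x \<in> A \<Longrightarrow> ?g (h x) = x" using h by (simp add: bij_betw_inv_into_left)
  have g2: "\<And>y. y \<in> B \<Longrightarrow> h (?g y) = y" using h by (simp add: bij_betw_inv_into_right)
  have g3: "\<And>y. y \<in> B \<Longrightarrow> ?g y \<in> A" using h by (metis bij_betw_imp_surj_on inv_into_into)
  have h1: "\<And>x. x \<in> A \<Longrightarrow> h x \<in> B" using h bij_betwE by blast
  have q: "q y \<in> B" "?g (q y) = p (?g y)" if "y \<in> B" for y
    using that eq[of "?g y"] g1 g2 g3 p h1 by metis+
  have cc: "color_count B (\<lambda>y\<in>B. c (?g y)) i = color_count A c i" for c i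
    unfolding color_count_def
    by (rule bij_betw_same_card[of ?g], rule bij_betw_byWitness[of _ h]) (auto simp: g1 g2 g3 h1)
  show ?thesis unfolding frob_def
  proof (rule sum.reindex_bij_witness[of _ "\<lambda>c. \<lambda>x\<in>A. c (h x)" "\<lambda>c. \<lambda>y\<in>B. c (?g y)"])
    fix c assume c: "c \<in> fixed_colorings l A p"
    show "(\<lambda>x\<in>A. (\<lambda>y\<in>B. c (?g y)) (h x)) = c"
      using c g1 h1 unfolding fixed_colorings_def by (auto simp: fun_eq_iff PiE_def extensional_def)
    show "(\<lambda>y\<in>B. c (?g y)) \<in> fixed_colorings l B q"
      using c g3 q unfolding fixed_colorings_def by auto
    show "vdm_coeff l (\<lambda>i. \<kappa> i - int (color_count B (\<lambda>y\<in>B. c (?g y)) i)) =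
      vdm_coeff l (\<lambda>i. \<kappa> i - int (color_count A c i))" by (simp add: cc)
  next
    fix c assume c: "c \<in> fixed_colorings l B q"
    show "(\<lambda>y\<in>B. (\<lambda>x\<in>A. c (h x)) (?g y)) = c"
      using c g2 g3 unfolding fixed_colorings_def by (auto simp: fun_eq_iff PiE_def extensional_def)
    show "(\<lambda>x\<in>A. c (h x)) \<in> fixed_colorings l A p"
      using c h1 p eq unfolding fixed_colorings_def by auto
  qed
qed

lemma color_count_insert:
  assumes "finite A" "x \<in> A"
  shows "color_count A c i = color_count (A - {x}) c i + of_bool (c x = i)"
proof -
  have "{y \<in> A. c y = i} = {y \<in> A - {x}. c y = i} \<union> (if c x = i then {x} else {})" using assms by auto
  then show ?thesis using assms unfolding color_count_def by (auto simp: card_insert_if)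
qed

lemma color_count_cong: "(\<And>x. x \<in> A \<Longrightarrow> c x = c' x) \<Longrightarrow> color_count A c i = color_count A c' i"
  unfolding color_count_def by (metis (mono_tags, lifting) Collect_cong)

text \<open>\<open>x\<close> is a fixed point of \<open>p\<close>, so its color \<open>i\<close> is
  free and merely lowers the exponent of the i-th variable by one: a cycle of length one contributes
  the power sum of degree one.\<close>

lemma frob_restrict:
  assumes "finite A" "x \<in> A" "p permutes (A - {x})"
  shows "frob l \<kappa> A p = (\<Sum>i<l. frob l (\<lambda>j. \<kappa> j - of_bool (j = i)) (A - {x}) p)"
proof -
  have px: "p x = x" using assms(3) by (simp add: permutes_not_in)
  have pA: "p y \<in> A - {x}" if "y \<in> A - {x}" for y using that permutes_in_image[OF assms(3)] by blast
  have cc: "color_count A c i = color_count (A - {x}) (c(x := u)) i + of_bool (c x = i)" for c u i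
    unfolding color_count_insert[OF assms(1,2)] by (simp add: color_count_def) (metis fun_upd_other)
  have "frob l \<kappa> A p = (\<Sum>(i,c)\<in>{..<l} \<times> fixed_colorings l (A - {x}) p.
      vdm_coeff l (\<lambda>j. \<kappa> j - of_bool (j = i) - int (color_count (A - {x}) c j)))"
    unfolding frob_def
  proof (rule sum.reindex_bij_witness[of _ "\<lambda>(i,c). c(x := i)" "\<lambda>c. (c x, c(x := undefined))"])
    fix c assume c: "c \<in> fixed_colorings l A p"
    show "(case (c x, c(x := undefined)) of (i, c) \<Rightarrow> c(x := i)) = c" by simp
    have "c (p y) = c y" if "y \<in> A" for y using that c by (auto simp: fixed_colorings_def)
    then show "(c x, c(x := undefined)) \<in> {..<l} \<times> fixed_colorings l (A - {x}) p"
      using c assms pA unfolding fixed_colorings_def by (auto simp: PiE_iff extensional_def)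
    show "(case (c x, c(x := undefined)) of (i, c) \<Rightarrow>
          vdm_coeff l (\<lambda>j. \<kappa> j - of_bool (j = i) - int (color_count (A - {x}) c j))) =
         vdm_coeff l (\<lambda>i. \<kappa> i - int (color_count A c i))"
      by (auto intro!: vdm_coeff_cong simp: cc[of c _ undefined])
  next
    fix b assume b: "b \<in> {..<l} \<times> fixed_colorings l (A - {x}) p"
    obtain i c where ic: "b = (i,c)" by (cases b)
    then have c: "c \<in> fixed_colorings l (A - {x}) p" "i < l" using b by auto
    have cx: "c x = undefined" using c unfolding fixed_colorings_def by (auto simp: PiE_iff extensional_def)
    show "((case b of (i,c) \<Rightarrow> c(x := i)) x, (case b of (i,c) \<Rightarrow> c(x := i))(x := undefined)) = b"
      using cx by (auto simp: ic fun_eq_iff)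
    show "(case b of (i,c) \<Rightarrow> c(x := i)) \<in> fixed_colorings l A p"
      using c assms(2) pA px unfolding ic fixed_colorings_def by (auto simp: PiE_iff extensional_def)
  qed
  also have "\<dots> = (\<Sum>i<l. frob l (\<lambda>j. \<kappa> j - of_bool (j = i)) (A - {x}) p)"
    unfolding frob_def by (simp add: sum.cartesian_product)
  finally show ?thesis .
qed

lemma color_count_transpose:
  "color_count A (\<lambda>x. transpose a b (c x)) i = color_count A c (transpose a b i)"
  unfolding color_count_def by (metis transpose_involutory)

text \<open>Exchanging two colors permutes the colorings fixed by \<open>p\<close>, while the
  Vandermonde coefficient changes sign.\<close>

lemma frob_transpose:
  assumes ab: "a < l" "b < l" "a \<noteq> b" and p: "p permutes A"
  shows "frob l (\<lambda>i. \<kappa> (transpose a b i)) A p = - frob l \<kappa> A p"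
proof -
  define t where "t = transpose a b"
  have t: "t permutes {..<l}" unfolding t_def using ab by (intro permutes_swap_id) auto
  have tt [simp]: "t (t i) = i" for i by (simp add: t_def)
  have tl: "t i < l \<longleftrightarrow> i < l" for i using permutes_in_image[OF t, of i] by simp
  have pA: "p x \<in> A" if "x \<in> A" for x using that permutes_in_image[OF p] by blast
  have inv: "(\<lambda>x\<in>A. t ((\<lambda>x\<in>A. t (c x)) x)) = c" if "c \<in> fixed_colorings l A p" for c
    using that unfolding fixed_colorings_def by (auto simp: fun_eq_iff PiE_def extensional_def)
  have mem: "(\<lambda>x\<in>A. t (c x)) \<in> fixed_colorings l A p" if "c \<in> fixed_colorings l A p" for c
    using that pA unfolding fixed_colorings_def by (auto simp: PiE_iff tl)
  have cc: "color_count A (\<lambda>x\<in>A. t (c x)) i = color_count A c (t i)" for c i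
    using color_count_cong[of A "\<lambda>x\<in>A. t (c x)" "\<lambda>x. t (c x)" i]
    by (simp add: t_def color_count_transpose)
  have "frob l (\<lambda>i. \<kappa> (t i)) A p = (\<Sum>c\<in>fixed_colorings l A p. vdm_coeff l (\<lambda>i. \<kappa> (t i) - int (color_count A c (t i))))"
    unfolding frob_def
    by (rule sum.reindex_bij_witness[of _ "\<lambda>c. \<lambda>x\<in>A. t (c x)" "\<lambda>c. \<lambda>x\<in>A. t (c x)"],
        erule inv, erule mem, erule inv, erule mem) (simp add: cc)
  also have "\<dots> = (\<Sum>c\<in>fixed_colorings l A p. - vdm_coeff l (\<lambda>i. \<kappa> i - int (color_count A c i)))"
    using vdm_coeff_permute[OF t] ab by (intro sum.cong refl) (simp add: t_def sign_swap_id)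
  finally show ?thesis by (simp add: t_def frob_def sum_negf)
qed

lemma frob_repeated:
  assumes "a < l" "b < l" "a \<noteq> b" "\<kappa> a = \<kappa> b" "p permutes A"
  shows "frob l \<kappa> A p = 0"
proof -
  have "(\<lambda>i. \<kappa> (transpose a b i)) = \<kappa>" using assms(4) by (auto simp: fun_eq_iff transpose_def)
  then show ?thesis using frob_transpose[OF assms(1-3,5), of \<kappa>] by simp
qed

section \<open>Partitions with at most \<open>l\<close> rows and the branching rule\<close>

text \<open>The strictly decreasing exponents that belong to a partition. They are integers because
  lowering a last exponent 0 has to give -1, where every coefficient vanishes.\<close>

definition shifted :: "nat \<Rightarrow> (nat \<Rightarrow> nat) \<Rightarrow> nat \<Rightarrow> int" where
  "shifted l L i = int (L i) + int l - 1 - int i"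

definition partition_rows :: "nat \<Rightarrow> nat \<Rightarrow> (nat \<Rightarrow> nat) set" where
  "partition_rows l n = {L. (\<forall>i. L (Suc i) \<le> L i) \<and> (\<forall>i\<ge>l. L i = 0) \<and> (\<Sum>i<l. L i) = n}"

lemma partition_rows_le: "L \<in> partition_rows l n \<Longrightarrow> i \<le> j \<Longrightarrow> L j \<le> L i"
  unfolding partition_rows_def by (auto intro: lift_Suc_antimono_le)

definition weak_comps :: "nat \<Rightarrow> nat \<Rightarrow> (nat \<Rightarrow> nat) set" where
  "weak_comps l r = {\<beta>. (\<forall>i\<ge>l. \<beta> i = 0) \<and> (\<Sum>i<l. \<beta> i) = r}"

lemma finite_weak_comps: "finite (weak_comps l n)"
proof (rule finite_subset)
  show "weak_comps l n \<subseteq> {f. \<forall>i. (i \<in> {..<l} \<longrightarrow> f i \<in> {..n}) \<and> (i \<notin> {..<l} \<longrightarrow> f i = 0)}"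
  proof
    fix L assume L: "L \<in> weak_comps l n"
    have "L i \<le> n" if "i < l" for i
      using L that member_le_sum[of i "{..<l}" L] by (simp add: weak_comps_def)
    then show "L \<in> {f. \<forall>i. (i \<in> {..<l} \<longrightarrow> f i \<in> {..n}) \<and> (i \<notin> {..<l} \<longrightarrow> f i = 0)}"
      using L by (simp add: weak_comps_def)
  qed
  show "finite {f. \<forall>i. (i \<in> {..<l} \<longrightarrow> f i \<in> {..n}) \<and> (i \<notin> {..<l} \<longrightarrow> f i = (0::nat))}"
    by (rule finite_set_of_finite_funs) auto
qed

lemma finite_partition_rows: "finite (partition_rows l n)"
  by (rule finite_subset[OF _ finite_weak_comps[of l n]]) (auto simp: partition_rows_def weak_comps_def)

definition dominated :: "nat \<Rightarrow> (nat \<Rightarrow> nat) \<Rightarrow> (nat \<Rightarrow> nat) \<Rightarrow> bool" where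
  "dominated l L L' \<longleftrightarrow> (\<forall>j\<le>l. (\<Sum>i<j. L i) \<le> (\<Sum>i<j. L' i))"

lemma dominated_antisym:
  assumes "dominated l L L'" "dominated l L' L" "\<And>i. i \<ge> l \<Longrightarrow> L i = L' i"
  shows "L = L'"
proof
  fix i
  have eq: "(\<Sum>i<j. L i) = (\<Sum>i<j. L' i)" if "j \<le> l" for j
    using assms(1,2) that unfolding dominated_def by (meson le_antisym)
  show "L i = L' i"
  proof (cases "i < l")
    case True
    then show ?thesis using eq[of i] eq[of "Suc i"] by simp
  qed (use assms(3) in auto)
qed

lemma vdm_coeff_staircase: "vdm_coeff l (shifted l (\<lambda>_. 0)) = 1"
proof -
  have w: "w = id" if "w permutes {..<l}" "\<forall>i<l. w i = i" for w
    using that by (auto simp: fun_eq_iff permutes_def)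
  have iff: "(\<forall>i<l. int l - 1 - int i = int l - 1 - int (w i)) \<longleftrightarrow> w = id" if "w permutes {..<l}" for w
    using w[OF that] by (auto simp: id_def)
  have "vdm_coeff l (\<lambda>i. int l - 1 - int i) = (\<Sum>w | w permutes {..<l}. of_int (sign w) * of_bool (w = id))"
    unfolding vdm_coeff_def using iff by (intro sum.cong refl) auto
  also have "\<dots> = (\<Sum>w | w permutes {..<l}. if w = id then 1 else 0)"
    by (intro sum.cong) auto
  also have "\<dots> = 1" by (subst sum.delta) (auto simp: finite_permutations permutes_id)
  finally show ?thesis by (simp add: shifted_def[abs_def])
qed

lemma frob_empty: "frob l (shifted l (\<lambda>_. 0)) {} p = 1"
  using vdm_coeff_staircase[of l] by (simp add: frob_def fixed_colorings_def color_count_def)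

text \<open>For partitions \<open>N \<subseteq> L\<close> with \<open>|L| - |N| = m\<close> this is the number of standard tableaux of shape \<open>L/N\<close>.\<close>

fun skew_count :: "nat \<Rightarrow> (nat \<Rightarrow> nat) \<Rightarrow> (nat \<Rightarrow> nat) \<Rightarrow> nat" where
  "skew_count 0 L N = of_bool (L = N)"
| "skew_count (Suc m) L N = (\<Sum>i | L (Suc i) < L i. skew_count m (L(i := L i - 1)) N)"

lemma partition_rows_remove:
  assumes "L \<in> partition_rows l (Suc n)" "L (Suc i) < L i"
  shows "i < l" "L(i := L i - 1) \<in> partition_rows l n"
proof -
  show il: "i < l" using assms by (cases "i < l") (auto simp: partition_rows_def)
  have "(\<Sum>j<l. L j) = L i + (\<Sum>j\<in>{..<l}-{i}. L j)" using il by (simp add: sum.remove)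
  moreover have dec: "(L(i := L i - 1)) (Suc j) \<le> (L(i := L i - 1)) j" for j
  proof -
    have "L (Suc j) \<le> L j" using assms(1) by (simp add: partition_rows_def)
    then show ?thesis using assms(2) by (cases "j = i") (auto simp: fun_upd_def)
  qed
  moreover have "(\<Sum>j<l. (L(i := L i - 1)) j) = L i - 1 + (\<Sum>j\<in>{..<l}-{i}. L j)"
    using il by (simp add: sum.remove[of _ i])
  ultimately show "L(i := L i - 1) \<in> partition_rows l n"
    using assms il dec unfolding partition_rows_def by auto
qed

text \<open>A row without a corner contributes nothing: lowering it either makes two consecutive
  exponents equal, which antisymmetry kills, or makes the last exponent negative.\<close>

lemma frob_branching_step:
  assumes "finite A" "x \<in> A" "p permutes (A - {x})" and L: "L \<in> partition_rows l n"
  shows "frob l (shifted l L) A p = (\<Sum>i | L (Suc i) < L i. frob l (shifted l (L(i := L i - 1))) (A - {x}) p)"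
proof -
  let ?R = "{i. L (Suc i) < L i}"
  have R: "?R \<subseteq> {..<l}"
  proof
    fix i assume "i \<in> ?R"
    then show "i \<in> {..<l}" using L by (cases "i < l") (auto simp: partition_rows_def)
  qed
  have 0: "frob l (\<lambda>j. shifted l L j - of_bool (j = i)) (A - {x}) p = 0" if i: "i < l" "i \<notin> ?R" for i
  proof (cases "Suc i < l")
    case True
    have "L (Suc i) = L i" using i L unfolding partition_rows_def by (simp add: le_antisym)
    then show ?thesis using True assms(3)
      by (intro frob_repeated[of i l "Suc i"]) (auto simp: shifted_def)
  next
    case False
    then have "i = l - 1" "L (Suc i) = 0" using i L unfolding partition_rows_def by auto
    then show ?thesis using i by (intro frob_neg[of i]) (auto simp: shifted_def)
  qed
  have "frob l (shifted l L) A p = (\<Sum>i<l. frob l (\<lambda>j. shifted l L j - of_bool (j = i)) (A - {x}) p)"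
    by (rule frob_restrict[OF assms(1-3)])
  also have "\<dots> = (\<Sum>i\<in>?R. frob l (\<lambda>j. shifted l L j - of_bool (j = i)) (A - {x}) p)"
    by (rule sum.mono_neutral_right[OF finite_lessThan R]) (blast intro: 0)
  also have "\<dots> = (\<Sum>i\<in>?R. frob l (shifted l (L(i := L i - 1))) (A - {x}) p)"
  proof (rule sum.cong[OF refl], rule frob_cong)
    fix i j assume "i \<in> ?R"
    then have "0 < L i" by simp
    then show "shifted l L j - of_bool (j = i) = shifted l (L(i := L i - 1)) j"
      by (cases "j = i") (simp_all add: shifted_def of_nat_diff)
  qed
  finally show ?thesis .
qed

text \<open>The points of \<open>A - M\<close> are fixed by \<open>p\<close> and are taken off one
  at a time; the chains of corner removals are counted by \<open>skew_count\<close>.\<close>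

lemma frob_branching:
  assumes "finite A" "M \<subseteq> A" "card (A - M) = m" "p permutes M" "L \<in> partition_rows l (m + k)"
  shows "frob l (shifted l L) A p = (\<Sum>N\<in>partition_rows l k. of_nat (skew_count m L N) * frob l (shifted l N) M p)"
  using assms
proof (induction m arbitrary: A L)
  case 0
  then have "A = M" by auto
  have "(\<Sum>N\<in>partition_rows l k. of_nat (skew_count 0 L N) * frob l (shifted l N) M p) =
    (\<Sum>N\<in>partition_rows l k. if L = N then frob l (shifted l N) M p else 0)"
    by (intro sum.cong) auto
  also have "\<dots> = frob l (shifted l L) A p" using 0 \<open>A = M\<close> by (simp add: finite_partition_rows)
  finally show ?case by simp
next
  case (Suc m)
  have "A - M \<noteq> {}" using Suc.prems(3) by (intro notI) simp
  then obtain x where x: "x \<in> A - M" by blast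
  have px: "p permutes (A - {x})" by (rule permutes_subset[OF Suc.prems(4)]) (use Suc.prems(2) x in blast)
  have "A - {x} - M = (A - M) - {x}" by auto
  then have c: "card (A - {x} - M) = m"
    using Suc.prems(1,3) x by simp
  have L: "L \<in> partition_rows l (Suc (m + k))" using Suc.prems(5) by simp
  have "frob l (shifted l L) A p = (\<Sum>i | L (Suc i) < L i. frob l (shifted l (L(i := L i - 1))) (A - {x}) p)"
    by (rule frob_branching_step[OF Suc.prems(1) _ px L]) (use x in auto)
  also have "\<dots> = (\<Sum>i | L (Suc i) < L i. \<Sum>N\<in>partition_rows l k. of_nat (skew_count m (L(i := L i - 1)) N) * frob l (shifted l N) M p)"
  proof (intro sum.cong refl Suc.IH)
    fix i assume "i \<in> {i. L (Suc i) < L i}"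
    then show "L(i := L i - 1) \<in> partition_rows l (m + k)" using partition_rows_remove(2)[OF L] by blast
    show "M \<subseteq> A - {x}" using Suc.prems(2) x by blast
  qed (use Suc.prems(1,4) c in auto)
  also have "\<dots> = (\<Sum>N\<in>partition_rows l k. of_nat (skew_count (Suc m) L N) * frob l (shifted l N) M p)"
    by (subst sum.swap) (simp add: sum_distrib_right)
  finally show ?case .
qed

lemma partition_rows_0: "partition_rows l 0 = {\<lambda>_. 0}"
proof -
  have "L = (\<lambda>_. 0)" if "L \<in> partition_rows l 0" for L
  proof
    fix i show "L i = 0" using that by (cases "i < l") (auto simp: partition_rows_def)
  qed
  then show ?thesis by (auto simp: partition_rows_def)
qed

text \<open>Branching all the way down to the empty set: the degree of the character is the number
  of standard tableaux.\<close>

lemma frob_id: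
  assumes "finite A" "L \<in> partition_rows l (card A)"
  shows "frob l (shifted l L) A id = of_nat (skew_count (card A) L (\<lambda>_. 0))"
proof -
  show ?thesis using frob_branching[OF assms(1), of "{}" "card A" id L l 0] assms
    by (simp add: partition_rows_0 frob_empty)
qed

lemma skew_count_pos:
  "L \<in> partition_rows l n \<Longrightarrow> 0 < skew_count n L (\<lambda>_. 0)"
proof (induction n arbitrary: L)
  case 0
  then show ?case by (simp add: partition_rows_0)
next
  case (Suc n)
  \<comment> \<open>Without a corner \<open>L\<close> would be non-decreasing and hence bounded by
    its eventual value 0.\<close>
  have "\<exists>i. L (Suc i) < L i"
  proof (rule ccontr)
    assume "\<not> ?thesis"
    then have le: "L i \<le> L (Suc i)" for i by (simp add: not_less)
    have "L i \<le> L (max i l)" for i by (rule lift_Suc_mono_le[of L]) (simp_all add: le)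
    moreover have "L (max i l) = 0" for i using Suc.prems by (simp add: partition_rows_def)
    ultimately have "L i = 0" for i by (metis le_zero_eq)
    then show False using Suc.prems unfolding partition_rows_def by auto
  qed
  then obtain i where i: "L (Suc i) < L i" by blast
  have fin: "finite {i. L (Suc i) < L i}"
    by (rule finite_subset[of _ "{..<l}"]) (use partition_rows_remove(1)[OF Suc.prems] in auto)
  have "0 < skew_count n (L(i := L i - 1)) (\<lambda>_. 0)" by (rule Suc.IH[OF partition_rows_remove(2)[OF Suc.prems i]])
  also have "\<dots> \<le> skew_count (Suc n) L (\<lambda>_. 0)"
    unfolding skew_count.simps by (rule member_le_sum[OF _ _ fin]) (use i in auto)
  finally show ?case .
qed

subsection \<open>The Pieri rule\<close>

text \<open>Adjacent exchanges suffice, since the cancellation in \<open>pieri_cancel\<close> swaps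
  neighbouring entries.\<close>

definition antisymmetric :: "nat \<Rightarrow> ((nat \<Rightarrow> int) \<Rightarrow> rat) \<Rightarrow> bool" where
  "antisymmetric l V \<longleftrightarrow> (\<forall>\<theta> i. Suc i < l \<longrightarrow> V (\<lambda>j. \<theta> (transpose i (Suc i) j)) = - V \<theta>)"

lemma sum_two_upd:
  fixes f :: "nat \<Rightarrow> 'a :: ab_group_add"
  assumes "Suc i < l"
  shows "(\<Sum>j<l. f j) = f i + f (Suc i) + (\<Sum>j\<in>{..<l} - {i, Suc i}. f j)"
proof -
  have "(\<Sum>j<l. f j) = f i + (\<Sum>j\<in>{..<l} - {i}. f j)" using assms by (intro sum.remove) auto
  also have "(\<Sum>j\<in>{..<l} - {i}. f j) = f (Suc i) + (\<Sum>j\<in>{..<l} - {i} - {Suc i}. f j)"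
    using assms by (intro sum.remove) auto
  also have "{..<l} - {i} - {Suc i} = {..<l} - {i, Suc i}" by auto
  finally show ?thesis by (simp add: add.assoc)
qed

text \<open>The Pieri rule: the terms that do not come from a horizontal strip cancel in pairs, by
  exchanging the entries of \<open>\<kappa> - \<beta>\<close> at the first violation.\<close>

lemma pieri_cancel:
  fixes V :: "(nat \<Rightarrow> int) \<Rightarrow> rat"
  assumes V: "antisymmetric l V" and \<kappa>: "\<And>i. Suc i < l \<Longrightarrow> \<kappa> (Suc i) < \<kappa> i"
  shows "(\<Sum>\<beta> | \<beta> \<in> weak_comps l r \<and> (\<exists>i. Suc i < l \<and> \<kappa> i - int (\<beta> i) \<le> \<kappa> (Suc i)).
           V (\<lambda>i. \<kappa> i - int (\<beta> i))) = 0" (is "sum ?X ?B = 0")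
proof -
  define viol where "viol \<beta> i \<longleftrightarrow> Suc i < l \<and> \<kappa> i - int (\<beta> i) \<le> \<kappa> (Suc i)" for \<beta> :: "nat \<Rightarrow> nat" and i
  define fv where "fv \<beta> = (LEAST i. viol \<beta> i)" for \<beta>
  \<comment> \<open>Chosen so that passing from \<open>\<beta>\<close> to \<open>s \<beta>\<close>
    exchanges the entries \<open>i\<close> and \<open>Suc i\<close> of
    \<open>\<kappa> - \<beta>\<close>. A violation means that \<open>\<beta> i\<close> is at least
    \<open>\<kappa> i - \<kappa> (Suc i)\<close>, so both uses of \<open>nat\<close> are
    exact.\<close>
  define s where "s \<beta> = (let i = fv \<beta> in \<beta>(i := nat (\<kappa> i - \<kappa> (Suc i)) + \<beta> (Suc i),
     Suc i := nat (int (\<beta> i) - (\<kappa> i - \<kappa> (Suc i)))))" for \<beta>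
  have fv: "viol \<beta> (fv \<beta>)" "\<And>j. j < fv \<beta> \<Longrightarrow> \<not> viol \<beta> j" if b: "\<beta> \<in> ?B" for \<beta>
  proof -
    obtain i where "viol \<beta> i" using b unfolding viol_def by blast
    then show "viol \<beta> (fv \<beta>)" unfolding fv_def by (rule LeastI)
    show "\<And>j. j < fv \<beta> \<Longrightarrow> \<not> viol \<beta> j" unfolding fv_def by (rule not_less_Least)
  qed
  have main: "s \<beta> \<in> ?B" "s (s \<beta>) = \<beta>" "?X (s \<beta>) = - ?X \<beta>" if b: "\<beta> \<in> ?B" for \<beta>
  proof -
    define i where "i = fv \<beta>"
    have i: "Suc i < l" "\<kappa> i - int (\<beta> i) \<le> \<kappa> (Suc i)" using fv(1)[OF b] by (auto simp: viol_def i_def)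
    have ki: "\<kappa> (Suc i) < \<kappa> i" using \<kappa> i by blast
    have s: "s \<beta> = \<beta>(i := nat (\<kappa> i - \<kappa> (Suc i)) + \<beta> (Suc i), Suc i := nat (int (\<beta> i) - (\<kappa> i - \<kappa> (Suc i))))"
      by (simp add: s_def i_def Let_def)
    have s1: "int (s \<beta> i) = \<kappa> i - \<kappa> (Suc i) + int (\<beta> (Suc i))"
      and s2: "int (s \<beta> (Suc i)) = int (\<beta> i) - (\<kappa> i - \<kappa> (Suc i))"
      and s3: "\<And>j. j \<noteq> i \<Longrightarrow> j \<noteq> Suc i \<Longrightarrow> s \<beta> j = \<beta> j"
      using ki i by (auto simp: s)
    have "(\<Sum>j\<in>{..<l} - {i, Suc i}. int (s \<beta> j)) = (\<Sum>j\<in>{..<l} - {i, Suc i}. int (\<beta> j))"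
      by (intro sum.cong) (auto simp: s3)
    then have "(\<Sum>j<l. int (s \<beta> j)) = (\<Sum>j<l. int (\<beta> j))"
      using sum_two_upd[OF i(1), of "\<lambda>j. int (s \<beta> j)"] sum_two_upd[OF i(1), of "\<lambda>j. int (\<beta> j)"] s1 s2
      by simp
    then have "(\<Sum>j<l. s \<beta> j) = (\<Sum>j<l. \<beta> j)" by (metis of_nat_eq_iff of_nat_sum)
    then have w: "s \<beta> \<in> weak_comps l r" using b i s3 by (auto simp: weak_comps_def)
    have vi: "viol (s \<beta>) i" using i s1 by (simp add: viol_def)
    \<comment> \<open>Whether \<open>j\<close> is a violation depends on \<open>\<beta> j\<close>
      alone, so the exchange leaves the first violation in place, which makes \<open>s\<close> an
      involution.\<close>
    have vj: "\<not> viol (s \<beta>) j" if "j < i" for j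
      using fv(2)[OF b, of j] s3[of j] that by (auto simp: viol_def i_def)
    have fs: "fv (s \<beta>) = i" unfolding fv_def
      by (rule Least_equality) (use vi vj not_less in blast)+
    show "s \<beta> \<in> ?B" using w vi by (auto simp: viol_def)
    have "s (s \<beta>) j = \<beta> j" for j
    proof -
      have "s (s \<beta>) = (s \<beta>)(i := nat (\<kappa> i - \<kappa> (Suc i)) + s \<beta> (Suc i), Suc i := nat (int (s \<beta> i) - (\<kappa> i - \<kappa> (Suc i))))"
        by (simp add: s_def[of "s \<beta>"] fs Let_def)
      moreover have "nat (\<kappa> i - \<kappa> (Suc i)) + s \<beta> (Suc i) = \<beta> i" using s2 ki by linarith
      moreover have "nat (int (s \<beta> i) - (\<kappa> i - \<kappa> (Suc i))) = \<beta> (Suc i)" using s1 by simp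
      ultimately show ?thesis using s3[of j] by simp
    qed
    then show "s (s \<beta>) = \<beta>" by blast
    have "(\<lambda>j. \<kappa> j - int (s \<beta> j)) = (\<lambda>j. (\<lambda>j. \<kappa> j - int (\<beta> j)) (transpose i (Suc i) j))"
      using s1 s2 s3 by (auto simp: fun_eq_iff transpose_def)
    then show "?X (s \<beta>) = - ?X \<beta>"
      using V[unfolded antisymmetric_def, rule_format, OF i(1), of "\<lambda>j. \<kappa> j - int (\<beta> j)"] by simp
  qed
  have "sum ?X ?B = sum (\<lambda>\<beta>. - ?X \<beta>) ?B"
    by (rule sum.reindex_bij_witness[of _ s s]) (use main in auto)
  then show ?thesis by (simp add: sum_negf)
qed

text \<open>If \<open>V \<theta>\<close> is the coefficient of \<open>x\<^sup>\<theta>\<close> in a polynomial, this is the coefficient of \<open>x\<^sup>\<kappa>\<close> in its product with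
  the complete symmetric functions of degrees \<open>\<alpha> a\<close> for \<open>a \<in> J\<close>.\<close>

definition comp_sum :: "nat \<Rightarrow> (nat \<Rightarrow> nat) \<Rightarrow> nat set \<Rightarrow> ((nat \<Rightarrow> int) \<Rightarrow> rat) \<Rightarrow> (nat \<Rightarrow> int) \<Rightarrow> rat" where
  "comp_sum l \<alpha> J V \<kappa> = (\<Sum>N\<in>PiE J (\<lambda>a. weak_comps l (\<alpha> a)). V (\<lambda>i. \<kappa> i - (\<Sum>a\<in>J. int (N a i))))"

lemma comp_sum_insert:
  assumes "finite J" "a \<notin> J"
  shows "comp_sum l \<alpha> (insert a J) V \<kappa> =
    (\<Sum>\<beta>\<in>weak_comps l (\<alpha> a). comp_sum l \<alpha> J V (\<lambda>i. \<kappa> i - int (\<beta> i)))"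
proof -
  have eq: "(\<Sum>b\<in>J. int ((N(a := \<beta>)) b i)) = (\<Sum>b\<in>J. int (N b i))" for N \<beta> i
    using assms by (intro sum.cong) auto
  have "comp_sum l \<alpha> (insert a J) V \<kappa> = (\<Sum>(\<beta>,N)\<in>weak_comps l (\<alpha> a) \<times> PiE J (\<lambda>a. weak_comps l (\<alpha> a)).
      V (\<lambda>i. \<kappa> i - int (\<beta> i) - (\<Sum>a\<in>J. int (N a i))))"
    unfolding comp_sum_def
  proof (rule sum.reindex_bij_witness[of _ "\<lambda>(\<beta>,N). N(a := \<beta>)" "\<lambda>N. (N a, N(a := undefined))"])
    fix N assume N: "N \<in> PiE (insert a J) (\<lambda>a. weak_comps l (\<alpha> a))"
    show "(case (N a, N(a := undefined)) of (\<beta>, N) \<Rightarrow> N(a := \<beta>)) = N" by simp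
    show "(N a, N(a := undefined)) \<in> weak_comps l (\<alpha> a) \<times> PiE J (\<lambda>a. weak_comps l (\<alpha> a))"
      using N assms(2) by (auto simp: PiE_iff extensional_def)
    show "(case (N a, N(a := undefined)) of (\<beta>, N) \<Rightarrow> V (\<lambda>i. \<kappa> i - int (\<beta> i) - (\<Sum>a\<in>J. int (N a i)))) =
         V (\<lambda>i. \<kappa> i - (\<Sum>a\<in>insert a J. int (N a i)))"
      using assms(1,2) eq[of N undefined] by (simp del: fun_upd_apply add: diff_diff_eq)
  next
    fix b assume b: "b \<in> weak_comps l (\<alpha> a) \<times> PiE J (\<lambda>a. weak_comps l (\<alpha> a))"
    obtain \<beta> N where bN: "b = (\<beta>, N)" by (cases b)
    have "N a = undefined" using b assms(2) by (auto simp: bN PiE_iff extensional_def)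
    then show "((case b of (\<beta>, N) \<Rightarrow> N(a := \<beta>)) a, (case b of (\<beta>, N) \<Rightarrow> N(a := \<beta>))(a := undefined)) = b"
      by (auto simp: bN)
    show "(case b of (\<beta>, N) \<Rightarrow> N(a := \<beta>)) \<in> PiE (insert a J) (\<lambda>a. weak_comps l (\<alpha> a))"
      using b by (auto simp: bN PiE_iff extensional_def)
  qed
  then show ?thesis by (simp add: comp_sum_def sum.cartesian_product)
qed

text \<open>Multiplication by a symmetric function preserves antisymmetry, so
  \<open>pieri_cancel\<close> still applies after further strips have been split off.\<close>

lemma comp_sum_antisymmetric:
  assumes J: "finite J" and V: "antisymmetric l V"
  shows "antisymmetric l (comp_sum l \<alpha> J V)"
  using J
proof (induction J rule: finite_induct)
  case empty
  then show ?case using V by (simp add: antisymmetric_def comp_sum_def)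
next
  case (insert a J)
  let ?W = "comp_sum l \<alpha> J V"
  show ?case unfolding antisymmetric_def
  proof (intro allI impI)
    fix \<theta> :: "nat \<Rightarrow> int" and i assume i: "Suc i < l"
    let ?t = "transpose i (Suc i)"
    have tp: "?t permutes {..<l}" using i by (intro permutes_swap_id) auto
    have mem: "(\<lambda>j. \<beta> (?t j)) \<in> weak_comps l r" if "\<beta> \<in> weak_comps l r" for \<beta> r
    proof -
      have "(\<Sum>j<l. \<beta> (?t j)) = (\<Sum>j<l. \<beta> j)"
        using sum.permute[OF tp, of \<beta>] by (simp add: o_def)
      moreover have "\<beta> (?t j) = 0" if "l \<le> j" for j
        using that i \<open>\<beta> \<in> weak_comps l r\<close> by (auto simp: weak_comps_def transpose_def)
      ultimately show ?thesis using that by (simp add: weak_comps_def)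
    qed
    have "comp_sum l \<alpha> (insert a J) V (\<lambda>j. \<theta> (?t j)) = (\<Sum>\<beta>\<in>weak_comps l (\<alpha> a). ?W (\<lambda>j. \<theta> (?t j) - int (\<beta> j)))"
      by (rule comp_sum_insert) (use insert in auto)
    also have "\<dots> = (\<Sum>\<beta>\<in>weak_comps l (\<alpha> a). ?W (\<lambda>j. \<theta> (?t j) - int (\<beta> (?t j))))"
      by (rule sum.reindex_bij_witness[of _ "\<lambda>\<beta> j. \<beta> (?t j)" "\<lambda>\<beta> j. \<beta> (?t j)"]) (auto simp: mem)
    also have "\<dots> = (\<Sum>\<beta>\<in>weak_comps l (\<alpha> a). - ?W (\<lambda>j. \<theta> j - int (\<beta> j)))"
    proof (rule sum.cong[OF refl])
      fix \<beta>
      show "?W (\<lambda>j. \<theta> (?t j) - int (\<beta> (?t j))) = - ?W (\<lambda>j. \<theta> j - int (\<beta> j))"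
        using insert.IH[unfolded antisymmetric_def, rule_format, OF i, of "\<lambda>j. \<theta> j - int (\<beta> j)"] .
    qed
    also have "\<dots> = - comp_sum l \<alpha> (insert a J) V \<theta>"
      by (subst comp_sum_insert) (use insert in \<open>auto simp: sum_negf\<close>)
    finally show "comp_sum l \<alpha> (insert a J) V (\<lambda>j. \<theta> (?t j)) = - comp_sum l \<alpha> (insert a J) V \<theta>" .
  qed
qed

lemma comp_sum_neg:
  assumes "\<And>\<theta>. \<theta> i < 0 \<Longrightarrow> V \<theta> = 0" "\<kappa> i < 0"
  shows "comp_sum l \<alpha> J V \<kappa> = 0"
  unfolding comp_sum_def
proof (intro sum.neutral ballI assms(1))
  fix N
  have "(\<Sum>a\<in>J. int (N a i)) \<ge> 0" by (simp add: sum_nonneg)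
  then show "\<kappa> i - (\<Sum>a\<in>J. int (N a i)) < 0" using assms(2) by linarith
qed

text \<open>Removing \<open>j\<close> horizontal strips from a partition removes at most as many boxes as its first
  \<open>j\<close> rows contain.\<close>

lemma comp_sum_dominance:
  assumes "finite J" "finite J'" "J \<inter> J' = {}" and V: "antisymmetric l V"
    and V0: "\<And>\<theta> i. i < l \<Longrightarrow> \<theta> i < 0 \<Longrightarrow> V \<theta> = 0"
    and L: "L \<in> partition_rows l n" and big: "(\<Sum>i<card J. L i) < (\<Sum>a\<in>J. \<alpha> a)"
  shows "comp_sum l \<alpha> (J \<union> J') V (shifted l L) = 0"
  using assms(1,3) L big
proof (induction J arbitrary: L n rule: finite_induct)
  case empty
  then show ?case by simp
next
  case (insert a J)
  let ?W = "comp_sum l \<alpha> (J \<union> J') V"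
  let ?strip = "\<lambda>\<beta>. \<forall>i. Suc i < l \<longrightarrow> \<not> shifted l L i - int (\<beta> i) \<le> shifted l L (Suc i)"
  have dec: "\<And>i. Suc i < l \<Longrightarrow> shifted l L (Suc i) < shifted l L i"
  proof -
    fix i
    have "L (Suc i) \<le> L i" using insert.prems(2) by (simp add: partition_rows_def)
    then show "shifted l L (Suc i) < shifted l L i" by (simp add: shifted_def)
  qed
  have "comp_sum l \<alpha> (insert a J \<union> J') V (shifted l L) = (\<Sum>\<beta>\<in>weak_comps l (\<alpha> a). ?W (\<lambda>i. shifted l L i - int (\<beta> i)))"
    using insert assms(2) by (simp add: comp_sum_insert)
  \<comment> \<open>Only the terms that \<open>pieri_cancel\<close> removes are kept. A genuine
    horizontal strip leaves either a negative exponent or a smaller partition, to which the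
    induction hypothesis applies, so its term is 0.\<close>
  also have "\<dots> = (\<Sum>\<beta> | \<beta> \<in> weak_comps l (\<alpha> a) \<and> (\<exists>i. Suc i < l \<and> shifted l L i - int (\<beta> i) \<le> shifted l L (Suc i)). ?W (\<lambda>i. shifted l L i - int (\<beta> i)))"
  proof (rule sum.mono_neutral_right[OF finite_weak_comps], blast, rule ballI)
    fix \<beta> assume "\<beta> \<in> weak_comps l (\<alpha> a) - {\<beta>. \<beta> \<in> weak_comps l (\<alpha> a) \<and> (\<exists>i. Suc i < l \<and> shifted l L i - int (\<beta> i) \<le> shifted l L (Suc i))}"
    then have \<beta>: "\<beta> \<in> weak_comps l (\<alpha> a)" and strip: "?strip \<beta>" by auto
    show "?W (\<lambda>i. shifted l L i - int (\<beta> i)) = 0"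
    proof (cases "\<exists>i<l. shifted l L i - int (\<beta> i) < 0")
      case True
      then show ?thesis using V0 by (blast intro: comp_sum_neg)
    next
      case False
      have lz: "L i = 0" if "l \<le> i" for i using insert.prems(2) that by (simp add: partition_rows_def)
      have bz: "\<beta> i = 0" if "l \<le> i" for i using \<beta> that by (simp add: weak_comps_def)
      have b1: "L (Suc i) + \<beta> i \<le> L i" for i
      proof -
        consider "Suc i < l" | "Suc i = l" | "l \<le> i" by linarith
        then show ?thesis
        proof cases
          case 1
          then have "\<not> shifted l L i - int (\<beta> i) \<le> shifted l L (Suc i)" using strip by blast
          then show ?thesis by (simp add: shifted_def)
        next
          case 2
          then have "\<not> shifted l L i - int (\<beta> i) < 0" using False by auto
          then show ?thesis using 2 lz by (simp add: shifted_def)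
        next
          case 3
          then show ?thesis using lz bz by simp
        qed
      qed
      define L' where "L' i = L i - \<beta> i" for i
      have L'L: "int (L' i) = int (L i) - int (\<beta> i)" for i using b1[of i] by (simp add: L'_def)
      have eq: "(\<lambda>i. shifted l L i - int (\<beta> i)) = shifted l L'" by (auto simp: shifted_def L'L)
      have "L' (Suc i) \<le> L' i" for i using b1[of i] by (simp add: L'_def)
      then have mem: "L' \<in> partition_rows l (\<Sum>i<l. L' i)" by (auto simp: partition_rows_def L'_def lz)
      have sb: "(\<Sum>i<l. \<beta> i) = \<alpha> a" using \<beta> by (simp add: weak_comps_def)
      have "(\<Sum>i<card J. L' i) + \<alpha> a \<le> (\<Sum>i<Suc (card J). L i)"
      proof -
        \<comment> \<open>The strip condition \<open>\<beta> i \<le> L i - L (Suc i)\<close>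
          telescopes: all that is removed from row \<open>m\<close> on fits into row
          \<open>m\<close> of \<open>L\<close>. Taking the larger of \<open>l\<close> and
          \<open>card J\<close> for \<open>q\<close> collects the whole strip.\<close>
        have key: "(\<Sum>i<m. L' i) + (\<Sum>i<q. \<beta> i) + L q \<le> (\<Sum>i<Suc m. L i)" if "m \<le> q" for m q
          using that
        proof (induction q rule: dec_induct)
          case base
          have "(\<Sum>i<m. L' i) + (\<Sum>i<m. \<beta> i) = (\<Sum>i<m. L i)"
            unfolding sum.distrib[symmetric]
          proof (rule sum.cong[OF refl])
            fix i show "L' i + \<beta> i = L i" using b1[of i] by (simp add: L'_def)
          qed
          then show ?case by simp
        next
          case (step q)
          then show ?case using b1[of q] by simp
        qed
        have "(\<Sum>i<max l (card J). \<beta> i) = (\<Sum>i<l. \<beta> i)"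
          by (rule sum.mono_neutral_right) (auto simp: bz)
        then show ?thesis using key[of "card J" "max l (card J)"] sb by simp
      qed
      then have "(\<Sum>i<card J. L' i) < (\<Sum>a\<in>J. \<alpha> a)" using insert.prems(3) insert.hyps by simp
      then show ?thesis unfolding eq using insert.prems(1) by (intro insert.IH[OF _ mem]) auto
    qed
  qed
  also have "\<dots> = 0"
  proof (rule pieri_cancel)
    show "antisymmetric l ?W" by (rule comp_sum_antisymmetric[OF _ V]) (use insert.hyps assms(2) in auto)
  qed (rule dec)
  finally show ?case .
qed

subsection \<open>Orthogonality of the Frobenius characters\<close>

text \<open>Young subgroups, encoded by colorings instead of set partitions so that row groups,
  column groups and the colorings of Frobenius' formula are all instances.\<close>

definition color_stab :: "'a set \<Rightarrow> ('a \<Rightarrow> 'b) \<Rightarrow> ('a \<Rightarrow> 'a) set" where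
  "color_stab A c = {p. p permutes A \<and> (\<forall>x\<in>A. c (p x) = c x)}"

lemma finite_color_stab: "finite A \<Longrightarrow> finite (color_stab A c)"
  unfolding color_stab_def by (rule finite_subset[OF _ finite_permutations]) auto

lemma id_color_stab: "id \<in> color_stab A c"
  by (simp add: color_stab_def permutes_id)

lemma card_color_stab_pos: "finite A \<Longrightarrow> card (color_stab A c) > 0"
  using finite_color_stab id_color_stab by (metis card_gt_0_iff empty_iff)

lemma same_counts_permutes:
  assumes "finite A" "\<And>v. card {x \<in> A. c x = v} = card {x \<in> A. c' x = v}"
  obtains g where "g permutes A" "\<And>x. x \<in> A \<Longrightarrow> c x = c' (g x)"
proof -
  have "image_mset c (mset_set A) = image_mset c' (mset_set A)"
    by (rule multiset_eqI) (simp add: count_image_mset_eq_card_vimage assms)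
  then show ?thesis using image_mset_eq_implies_permutes[OF assms(1)] that by metis
qed

text \<open>Orbit counting. The stabilizer of \<open>c\<close> acts transitively on the colorings
  with the joint counts of \<open>c0\<close>, and each fiber of
  \<open>g \<mapsto> c0 \<circ> g\<close> over such a \<open>c'\<close> is a coset of the joint
  stabilizer of \<open>c\<close> and \<open>c'\<close>.\<close>

lemma sum_stab_refinement:
  fixes c :: "'a \<Rightarrow> 'b" and l :: nat
  assumes A: "finite A" and c0: "c0 \<in> C" and C: "C = A \<rightarrow>\<^sub>E {..<l}"
  defines "N \<equiv> \<lambda>c' a i. card {x \<in> A. c x = a \<and> c' x = i}"
  shows "(\<Sum>c' | c' \<in> C \<and> N c' = N c0. card (color_stab A (\<lambda>x. (c x, c' x)))) = card (color_stab A c)"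
proof -
  let ?T = "{c' \<in> C. N c' = N c0}"
  let ?F = "\<lambda>g. \<lambda>x\<in>A. c0 (g x)"
  have "finite C" using A by (simp add: C finite_PiE)
  then have finT: "finite ?T" by simp
  have FT: "?F g \<in> ?T" if g: "g \<in> color_stab A c" for g
  proof -
    have gp: "g permutes A" and gc: "\<And>x. x \<in> A \<Longrightarrow> c (g x) = c x" using g by (auto simp: color_stab_def)
    have gA: "g x \<in> A \<longleftrightarrow> x \<in> A" for x by (rule permutes_in_image[OF gp])
    have "card {x \<in> A. c x = a \<and> c0 (g x) = i} = card {x \<in> A. c x = a \<and> c0 x = i}" for a i
    proof -
      have "g ` {x \<in> A. c x = a \<and> c0 (g x) = i} = {x \<in> A. c x = a \<and> c0 x = i}"
      proof (intro equalityI subsetI)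
        fix y assume y: "y \<in> {x \<in> A. c x = a \<and> c0 x = i}"
        then obtain x where "x \<in> A" "y = g x" using permutes_image[OF gp] by blast
        then show "y \<in> g ` {x \<in> A. c x = a \<and> c0 (g x) = i}" using y gc by auto
      qed (use gc gA in auto)
      moreover have "inj_on g {x \<in> A. c x = a \<and> c0 (g x) = i}"
        by (rule inj_on_subset[OF permutes_inj[OF gp] subset_UNIV])
      ultimately show ?thesis using card_image by fastforce
    qed
    then have "N (?F g) = N c0" unfolding N_def by (auto simp: fun_eq_iff cong: conj_cong)
    moreover have "?F g \<in> C" using c0 gA unfolding C by auto
    ultimately show ?thesis by blast
  qed
  have fiber: "card {g \<in> color_stab A c. ?F g = c'} = card (color_stab A (\<lambda>x. (c x, c' x)))" if c': "c' \<in> ?T" for c'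
  proof -
    have "card {x \<in> A. (c x, c' x) = v} = card {x \<in> A. (c x, c0 x) = v}" for v
      using c' by (cases v) (simp add: N_def fun_eq_iff)
    then obtain g0 where g0: "g0 permutes A" and g0c: "\<And>x. x \<in> A \<Longrightarrow> (c x, c' x) = (c (g0 x), c0 (g0 x))"
      using same_counts_permutes[OF A, of "\<lambda>x. (c x, c' x)" "\<lambda>x. (c x, c0 x)"] by metis
    let ?i = "inv_into UNIV g0"
    have ip: "?i permutes A" by (rule permutes_inv[OF g0])
    have inv: "g0 (?i x) = x" "?i (g0 x) = x" for x using g0 by (simp_all add: permutes_inverses)
    have ext: "c' x = undefined" if "x \<notin> A" for x using c' that by (auto simp: C PiE_iff extensional_def)
    have "bij_betw (\<lambda>s. g0 \<circ> s) (color_stab A (\<lambda>x. (c x, c' x))) {g \<in> color_stab A c. ?F g = c'}"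
    proof (rule bij_betw_byWitness[of _ "\<lambda>g. ?i \<circ> g"])
      show "(\<lambda>s. g0 \<circ> s) ` color_stab A (\<lambda>x. (c x, c' x)) \<subseteq> {g \<in> color_stab A c. ?F g = c'}"
      proof (rule image_subsetI)
        fix s assume "s \<in> color_stab A (\<lambda>x. (c x, c' x))"
        then have sp: "s permutes A" and s: "\<And>x. x \<in> A \<Longrightarrow> c (s x) = c x \<and> c' (s x) = c' x"
          by (auto simp: color_stab_def)
        have sA: "s x \<in> A" if "x \<in> A" for x using that permutes_in_image[OF sp] by blast
        have "g0 \<circ> s permutes A" by (rule permutes_compose[OF sp g0])
        then show "g0 \<circ> s \<in> {g \<in> color_stab A c. ?F g = c'}"
          using g0c s sA ext by (auto simp: color_stab_def fun_eq_iff)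
      qed
      show "(\<lambda>g. ?i \<circ> g) ` {g \<in> color_stab A c. ?F g = c'} \<subseteq> color_stab A (\<lambda>x. (c x, c' x))"
      proof (rule image_subsetI)
        fix g assume "g \<in> {g \<in> color_stab A c. ?F g = c'}"
        then have gp: "g permutes A" and gc: "\<And>x. x \<in> A \<Longrightarrow> c (g x) = c x" and Fg: "?F g = c'"
          by (auto simp: color_stab_def)
        have gc0: "c0 (g x) = c' x" if "x \<in> A" for x using that Fg by auto
        have "?i \<circ> g permutes A" by (rule permutes_compose[OF gp ip])
        moreover have "?i (g x) \<in> A" if "x \<in> A" for x
          using that permutes_in_image[OF ip] permutes_in_image[OF gp] by blast
        ultimately show "?i \<circ> g \<in> color_stab A (\<lambda>x. (c x, c' x))"
          using g0c[of "?i (g _)"] gc gc0 by (auto simp: color_stab_def inv)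
      qed
    qed (simp_all add: fun_eq_iff inv)
    then show ?thesis by (rule bij_betw_same_card[symmetric])
  qed
  have "card (color_stab A c) = (\<Sum>g\<in>color_stab A c. 1)" by simp
  also have "\<dots> = (\<Sum>c'\<in>?T. \<Sum>g | g \<in> color_stab A c \<and> ?F g = c'. 1)"
    by (rule sum.group[symmetric, OF finite_color_stab[OF A] finT]) (use FT in blast)
  also have "\<dots> = (\<Sum>c'\<in>?T. card (color_stab A (\<lambda>x. (c x, c' x))))"
    by (rule sum.cong[OF refl]) (use fiber in simp)
  finally show ?thesis by simp
qed

lemma exists_coloring:
  assumes "finite B" "\<beta> \<in> weak_comps l (card B)"
  shows "\<exists>f. (\<forall>x\<in>B. f x < l) \<and> (\<forall>i. card {x \<in> B. f x = i} = \<beta> i)"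
  using assms
proof (induction B arbitrary: \<beta> rule: finite_induct)
  case empty
  have "\<beta> i = 0" for i using empty by (cases "i < l") (auto simp: weak_comps_def)
  then show ?case by simp
next
  case (insert x B)
  have s: "(\<Sum>i<l. \<beta> i) = Suc (card B)" using insert by (simp add: weak_comps_def)
  then obtain i where i: "i < l" "\<beta> i \<noteq> 0" by (metis lessThan_iff nat.distinct(1) sum.neutral)
  let ?b = "\<beta>(i := \<beta> i - 1)"
  have "(\<Sum>j<l. \<beta> j) = \<beta> i + (\<Sum>j\<in>{..<l}-{i}. \<beta> j)" using i by (simp add: sum.remove)
  moreover have "(\<Sum>j<l. ?b j) = \<beta> i - 1 + (\<Sum>j\<in>{..<l}-{i}. \<beta> j)"
    using i by (simp add: sum.remove[of _ i])
  ultimately have "?b \<in> weak_comps l (card B)" using s i insert.prems by (simp add: weak_comps_def)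
  from insert.IH[OF this] obtain f where f: "\<forall>y\<in>B. f y < l" "\<And>j. card {y \<in> B. f y = j} = ?b j" by blast
  have "card {y \<in> insert x B. (f(x := i)) y = j} = \<beta> j" for j
  proof -
    have "{y \<in> insert x B. (f(x := i)) y = j} = {y \<in> B. f y = j} \<union> (if j = i then {x} else {})"
      using insert.hyps by auto
    then show ?thesis using f(2)[of j] insert.hyps i by (auto simp: card_insert_if)
  qed
  then show ?case using f(1) i by (intro exI[of _ "f(x := i)"]) auto
qed

lemma color_count_weak_comps:
  assumes "finite A" "\<And>x. x \<in> A \<Longrightarrow> c x < l"
  shows "color_count A c \<in> weak_comps l (card A)"
proof -
  have "card A = (\<Sum>i<l. card {x \<in> A. c x = i})"
  proof -
    have "c ` A \<subseteq> {..<l}" using assms(2) by auto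
    then show ?thesis using sum.group[of A "{..<l}" c "\<lambda>_. 1::nat"] assms(1) by simp
  qed
  moreover have "color_count A c i = 0" if "i \<ge> l" for i
    using assms that unfolding color_count_def by (metis (mono_tags, lifting) card.empty empty_Collect_eq not_le)
  ultimately show ?thesis by (simp add: weak_comps_def color_count_def)
qed

text \<open>Averaging over a Young subgroup turns power sums into complete symmetric functions, one
  for each color class. The pairs of a permutation and a coloring fixed by it are sorted by the
  table of joint counts of the two colorings.\<close>

lemma sum_stab_frob:
  assumes A: "finite A" and c: "\<And>x. x \<in> A \<Longrightarrow> c x < l"
  shows "(\<Sum>p\<in>color_stab A c. frob l \<kappa> A p) =
    of_nat (card (color_stab A c)) * comp_sum l (color_count A c) {..<l} (vdm_coeff l) \<kappa>"
proof -
  let ?C = "A \<rightarrow>\<^sub>E {..<l}"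
  let ?N = "\<lambda>c' a i. card {x \<in> A. c x = a \<and> c' x = i}"
  let ?V = "\<lambda>c'. vdm_coeff l (\<lambda>i. \<kappa> i - int (color_count A c' i))"
  let ?W = "\<lambda>N. vdm_coeff l (\<lambda>i. \<kappa> i - (\<Sum>a<l. int (N a i)))"
  let ?st = "\<lambda>c'. color_stab A (\<lambda>x. (c x, c' x))"
  have finC: "finite ?C" using A by (simp add: finite_PiE)
  have VW: "?V c' = ?W (?N c')" for c'
  proof -
    have "color_count A c' i = (\<Sum>a<l. ?N c' a i)" for i
    proof -
      have "card {x \<in> A. c' x = i} = (\<Sum>a<l. card {x \<in> {x \<in> A. c' x = i}. c x = a})"
      proof -
        have "c ` {x \<in> A. c' x = i} \<subseteq> {..<l}" using c by auto
        then show ?thesis using sum.group[of "{x \<in> A. c' x = i}" "{..<l}" c "\<lambda>_. 1::nat"] A by simp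
      qed
      then show ?thesis by (simp add: color_count_def conj_ac)
    qed
    then show ?thesis by simp
  qed
  have "(\<Sum>p\<in>color_stab A c. frob l \<kappa> A p) =
    (\<Sum>p\<in>color_stab A c. \<Sum>c'\<in>?C. if (\<forall>x\<in>A. c' (p x) = c' x) then ?V c' else 0)"
    unfolding frob_def fixed_colorings_def by (intro sum.cong refl sum.inter_filter[OF finC])
  also have "\<dots> = (\<Sum>c'\<in>?C. \<Sum>p\<in>color_stab A c. if (\<forall>x\<in>A. c' (p x) = c' x) then ?V c' else 0)"
    by (rule sum.swap)
  also have "\<dots> = (\<Sum>c'\<in>?C. of_nat (card (?st c')) * ?W (?N c'))"
  proof (rule sum.cong[OF refl])
    fix c' assume "c' \<in> ?C"
    have "?st c' = {p \<in> color_stab A c. \<forall>x\<in>A. c' (p x) = c' x}" by (auto simp: color_stab_def)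
    then show "(\<Sum>p\<in>color_stab A c. if (\<forall>x\<in>A. c' (p x) = c' x) then ?V c' else 0) = of_nat (card (?st c')) * ?W (?N c')"
      by (simp add: sum.inter_filter[OF finite_color_stab[OF A], symmetric] VW)
  qed
  also have "\<dots> = (\<Sum>N\<in>?N ` ?C. \<Sum>c' | c' \<in> ?C \<and> ?N c' = N. of_nat (card (?st c')) * ?W (?N c'))"
    by (rule sum.image_gen[OF finC])
  also have "\<dots> = (\<Sum>N\<in>?N ` ?C. of_nat (card (color_stab A c)) * ?W N)"
  proof (rule sum.cong[OF refl])
    fix N assume "N \<in> ?N ` ?C"
    then obtain c0 where c0: "c0 \<in> ?C" "N = ?N c0" by blast
    have "(\<Sum>c' | c' \<in> ?C \<and> ?N c' = N. of_nat (card (?st c')) * ?W (?N c')) =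
      of_nat (\<Sum>c' | c' \<in> ?C \<and> ?N c' = N. card (?st c')) * ?W N"
      unfolding of_nat_sum sum_distrib_right by (rule sum.cong) auto
    then show "(\<Sum>c' | c' \<in> ?C \<and> ?N c' = N. of_nat (card (?st c')) * ?W (?N c')) = of_nat (card (color_stab A c)) * ?W N"
      using sum_stab_refinement[OF A c0(1) refl, of c] c0(2) by simp
  qed
  also have "\<dots> = of_nat (card (color_stab A c)) * (\<Sum>N\<in>?N ` ?C. ?W N)" by (simp add: sum_distrib_left)
  also have "(\<Sum>N\<in>?N ` ?C. ?W N) = comp_sum l (color_count A c) {..<l} (vdm_coeff l) \<kappa>"
    unfolding comp_sum_def
  \<comment> \<open>Tables of joint counts are 0 outside \<open>{..<l}\<close>, members of
    \<open>PiE\<close> are undefined there; the two maps translate between these defaults.\<close>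
  proof (rule sum.reindex_bij_witness[of _ "\<lambda>N a. if a < l then N a else (\<lambda>_. 0)" "\<lambda>N. \<lambda>a\<in>{..<l}. N a"])
    fix N assume "N \<in> ?N ` ?C"
    then obtain c0 where c0: "c0 \<in> ?C" "N = ?N c0" by blast
    have "N a i = 0" if "\<not> a < l" for a i
    proof -
      have "{x \<in> A. c x = a \<and> c0 x = i} = {}" using c that by auto
      then show ?thesis by (simp only: c0(2) card.empty)
    qed
    then have "N a = (\<lambda>_. 0)" if "\<not> a < l" for a using that by blast
    then show "(\<lambda>a. if a < l then (\<lambda>a\<in>{..<l}. N a) a else (\<lambda>_. 0)) = N" by (auto simp: fun_eq_iff)
    show "(\<lambda>a\<in>{..<l}. N a) \<in> PiE {..<l} (\<lambda>a. weak_comps l (color_count A c a))"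
    proof (rule restrict_PiE_iff[THEN iffD2], rule ballI)
      fix a
      have "color_count {x \<in> A. c x = a} c0 \<in> weak_comps l (card {x \<in> A. c x = a})"
        using A c0 by (intro color_count_weak_comps) auto
      moreover have "color_count {x \<in> A. c x = a} c0 = N a"
        unfolding c0 color_count_def by (auto simp: fun_eq_iff conj_ac)
      ultimately show "N a \<in> weak_comps l (color_count A c a)" by (simp add: color_count_def)
    qed
    show "vdm_coeff l (\<lambda>i. \<kappa> i - (\<Sum>a<l. int ((\<lambda>a\<in>{..<l}. N a) a i))) = ?W N"
      by (intro vdm_coeff_cong) simp
  next
    fix N assume N: "N \<in> PiE {..<l} (\<lambda>a. weak_comps l (color_count A c a))"
    let ?M = "\<lambda>a. if a < l then N a else (\<lambda>_. 0)"
    show "(\<lambda>a\<in>{..<l}. ?M a) = N" using N by (auto simp: fun_eq_iff PiE_iff extensional_def)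
    \<comment> \<open>Every table with the prescribed row sums is realized, by coloring each class
      of \<open>c\<close> separately.\<close>
    have "\<exists>f. (\<forall>x\<in>{x \<in> A. c x = a}. f x < l) \<and> (\<forall>i. card {x \<in> {x \<in> A. c x = a}. f x = i} = N a i)" if "a < l" for a
      using N that A by (intro exists_coloring) (auto simp: PiE_iff color_count_def)
    then have "\<forall>a. \<exists>f. a < l \<longrightarrow> (\<forall>x\<in>{x \<in> A. c x = a}. f x < l) \<and> (\<forall>i. card {x \<in> {x \<in> A. c x = a}. f x = i} = N a i)"
      by blast
    from choice[OF this] obtain f where f: "\<And>a x. a < l \<Longrightarrow> x \<in> A \<Longrightarrow> c x = a \<Longrightarrow> f a x < l"
      "\<And>a i. a < l \<Longrightarrow> card {x \<in> {x \<in> A. c x = a}. f a x = i} = N a i"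
      by blast
    let ?c = "\<lambda>x\<in>A. f (c x) x"
    have cC: "?c \<in> ?C" using f(1) c by auto
    have "?N ?c a i = ?M a i" for a i
    proof (cases "a < l")
      case True
      have "{x \<in> A. c x = a \<and> ?c x = i} = {x \<in> {x \<in> A. c x = a}. f a x = i}" by auto
      then show ?thesis using f(2)[OF True, of i] True by simp
    next
      case False
      then have "{x \<in> A. c x = a \<and> ?c x = i} = {}" using c by auto
      then show ?thesis using False by (simp only: card.empty if_False)
    qed
    then have NM: "?N ?c = ?M" by blast
    show "?M \<in> ?N ` ?C" using imageI[OF cC, of ?N] by (simp only: NM)
  qed
  finally show ?thesis .
qed

lemma vdm_coeff_antisymmetric: "antisymmetric l (vdm_coeff l)"
  unfolding antisymmetric_def
proof (intro allI impI)
  fix \<theta> :: "nat \<Rightarrow> int" and i assume i: "Suc i < l"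
  have "transpose i (Suc i) permutes {..<l}" using i by (intro permutes_swap_id) auto
  from vdm_coeff_permute[OF this, of \<theta>]
  show "vdm_coeff l (\<lambda>j. \<theta> (transpose i (Suc i) j)) = - vdm_coeff l \<theta>" by (simp add: sign_swap_id)
qed

section \<open>Triangularity in the dominance order\<close>

text \<open>If dominance failed at \<open>j\<close>, the strips of the first \<open>j\<close> colors
  would have to remove more boxes than the first \<open>j\<close> rows of \<open>L\<close> hold, and
  the sum would vanish.\<close>

lemma sum_stab_frob_dominated:
  assumes A: "finite A" and c: "\<And>x. x \<in> A \<Longrightarrow> c x < l" and L: "L \<in> partition_rows l n"
    and nz: "(\<Sum>p\<in>color_stab A c. frob l (shifted l L) A p) \<noteq> 0"
  shows "dominated l (color_count A c) L"
  unfolding dominated_def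
proof (intro allI impI, rule ccontr)
  fix j assume j: "j \<le> l" and "\<not> (\<Sum>i<j. color_count A c i) \<le> (\<Sum>i<j. L i)"
  then have "comp_sum l (color_count A c) ({..<j} \<union> {j..<l}) (vdm_coeff l) (shifted l L) = 0"
    by (intro comp_sum_dominance[OF _ _ _ vdm_coeff_antisymmetric vdm_coeff_neg L]) auto
  moreover have "{..<j} \<union> {j..<l} = {..<l}" using j by auto
  ultimately show False using nz sum_stab_frob[OF A c, where \<kappa> = "shifted l L"] by simp
qed

lemma permutes_partial_sum_ge:
  fixes w :: "nat \<Rightarrow> nat"
  assumes "w permutes {..<l}" "j \<le> l"
  shows "(\<Sum>i<j. i) \<le> (\<Sum>i<j. w i)"
proof -
  have inj: "inj_on w {..<j}" using permutes_inj[OF assms(1)] inj_on_subset by blast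
  have "(\<Sum>i<j. i) = \<Sum>{0..<card (w ` {..<j})}" using card_image[OF inj] by (simp add: atLeast0LessThan)
  also have "\<dots> \<le> \<Sum>(w ` {..<j})" by (rule card_sum_le_nat_sum)
  also have "\<dots> = (\<Sum>i<j. w i)" using sum.reindex[OF inj, of "\<lambda>x. x"] by simp
  finally show ?thesis .
qed

text \<open>A nonzero coefficient means that the exponents are the staircase permuted by some
  \<open>w\<close>, so \<open>\<alpha> - L\<close> is \<open>w\<close> minus the identity, whose
  prefix sums are non-negative.\<close>

lemma vdm_coeff_shifted_dominated:
  assumes "vdm_coeff l (\<lambda>i. shifted l L i - int (\<alpha> i)) \<noteq> 0"
  shows "dominated l L \<alpha>"
proof -
  obtain w where w: "w permutes {..<l}" "\<And>i. i < l \<Longrightarrow> shifted l L i - int (\<alpha> i) = int l - 1 - int (w i)"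
    using assms by (rule vdm_coeff_nonzeroD) blast
  show ?thesis unfolding dominated_def
  proof (intro allI impI)
    fix j assume j: "j \<le> l"
    have "L i + w i = \<alpha> i + i" if "i < j" for i
      using w(2)[of i] that j by (simp add: shifted_def)
    then have "(\<Sum>i<j. L i + w i) = (\<Sum>i<j. \<alpha> i + i)" by (intro sum.cong) auto
    then show "(\<Sum>i<j. L i) \<le> (\<Sum>i<j. \<alpha> i)"
      using permutes_partial_sum_ge[OF w(1) j] by (simp add: sum.distrib)
  qed
qed

text \<open>Here \<open>frob\<close> is read as a signed sum of indicators of Young subgroups, so
  that pairing with it reduces to sums of \<open>\<psi>\<close> over such subgroups.\<close>

lemma sum_frob_expand:
  assumes A: "finite A"
  shows "(\<Sum>p | p permutes A. \<psi> p * frob l \<kappa> A p) =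
    (\<Sum>c\<in>A \<rightarrow>\<^sub>E {..<l}. vdm_coeff l (\<lambda>i. \<kappa> i - int (color_count A c i)) * (\<Sum>p\<in>color_stab A c. \<psi> p))"
proof -
  let ?C = "A \<rightarrow>\<^sub>E {..<l}"
  let ?V = "\<lambda>c'. vdm_coeff l (\<lambda>i. \<kappa> i - int (color_count A c' i))"
  have finC: "finite ?C" using A by (simp add: finite_PiE)
  have "(\<Sum>p | p permutes A. \<psi> p * frob l \<kappa> A p) =
    (\<Sum>p | p permutes A. \<Sum>c\<in>?C. if (\<forall>x\<in>A. c (p x) = c x) then ?V c * \<psi> p else 0)"
  proof (rule sum.cong[OF refl])
    fix p
    have "\<psi> p * frob l \<kappa> A p = (\<Sum>c\<in>{c \<in> ?C. \<forall>x\<in>A. c (p x) = c x}. ?V c * \<psi> p)"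
      by (simp add: frob_def fixed_colorings_def sum_distrib_left mult.commute)
    then show "\<psi> p * frob l \<kappa> A p = (\<Sum>c\<in>?C. if (\<forall>x\<in>A. c (p x) = c x) then ?V c * \<psi> p else 0)"
      by (simp add: sum.inter_filter[OF finC])
  qed
  also have "\<dots> = (\<Sum>c\<in>?C. \<Sum>p | p permutes A. if (\<forall>x\<in>A. c (p x) = c x) then ?V c * \<psi> p else 0)"
    by (rule sum.swap)
  also have "\<dots> = (\<Sum>c\<in>?C. ?V c * (\<Sum>p\<in>color_stab A c. \<psi> p))"
    by (intro sum.cong refl)
      (simp add: color_stab_def sum_distrib_left sum.inter_filter[OF finite_permutations[OF A], symmetric])
  finally show ?thesis .
qed

text \<open>A nonzero pairing produces a color count that lies between the two partitions in
  dominance order. Expanding one factor or the other gives both inequalities.\<close>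

lemma frob_orthogonal:
  assumes A: "finite A" and L: "L \<in> partition_rows l n" "L' \<in> partition_rows l n'" "L \<noteq> L'"
  shows "(\<Sum>p | p permutes A. frob l (shifted l L) A p * frob l (shifted l L') A p) = 0"
proof (rule ccontr)
  assume nz: "\<not> ?thesis"
  have dom: "dominated l K K'"
    if nz: "(\<Sum>p | p permutes A. frob l (shifted l K') A p * frob l (shifted l K) A p) \<noteq> 0"
      and K': "K' \<in> partition_rows l k" for K K' k
  proof -
    obtain c where c: "c \<in> A \<rightarrow>\<^sub>E {..<l}"
      "vdm_coeff l (\<lambda>i. shifted l K i - int (color_count A c i)) * (\<Sum>p\<in>color_stab A c. frob l (shifted l K') A p) \<noteq> 0"
      using nz unfolding sum_frob_expand[OF A] by (meson sum.neutral)
    have "dominated l K (color_count A c)" using c by (intro vdm_coeff_shifted_dominated) auto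
    moreover have "dominated l (color_count A c) K'"
      using c by (intro sum_stab_frob_dominated[OF A _ K']) auto
    ultimately show ?thesis unfolding dominated_def by (meson order_trans)
  qed
  have "dominated l L' L" using nz dom[OF _ L(1)] by simp
  moreover have "dominated l L L'" using nz dom[OF _ L(2), of L] by (simp add: mult.commute)
  ultimately have "L = L'" using L(1,2) by (intro dominated_antisym) (auto simp: partition_rows_def)
  then show False using L(3) by simp
qed

subsection \<open>Completeness of the Frobenius characters\<close>

definition class_function :: "'a set \<Rightarrow> (('a \<Rightarrow> 'a) \<Rightarrow> rat) \<Rightarrow> bool" where
  "class_function A \<psi> \<longleftrightarrow> (\<forall>p q. p permutes A \<longrightarrow> q permutes A \<longrightarrow> \<psi> (q \<circ> p) = \<psi> (p \<circ> q))"

lemma class_function_conj: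
  assumes "class_function A \<psi>" "p permutes A" "q permutes A" "h permutes A" "h \<circ> p = q \<circ> h"
  shows "\<psi> p = \<psi> q"
proof -
  let ?i = "inv_into UNIV h"
  have i: "?i permutes A" by (rule permutes_inv[OF assms(4)])
  have e: "?i \<circ> h = id" "h \<circ> ?i = id" using assms(4) by (simp_all add: permutes_inv_o)
  have "\<psi> p = \<psi> (?i \<circ> (h \<circ> p))" by (simp add: o_assoc e)
  also have "\<dots> = \<psi> ((h \<circ> p) \<circ> ?i)"
    using assms i permutes_compose[OF assms(2,4)] by (simp add: class_function_def)
  also have "(h \<circ> p) \<circ> ?i = q" unfolding assms(5) by (simp add: o_assoc[symmetric] e)
  finally show ?thesis .
qed

lemma frob_class_function: "class_function A (frob l \<kappa> A)"
  unfolding class_function_def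
proof (intro allI impI)
  fix p q :: "'a \<Rightarrow> 'a" assume p: "p permutes A" and q: "q permutes A"
  have "frob l \<kappa> A (q \<circ> p) = frob l \<kappa> A (p \<circ> q)"
  proof (rule frob_transport[of p])
    show "bij_betw p A A" by (rule permutes_imp_bij[OF p])
  qed (use permutes_in_image[OF p] permutes_in_image[OF q] in auto)
  then show "frob l \<kappa> A (q \<circ> p) = frob l \<kappa> A (p \<circ> q)" .
qed

text \<open>The two stabilizers are conjugate by \<open>g\<close>, so the sum of a class function
  depends on the color counts only.\<close>

lemma sum_color_stab_comp:
  assumes A: "finite A" and \<psi>: "class_function A \<psi>" and g: "g permutes A"
    and c: "\<And>x. x \<in> A \<Longrightarrow> c' x = c (g x)"
  shows "(\<Sum>p\<in>color_stab A c'. \<psi> p) = (\<Sum>p\<in>color_stab A c. \<psi> p)"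
proof -
  let ?i = "inv_into UNIV g"
  have i: "?i permutes A" by (rule permutes_inv[OF g])
  have inv: "g (?i x) = x" "?i (g x) = x" for x using g by (simp_all add: permutes_inverses)
  have gA: "g x \<in> A \<longleftrightarrow> x \<in> A" "?i x \<in> A \<longleftrightarrow> x \<in> A" for x using permutes_in_image[OF g] permutes_in_image[OF i] by auto
  have pA: "p x \<in> A \<longleftrightarrow> x \<in> A" if "p permutes A" for p x using permutes_in_image[OF that] .
  show ?thesis
  proof (rule sum.reindex_bij_witness[of _ "\<lambda>p. ?i \<circ> p \<circ> g" "\<lambda>p. g \<circ> p \<circ> ?i"])
    fix p assume p: "p \<in> color_stab A c'"
    then have pp: "p permutes A" by (simp add: color_stab_def)
    show "?i \<circ> (g \<circ> p \<circ> ?i) \<circ> g = p" by (auto simp: fun_eq_iff inv)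
    have q: "g \<circ> p \<circ> ?i permutes A" by (intro permutes_compose g pp i)
    moreover have "c (g (p (?i x))) = c x" if "x \<in> A" for x
    proof -
      have "c (g (p (?i x))) = c' (p (?i x))" using c pA[OF pp] gA that by simp
      also have "\<dots> = c' (?i x)" using p gA that by (simp add: color_stab_def)
      also have "\<dots> = c x" using c gA that by (simp add: inv)
      finally show ?thesis .
    qed
    ultimately show "g \<circ> p \<circ> ?i \<in> color_stab A c" by (simp add: color_stab_def)
    show "\<psi> (g \<circ> p \<circ> ?i) = \<psi> p"
      by (rule class_function_conj[OF \<psi> pp q g, symmetric]) (simp add: fun_eq_iff inv)
  next
    fix p assume p: "p \<in> color_stab A c"
    then have pp: "p permutes A" by (simp add: color_stab_def)
    show "g \<circ> (?i \<circ> p \<circ> g) \<circ> ?i = p" by (auto simp: fun_eq_iff inv)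
    have "?i \<circ> p \<circ> g permutes A" by (intro permutes_compose g pp i)
    moreover have "c' (?i (p (g x))) = c' x" if "x \<in> A" for x
      using p c gA pA[OF pp] that by (simp add: inv color_stab_def)
    ultimately show "?i \<circ> p \<circ> g \<in> color_stab A c'" by (simp add: color_stab_def)
  qed
qed

section \<open>Vanishing of sums over Young subgroups\<close>

text \<open>Abel summation of decreasing weights against non-negative prefix sums. The boundary term
  on the left is what the induction carries along.\<close>

lemma abel_sum_nonneg:
  fixes d :: "nat \<Rightarrow> int"
  assumes "\<And>i. L (Suc i) \<le> L i" and "\<And>j. j \<le> m \<Longrightarrow> 0 \<le> (\<Sum>i<j. d i)"
  shows "int (L m) * (\<Sum>i<m. d i) \<le> (\<Sum>i<m. int (L i) * d i)"
  using assms(2)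
proof (induction m)
  case (Suc m)
  have "int (L (Suc m)) * (\<Sum>i<Suc m. d i) \<le> int (L m) * (\<Sum>i<Suc m. d i)"
    using assms(1)[of m] Suc.prems[of "Suc m"] by (intro mult_right_mono) auto
  also have "\<dots> \<le> (\<Sum>i<Suc m. int (L i) * d i)"
    using Suc.IH Suc.prems by (simp add: algebra_simps)
  finally show ?case .
qed simp

text \<open>Put \<open>\<alpha> = L + d\<close>. The prefix sums of \<open>d\<close> are
  non-negative, hence so is the cross term in the square of \<open>L + d\<close>, and the square of
  \<open>d\<close> remains. So the sum of squares grows along the triangular expansion and can serve
  as a measure.\<close>

lemma sum_squares_increases:
  assumes L: "L \<in> partition_rows l n" and w: "w permutes {..<l}"
    and eq: "\<And>i. i < l \<Longrightarrow> L i + w i = \<alpha> i + i" and ne: "\<exists>i<l. \<alpha> i \<noteq> L i"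
  shows "(\<Sum>i<l. (L i)\<^sup>2) < (\<Sum>i<l. (\<alpha> i)\<^sup>2)"
proof -
  define d where "d i = int (w i) - int i" for i
  have ad: "int (\<alpha> i) = int (L i) + d i" if "i < l" for i using eq[OF that] by (simp add: d_def)
  have D: "0 \<le> (\<Sum>i<j. d i)" if "j \<le> l" for j
  proof -
    have "int (\<Sum>i<j. i) \<le> int (\<Sum>i<j. w i)" using permutes_partial_sum_ge[OF w that] by (simp only: of_nat_le_iff)
    then show ?thesis by (simp add: d_def sum_subtractf)
  qed
  have "int (L l) * (\<Sum>i<l. d i) \<le> (\<Sum>i<l. int (L i) * d i)"
    by (rule abel_sum_nonneg) (use L D in \<open>auto simp: partition_rows_def\<close>)
  moreover have "L l = 0" using L by (simp add: partition_rows_def)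
  ultimately have 1: "0 \<le> (\<Sum>i<l. int (L i) * d i)" by simp
  obtain i where i: "i < l" "d i \<noteq> 0" using ne ad by (metis add.right_neutral of_nat_eq_iff)
  have 2: "0 < (\<Sum>i<l. (d i)\<^sup>2)"
    by (rule sum_pos2[of _ i]) (use i in auto)
  have "int (\<Sum>i<l. (\<alpha> i)\<^sup>2) = (\<Sum>i<l. (int (L i) + d i)\<^sup>2)"
    by (simp add: ad)
  also have "\<dots> = int (\<Sum>i<l. (L i)\<^sup>2) + 2 * (\<Sum>i<l. int (L i) * d i) + (\<Sum>i<l. (d i)\<^sup>2)"
    by (simp add: power2_sum sum.distrib sum_distrib_left algebra_simps)
  finally show ?thesis using 1 2 by linarith
qed

text \<open>The triangular system is inverted at an extremal failure \<open>c0\<close>, whose counts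
  form a partition \<open>L\<close>. In the pairing with the character of \<open>L\<close>, any
  other counts with a nonzero coefficient have a larger sum of squares and so contribute 0. What is
  left is a positive multiple of the sum for \<open>c0\<close>.\<close>

lemma color_stab_sum_zero:
  assumes A: "finite A" and \<psi>: "class_function A \<psi>"
    and orth: "\<And>L. L \<in> partition_rows l (card A) \<Longrightarrow> (\<Sum>p | p permutes A. \<psi> p * frob l (shifted l L) A p) = 0"
    and c: "c \<in> A \<rightarrow>\<^sub>E {..<l}"
  shows "(\<Sum>p\<in>color_stab A c. \<psi> p) = 0"
proof (rule ccontr)
  assume nz: "(\<Sum>p\<in>color_stab A c. \<psi> p) \<noteq> 0"
  let ?C = "A \<rightarrow>\<^sub>E {..<l}"
  let ?E = "\<lambda>c. \<Sum>p\<in>color_stab A c. \<psi> p"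
  let ?Q = "\<lambda>c. \<Sum>i<l. (color_count A c i)\<^sup>2"
  let ?S = "\<lambda>c. \<Sum>i<l. i * color_count A c i"
  define n where "n = card A"
  have comp: "color_count A c \<in> weak_comps l n" if "c \<in> ?C" for c
    using that A unfolding n_def by (intro color_count_weak_comps) auto
  have Qle: "?Q c \<le> n * n" if "c \<in> ?C" for c
  proof -
    have le: "color_count A c i \<le> n" for i unfolding n_def color_count_def using A by (auto intro: card_mono)
    have "?Q c \<le> (\<Sum>i<l. n * color_count A c i)"
      by (intro sum_mono) (use le in \<open>auto simp: power2_eq_square\<close>)
    also have "\<dots> = n * n" using comp[OF that] by (simp add: sum_distrib_left[symmetric] weak_comps_def)
    finally show ?thesis .
  qed
  \<comment> \<open>First the largest sum of squares, then the smallest weighted sum of the counts: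
    the second criterion forces the counts to be decreasing, since swapping two colors changes
    neither the stabilizer nor the squares. By \<open>Qle\<close> the subtraction is exact.\<close>
  let ?m = "measures [\<lambda>c. n * n - ?Q c, ?S]"
  obtain c0 where c0: "c0 \<in> {c \<in> ?C. ?E c \<noteq> 0}"
    and min: "\<And>c'. (c', c0) \<in> ?m \<Longrightarrow> c' \<notin> {c \<in> ?C. ?E c \<noteq> 0}"
    using wfE_min[OF wf_measures, of c "{c \<in> ?C. ?E c \<noteq> 0}"] c nz by blast
  have Qmin: "?E c' = 0" if "c' \<in> ?C" "?Q c0 < ?Q c'" for c'
  proof -
    have "n * n - ?Q c' < n * n - ?Q c0" using that(2) Qle[OF that(1)] by linarith
    then show ?thesis using min[of c'] that(1) by simp
  qed
  have Smin: "?E c' = 0" if "c' \<in> ?C" "?Q c' = ?Q c0" "?S c' < ?S c0" for c'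
    using min[of c'] that by simp
  have dec: "color_count A c0 (Suc i) \<le> color_count A c0 i" for i
  proof (rule ccontr)
    assume "\<not> ?thesis"
    then have lt: "color_count A c0 i < color_count A c0 (Suc i)" by simp
    then have il: "Suc i < l" using comp c0 by (cases "Suc i < l") (auto simp: weak_comps_def)
    let ?t = "transpose i (Suc i)"
    have tp: "?t permutes {..<l}" using il by (intro permutes_swap_id) auto
    let ?c = "\<lambda>x\<in>A. ?t (c0 x)"
    have cc: "color_count A ?c j = color_count A c0 (?t j)" for j
      using color_count_cong[of A ?c "\<lambda>x. ?t (c0 x)" j] by (simp add: color_count_transpose)
    have "?t y < l \<longleftrightarrow> y < l" for y using permutes_in_image[OF tp, of y] by simp
    then have 1: "?c \<in> ?C" using c0 by auto
    have 2: "?Q ?c = ?Q c0" using sum.permute[OF tp, of "\<lambda>j. (color_count A c0 j)\<^sup>2"] by (simp add: cc o_def)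
    have "(\<Sum>j\<in>{..<l} - {i, Suc i}. int j * int (color_count A ?c j)) = (\<Sum>j\<in>{..<l} - {i, Suc i}. int j * int (color_count A c0 j))"
    proof (rule sum.cong[OF refl])
      fix j assume "j \<in> {..<l} - {i, Suc i}"
      then have "?t j = j" by (auto simp: transpose_def)
      then show "int j * int (color_count A ?c j) = int j * int (color_count A c0 j)" by (simp only: cc)
    qed
    then have "(\<Sum>j<l. int j * int (color_count A ?c j)) < (\<Sum>j<l. int j * int (color_count A c0 j))"
      using lt sum_two_upd[OF il, of "\<lambda>j. int j * int (color_count A ?c j)"]
        sum_two_upd[OF il, of "\<lambda>j. int j * int (color_count A c0 j)"] by (simp add: cc algebra_simps)
    then have 3: "?S ?c < ?S c0" by (simp flip: of_nat_mult of_nat_sum)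
    have ti: "?t u = ?t v \<longleftrightarrow> u = v" for u v by (metis transpose_involutory)
    have "color_stab A ?c = color_stab A c0"
      unfolding color_stab_def using ti by (auto simp: permutes_in_image)
    then show False using Smin[OF 1 2 3] c0 by simp
  qed
  define L where "L = color_count A c0"
  have L: "L \<in> partition_rows l n" using dec comp c0 by (auto simp: L_def partition_rows_def weak_comps_def)
  have summand: "vdm_coeff l (\<lambda>i. shifted l L i - int (color_count A c' i)) * ?E c' =
      (if color_count A c' = L then ?E c0 else 0)" if c': "c' \<in> ?C" for c'
  proof (cases "color_count A c' = L")
    case True
    have "card {x \<in> A. c' x = v} = card {x \<in> A. c0 x = v}" for v
      using True by (simp add: L_def color_count_def fun_eq_iff)
    then obtain g where "g permutes A" "\<And>x. x \<in> A \<Longrightarrow> c' x = c0 (g x)" by (rule same_counts_permutes[OF A]) blast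
    then have "?E c' = ?E c0" by (rule sum_color_stab_comp[OF A \<psi>])
    moreover have "vdm_coeff l (\<lambda>i. shifted l L i - int (L i)) = vdm_coeff l (shifted l (\<lambda>_. 0))"
      by (rule vdm_coeff_cong) (simp add: shifted_def)
    ultimately show ?thesis using True by (simp add: vdm_coeff_staircase)
  next
    case False
    show ?thesis
    proof (rule ccontr)
      assume "\<not> ?thesis"
      then have V: "vdm_coeff l (\<lambda>i. shifted l L i - int (color_count A c' i)) \<noteq> 0" and E: "?E c' \<noteq> 0"
        using False by auto
      obtain w where w: "w permutes {..<l}"
        "\<And>i. i < l \<Longrightarrow> shifted l L i - int (color_count A c' i) = int l - 1 - int (w i)"
        using V by (rule vdm_coeff_nonzeroD) blast
      have z: "color_count A c' i = L i" if "l \<le> i" for i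
        using comp[OF c'] L that by (auto simp: weak_comps_def partition_rows_def)
      have "\<exists>i<l. color_count A c' i \<noteq> L i"
      proof (rule ccontr)
        assume "\<not> ?thesis"
        then have "color_count A c' i = L i" for i using z by (cases "i < l") auto
        then show False using False by blast
      qed
      moreover have "L i + w i = color_count A c' i + i" if "i < l" for i
        using w(2)[OF that] that by (simp add: shifted_def)
      ultimately have "(\<Sum>i<l. (L i)\<^sup>2) < ?Q c'" by (intro sum_squares_increases[OF L w(1)])
      then show False using Qmin[OF c'] E by (simp add: L_def)
    qed
  qed
  have "0 = (\<Sum>c'\<in>?C. vdm_coeff l (\<lambda>i. shifted l L i - int (color_count A c' i)) * ?E c')"
    using orth[of L] L unfolding sum_frob_expand[OF A] by (simp add: n_def)
  also have "\<dots> = (\<Sum>c'\<in>?C. if color_count A c' = L then ?E c0 else 0)"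
    by (rule sum.cong[OF refl summand])
  also have "\<dots> = of_nat (card {c' \<in> ?C. color_count A c' = L}) * ?E c0"
    using A by (simp add: sum.inter_filter[symmetric] finite_PiE)
  finally have "card {c' \<in> ?C. color_count A c' = L} = 0" using c0 by simp
  moreover have "c0 \<in> {c' \<in> ?C. color_count A c' = L}" using c0 by (simp add: L_def)
  moreover have "finite {c' \<in> ?C. color_count A c' = L}" using A by (simp add: finite_PiE)
  ultimately show False unfolding card_eq_0_iff by blast
qed

section \<open>From Young subgroups to single permutations\<close>

text \<open>Choose a representative \<open>r\<close> in each orbit and send its iterates under
  \<open>p\<close> to those under \<open>q\<close>. This is well defined and injective because the
  cycles of \<open>p\<close> and \<open>q\<close> through a point have the same length.\<close>

lemma same_orbits_conj:
  fixes p q :: "'a \<Rightarrow> 'a"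
  assumes A: "finite A" and p: "p permutes A" and q: "q permutes A"
    and orb: "\<And>x. x \<in> A \<Longrightarrow> orbit p x = orbit q x"
  obtains h where "h permutes A" "h \<circ> p = q \<circ> h"
proof -
  have perm: "permutation p" "permutation q" using permutes_imp_permutation[OF A] p q by auto
  have self: "x \<in> orbit p x" "x \<in> orbit q x" for x
    using permutation_self_in_orbit[OF perm(1)] permutation_self_in_orbit[OF perm(2)] by auto
  define r where "r x = (SOME y. y \<in> orbit p x)" for x
  have r: "r x \<in> orbit p x" for x unfolding r_def using self by (metis someI)
  have orbr: "orbit p (r x) = orbit p x" for x
    using orbit_cyclic_eq3[OF cyclic_on_orbit'[OF perm(1)] r] .
  have req: "orbit p x = orbit p y \<Longrightarrow> r x = r y" for x y by (simp add: r_def)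
  have xr: "x \<in> orbit p (r x)" for x using self orbr by blast
  have inA: "orbit p x \<subseteq> A" if "x \<in> A" for x using permutes_orbit_subset[OF p that] .
  define k where "k x = funpow_dist p (r x) x" for x
  have kx: "(p ^^ k x) (r x) = x" for x unfolding k_def by (rule funpow_dist_prop[OF xr])
  have wd: "(p ^^ a) x = (p ^^ b) x \<longleftrightarrow> (q ^^ a) x = (q ^^ b) x" if x: "x \<in> A" for a b x
  proof -
    have card: "f = p \<or> f = q \<Longrightarrow> funpow_dist1 f x x = card (orbit p x)" for f
    proof -
      assume f: "f = p \<or> f = q"
      then have "orbit p x = orbit f x" "x \<in> orbit f x" using orb[OF x] self by auto
      then show ?thesis using orbit_conv_funpow_dist1[of x f] inj_on_funpow_dist1[of x f] card_image
        by (metis card_atLeastLessThan diff_zero)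
    qed
    define N where "N = card (orbit p x)"
    have main: "(f ^^ a) x = (f ^^ b) x \<longleftrightarrow> a mod N = b mod N" if f: "f = p \<or> f = q" for f
    proof -
      have xo: "x \<in> orbit f x" using f self by auto
      have N: "funpow_dist1 f x x = N" using card[OF f] by (simp add: N_def)
      have fN: "(f ^^ N) x = x" using funpow_dist1_prop[OF xo] N by simp
      have md: "(f ^^ (a mod N)) x = (f ^^ a) x" for a using funpow_mod_eq[OF fN] .
      have Np: "N > 0" using N by simp
      have inj: "inj_on (\<lambda>n. (f ^^ n) x) {0..<N}" using inj_on_funpow_dist1[OF xo] N by simp
      have "(f ^^ a) x = (f ^^ b) x \<longleftrightarrow> (f ^^ (a mod N)) x = (f ^^ (b mod N)) x" by (simp add: md)
      also have "\<dots> \<longleftrightarrow> a mod N = b mod N" using inj_on_eq_iff[OF inj, of "a mod N" "b mod N"] Np by simp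
      finally show ?thesis .
    qed
    show ?thesis using main[of p] main[of q] by simp
  qed
  define h where "h x = (if x \<in> A then (q ^^ k x) (r x) else x)" for x
  have rA: "r x \<in> A" if "x \<in> A" for x using inA[OF that] r by blast
  have hval: "h x = (q ^^ n) (r x)" if "x \<in> A" "(p ^^ n) (r x) = x" for x n
    using wd[OF rA[OF that(1)], of "k x" n] kx[of x] that by (simp add: h_def)
  have qn: "(q ^^ n) y \<in> orbit q y" for n y
    using funpow_in_orbit[OF self(2)] .
  have horb: "h x \<in> orbit p x" if "x \<in> A" for x
    using qn[of "k x" "r x"] orb[OF rA[OF that]] orbr[of x] that by (simp add: h_def)
  have "h permutes A"
  proof (rule inj_imp_permutes)
    show "inj_on h A"
    proof (rule inj_onI)
      fix x y assume x: "x \<in> A" and y: "y \<in> A" and e: "h x = h y"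
      have "orbit p (h x) = orbit p x" "orbit p (h y) = orbit p y"
        using orbit_cyclic_eq3[OF cyclic_on_orbit'[OF perm(1)] horb] x y by auto
      then have "orbit p x = orbit p y" using e by simp
      then have rr: "r x = r y" by (rule req)
      have "(q ^^ k x) (r x) = (q ^^ k y) (r x)" using e x y rr by (simp add: h_def)
      then have pk: "(p ^^ k x) (r x) = (p ^^ k y) (r x)" using wd[OF rA[OF x]] by blast
      have "x = (p ^^ k x) (r x)" by (rule kx[symmetric])
      also have "\<dots> = (p ^^ k y) (r y)" unfolding pk by (simp only: rr)
      also have "\<dots> = y" by (rule kx)
      finally show "x = y" .
    qed
    show "h x \<in> A" if "x \<in> A" for x using horb[OF that] inA[OF that] by blast
  qed (use A in \<open>auto simp: h_def\<close>)
  moreover have "h (p x) = q (h x)" for x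
  proof (cases "x \<in> A")
    case True
    have "p x \<in> orbit p x" using orbit.base by fast
    then have "orbit p (p x) = orbit p x" using orbit_cyclic_eq3[OF cyclic_on_orbit'[OF perm(1)]] by blast
    then have rr: "r (p x) = r x" by (rule req)
    have "(p ^^ Suc (k x)) (r (p x)) = p x" by (simp add: rr kx)
    then have "h (p x) = (q ^^ Suc (k x)) (r (p x))" using True permutes_in_image[OF p] by (intro hval) auto
    then show ?thesis using True by (simp add: rr h_def)
  next
    case False
    then show ?thesis using permutes_not_in[OF p] permutes_not_in[OF q] by (simp add: h_def)
  qed
  then have "h \<circ> p = q \<circ> h" by (simp add: fun_eq_iff)
  ultimately show ?thesis by (rule that)
qed

text \<open>The induction is on how coarse the orbit partition is: among the permutations that preserve the
  orbits of \<open>p\<close>, those with the same orbits are conjugate to \<open>p\<close> and the others have finer orbits.\<close>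

lemma class_function_zero:
  assumes A: "finite A" "card A \<le> l" and \<psi>: "class_function A \<psi>"
    and E: "\<And>c. c \<in> A \<rightarrow>\<^sub>E {..<l} \<Longrightarrow> (\<Sum>p\<in>color_stab A c. \<psi> p) = 0"
    and p: "p permutes A"
  shows "\<psi> p = 0"
  using p
proof (induction "card {(x,y). x \<in> A \<and> y \<in> orbit p x}" arbitrary: p rule: less_induct)
  case (less p)
  let ?R = "\<lambda>p. {(x,y). x \<in> A \<and> y \<in> orbit p x}"
  have Rsub: "?R p \<subseteq> A \<times> A" if "p permutes A" for p using permutes_orbit_subset[OF that] by auto
  have fin: "finite (?R p)" using finite_subset[OF Rsub[OF less.prems]] A by simp
  have pp: "permutation p" by (rule permutes_imp_permutation[OF A(1) less.prems])
  have self: "x \<in> orbit p x" for x using permutation_self_in_orbit[OF pp] .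
  have orbeq: "orbit p y = orbit p x" if "y \<in> orbit p x" for x y
    using orbit_cyclic_eq3[OF cyclic_on_orbit'[OF pp] that] .
  \<comment> \<open>One color for each orbit, so that the stabilizer of \<open>c\<close> consists of
    the permutations that preserve every orbit of \<open>p\<close>; \<open>card A \<le> l\<close>
    provides enough colors.\<close>
  obtain e where e: "inj_on e A" "e ` A \<subseteq> {..<l}"
    using card_le_inj[of A "{..<l}"] A by auto
  define c where "c = (\<lambda>x\<in>A. e (SOME y. y \<in> orbit p x))"
  have someA: "(SOME y. y \<in> orbit p x) \<in> orbit p x" for x using self by (metis someI)
  have oA: "orbit p x \<subseteq> A" if "x \<in> A" for x using permutes_orbit_subset[OF less.prems that] .
  have c: "c \<in> A \<rightarrow>\<^sub>E {..<l}" unfolding c_def using e(2) someA oA by fastforce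
  have ceq: "c x = c y \<longleftrightarrow> y \<in> orbit p x" if xy: "x \<in> A" "y \<in> A" for x y
  proof
    assume "c x = c y"
    then have "(SOME z. z \<in> orbit p x) = (SOME z. z \<in> orbit p y)"
      using xy e(1) someA oA unfolding c_def by (simp add: inj_on_eq_iff subset_eq)
    then have "orbit p x = orbit p y" using orbeq someA by metis
    then show "y \<in> orbit p x" using self by simp
  next
    assume "y \<in> orbit p x"
    then show "c x = c y" using xy orbeq by (simp add: c_def)
  qed
  have pA: "p x \<in> A" if "x \<in> A" for x using that permutes_in_image[OF less.prems] by blast
  have stab: "\<psi> q = (if ?R q = ?R p then \<psi> p else 0)" if q: "q \<in> color_stab A c" for q
  proof -
    have qp: "q permutes A" using q by (simp add: color_stab_def)
    have "y \<in> orbit p x" if "x \<in> A" "y \<in> orbit q x" for x y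
      using that(2)
    proof (induction rule: orbit.induct)
      case base
      have "q x \<in> A" using permutes_in_image[OF qp] that by blast
      then show ?case using q that ceq[of x "q x"] by (simp add: color_stab_def)
    next
      case (step y)
      then have yA: "y \<in> A" using oA that by blast
      then have "q y \<in> A" using permutes_in_image[OF qp] by blast
      then have "q y \<in> orbit p y" using q yA ceq[of y "q y"] by (simp add: color_stab_def)
      then show ?case using orbeq[OF step.IH] by simp
    qed
    then have sub: "?R q \<subseteq> ?R p" by auto
    show ?thesis
    proof (cases "?R q = ?R p")
      case True
      have "orbit q x = orbit p x" if "x \<in> A" for x
      proof -
        have "y \<in> orbit q x \<longleftrightarrow> y \<in> orbit p x" for y using True that by (auto simp: set_eq_iff)
        then show ?thesis by blast
      qed
      then obtain h where "h permutes A" "h \<circ> q = p \<circ> h" using same_orbits_conj[OF A(1) qp less.prems] by metis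
      then show ?thesis using class_function_conj[OF \<psi> qp less.prems] True by simp
    next
      case False
      then have "card (?R q) < card (?R p)" using sub fin by (intro psubset_card_mono) auto
      then show ?thesis using less.hyps[OF _ qp] False by simp
    qed
  qed
  have fs: "finite (color_stab A c)" by (rule finite_color_stab[OF A(1)])
  have pin: "p \<in> color_stab A c"
  proof -
    have "c (p x) = c x" if "x \<in> A" for x
      using ceq[OF that pA[OF that]] orbit.base[of p x] by simp
    then show ?thesis using less.prems by (simp add: color_stab_def)
  qed
  have "0 = (\<Sum>q\<in>color_stab A c. \<psi> q)" using E[OF c] by simp
  also have "\<dots> = (\<Sum>q\<in>color_stab A c. if ?R q = ?R p then \<psi> p else 0)" by (rule sum.cong[OF refl stab])
  also have "\<dots> = of_nat (card {q \<in> color_stab A c. ?R q = ?R p}) * \<psi> p"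
    using fs by (simp add: sum.inter_filter[symmetric])
  finally have *: "of_nat (card {q \<in> color_stab A c. ?R q = ?R p}) * \<psi> p = 0" by simp
  have "p \<in> {q \<in> color_stab A c. ?R q = ?R p}" using pin by blast
  moreover have "finite {q \<in> color_stab A c. ?R q = ?R p}" using fs by simp
  ultimately have "card {q \<in> color_stab A c. ?R q = ?R p} \<noteq> 0" unfolding card_eq_0_iff by blast
  then show ?case using * by simp
qed

lemma frob_complete:
  assumes "finite A" "card A \<le> l" "class_function A \<psi>"
    and "\<And>L. L \<in> partition_rows l (card A) \<Longrightarrow> (\<Sum>p | p permutes A. \<psi> p * frob l (shifted l L) A p) = 0"
    and "p permutes A"
  shows "\<psi> p = 0"
  using assms by (intro class_function_zero[of A l \<psi> p] color_stab_sum_zero[of A \<psi> l])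

subsection \<open>Young symmetrizers\<close>

lemma color_stab_comp: "p \<in> color_stab A c \<Longrightarrow> q \<in> color_stab A c \<Longrightarrow> p \<circ> q \<in> color_stab A c"
  unfolding color_stab_def by (auto simp: permutes_compose) (metis permutes_in_image)

lemma color_stab_inv:
  assumes "p \<in> color_stab A c"
  shows "inv_into UNIV p \<in> color_stab A c"
proof -
  have p: "p permutes A" using assms by (simp add: color_stab_def)
  have "c (inv_into UNIV p x) = c x" if "x \<in> A" for x
  proof -
    have "inv_into UNIV p x \<in> A" using that permutes_in_image[OF permutes_inv[OF p]] by blast
    then have "c (p (inv_into UNIV p x)) = c (inv_into UNIV p x)" using assms by (simp add: color_stab_def)
    then show ?thesis using permutes_inverses(1)[OF p] by simp
  qed
  then show ?thesis using permutes_inv[OF p] by (simp add: color_stab_def)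
qed

lemma sum_color_stab_right:
  assumes "s \<in> color_stab A c"
  shows "(\<Sum>t\<in>color_stab A c. f (t \<circ> s)) = (\<Sum>t\<in>color_stab A c. f t)"
proof -
  have s: "s permutes A" using assms by (simp add: color_stab_def)
  have e: "t \<circ> s \<circ> inv_into UNIV s = t" "t \<circ> inv_into UNIV s \<circ> s = t" for t
    using s by (simp_all add: comp_assoc permutes_inv_o)
  show ?thesis
    by (rule sum.reindex_bij_witness[of _ "\<lambda>t. t \<circ> inv_into UNIV s" "\<lambda>t. t \<circ> s"])
      (auto simp: e intro: color_stab_comp assms color_stab_inv)
qed

lemma sum_color_stab_left:
  assumes "s \<in> color_stab A c"
  shows "(\<Sum>t\<in>color_stab A c. f (s \<circ> t)) = (\<Sum>t\<in>color_stab A c. f t)"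
proof -
  have s: "s permutes A" using assms by (simp add: color_stab_def)
  have e: "inv_into UNIV s \<circ> (s \<circ> t) = t" "s \<circ> (inv_into UNIV s \<circ> t) = t" for t
    using s by (simp_all add: o_assoc permutes_inv_o)
  show ?thesis
    by (rule sum.reindex_bij_witness[of _ "\<lambda>t. inv_into UNIV s \<circ> t" "\<lambda>t. s \<circ> t"])
      (auto simp: e intro: color_stab_comp assms color_stab_inv)
qed

lemma sum_color_stab_inv:
  "(\<Sum>t\<in>color_stab A c. f (inv_into UNIV t)) = (\<Sum>t\<in>color_stab A c. f t)"
proof -
  have e: "inv_into UNIV (inv_into UNIV t) = t" if "t \<in> color_stab A c" for t
    using that permutes_inv_inv by (auto simp: color_stab_def)
  show ?thesis
    by (rule sum.reindex_bij_witness[of _ "inv_into UNIV" "inv_into UNIV"])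
      (auto simp: e color_stab_inv)
qed

section \<open>Transport along bijections\<close>

text \<open>Extensional functions, so that the set is finite and each bijection counts once.\<close>

definition bijs :: "'a set \<Rightarrow> 'b set \<Rightarrow> ('a \<Rightarrow> 'b) set" where
  "bijs B A = {h \<in> B \<rightarrow>\<^sub>E A. bij_betw h B A}"

lemma finite_bijs: "finite A \<Longrightarrow> finite B \<Longrightarrow> finite (bijs B A)"
  unfolding bijs_def by (simp add: finite_PiE)

text \<open>In \<open>s \<circ> h = g \<circ> s'\<close> the bijection \<open>g\<close> is
  determined by the other three maps. This is what collapses the intermediate sum in a product of
  two kernels.\<close>

lemma bijs_ex1:
  assumes h: "h \<in> bijs B A" and s: "s permutes A" "s' permutes B"
  defines "g \<equiv> \<lambda>x\<in>B. s (h (inv_into UNIV s' x))"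
  shows "g \<in> bijs B A" "\<forall>x\<in>B. s (h x) = g (s' x)"
    "\<And>g'. g' \<in> bijs B A \<Longrightarrow> \<forall>x\<in>B. s (h x) = g' (s' x) \<Longrightarrow> g' = g"
proof -
  let ?i = "inv_into UNIV s'"
  have hb: "bij_betw h B A" using h by (simp add: bijs_def)
  have i: "?i permutes B" by (rule permutes_inv[OF s(2)])
  have iB: "?i x \<in> B \<longleftrightarrow> x \<in> B" "s' x \<in> B \<longleftrightarrow> x \<in> B" for x
    using permutes_in_image[OF i] permutes_in_image[OF s(2)] by auto
  have inv: "s' (?i x) = x" "?i (s' x) = x" for x using s(2) by (simp_all add: permutes_inverses)
  have "bij_betw (s \<circ> (h \<circ> ?i)) B A"
    by (intro bij_betw_trans[of _ B A] bij_betw_trans[of _ B B] permutes_imp_bij[OF i] hb permutes_imp_bij[OF s(1)])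
  then have "bij_betw g B A" by (subst bij_betw_cong[of B g "s \<circ> (h \<circ> ?i)"]) (auto simp: g_def)
  then show "g \<in> bijs B A" by (auto simp: bijs_def g_def dest: bij_betwE)
  show g: "\<forall>x\<in>B. s (h x) = g (s' x)" by (simp add: g_def iB inv)
  fix g' assume g': "g' \<in> bijs B A" "\<forall>x\<in>B. s (h x) = g' (s' x)"
  show "g' = g"
  proof
    fix x show "g' x = g x"
    proof (cases "x \<in> B")
      case True
      then show ?thesis using g'(2) g iB inv by metis
    next
      case False
      then show ?thesis using g'(1) by (auto simp: g_def bijs_def PiE_iff extensional_def)
    qed
  qed
qed

lemma card_bijs:
  assumes "finite A" "finite B" "card A = card B"
  shows "card (bijs B A) = fact (card A)"
proof -
  obtain h0 where h0: "bij_betw h0 B A" using assms finite_same_card_bij by metis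
  have "bij_betw (\<lambda>p. \<lambda>x\<in>B. p (h0 x)) {p. p permutes A} (bijs B A)"
  proof (rule bij_betw_byWitness[of _ "\<lambda>g x. if x \<in> A then g (inv_into B h0 x) else x"])
    have i: "inv_into B h0 x \<in> B" "h0 (inv_into B h0 x) = x" if "x \<in> A" for x
      using h0 that by (simp_all add: bij_betw_inv_into_right) (metis bij_betw_imp_surj_on inv_into_into)
    have j: "h0 x \<in> A" "inv_into B h0 (h0 x) = x" if "x \<in> B" for x
      using h0 that by (simp_all add: bij_betw_inv_into_left) (auto dest: bij_betwE)
    show "\<forall>p\<in>{p. p permutes A}. (\<lambda>x. if x \<in> A then (\<lambda>x\<in>B. p (h0 x)) (inv_into B h0 x) else x) = p"
      using i by (auto simp: fun_eq_iff permutes_def)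
    show "\<forall>g\<in>bijs B A. (\<lambda>x\<in>B. (if h0 x \<in> A then g (inv_into B h0 (h0 x)) else h0 x)) = g"
      using j by (auto simp: fun_eq_iff bijs_def PiE_iff extensional_def)
    show "(\<lambda>p. \<lambda>x\<in>B. p (h0 x)) ` {p. p permutes A} \<subseteq> bijs B A"
    proof (rule image_subsetI)
      fix p assume "p \<in> {p. p permutes A}"
      then have "bij_betw (p \<circ> h0) B A" by (intro bij_betw_trans[OF h0] permutes_imp_bij) auto
      then have "bij_betw (\<lambda>x\<in>B. p (h0 x)) B A" by (simp add: o_def cong: bij_betw_cong)
      then show "(\<lambda>x\<in>B. p (h0 x)) \<in> bijs B A" by (auto simp: bijs_def dest: bij_betwE)
    qed
    show "(\<lambda>g x. if x \<in> A then g (inv_into B h0 x) else x) ` bijs B A \<subseteq> {p. p permutes A}"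
    proof (rule image_subsetI)
      fix g assume "g \<in> bijs B A"
      then have "bij_betw g B A" by (simp add: bijs_def)
      then have "bij_betw (g \<circ> inv_into B h0) A A" by (rule bij_betw_trans[OF bij_betw_inv_into[OF h0]])
      then have "bij_betw (\<lambda>x. if x \<in> A then g (inv_into B h0 x) else x) A A"
        by (subst bij_betw_cong[of A _ "g \<circ> inv_into B h0"]) auto
      then show "(\<lambda>x. if x \<in> A then g (inv_into B h0 x) else x) \<in> {p. p permutes A}"
        by (auto intro: bij_imp_permutes)
    qed
  qed
  then have "card (bijs B A) = card {p. p permutes A}" by (rule bij_betw_same_card[symmetric])
  then show ?thesis using card_permutations[OF refl assms(1)] by simp
qed

text \<open>The two projections of a box are its row and its column, so \<open>color_stab M fst\<close> and
  \<open>color_stab M snd\<close> are the row and column groups that make up the Young symmetrizer of \<open>M\<close>.\<close>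

definition young_pairing :: "('a \<times> 'b) set \<Rightarrow> (('a \<times> 'b \<Rightarrow> 'a \<times> 'b) \<Rightarrow> rat) \<Rightarrow> rat" where
  "young_pairing M f = (\<Sum>\<sigma>\<in>color_stab M fst. \<Sum>\<tau>\<in>color_stab M snd. of_int (sign \<tau>) * f (\<tau> \<circ> \<sigma>))"

text \<open>The coefficient of \<open>p\<close> in the sum of all transports to \<open>A\<close> of the Young symmetrizer of \<open>M\<close>.\<close>

definition young_class :: "('a \<times> 'b) set \<Rightarrow> 'c set \<Rightarrow> ('c \<Rightarrow> 'c) \<Rightarrow> rat" where
  "young_class M A p = (\<Sum>h\<in>bijs M A. young_pairing M (\<lambda>q. of_bool (\<forall>x\<in>M. h (q x) = p (h x))))"

lemma young_pairing_cong:
  "(\<And>q. q permutes M \<Longrightarrow> f q = g q) \<Longrightarrow> young_pairing M f = young_pairing M g"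
  unfolding young_pairing_def
  by (intro sum.cong refl) (auto simp: color_stab_def permutes_compose)

lemma young_pairing_sum: "young_pairing M (\<lambda>q. \<Sum>i\<in>I. f i q) = (\<Sum>i\<in>I. young_pairing M (f i))"
  unfolding young_pairing_def sum_distrib_left
  by (subst sum.swap[of _ _ I], intro sum.cong refl, rule sum.swap)+

lemma young_pairing_scale: "young_pairing M (\<lambda>q. c * f q) = c * young_pairing M f"
  by (simp add: young_pairing_def sum_distrib_left mult.left_commute)

lemma young_class_transport:
  assumes k: "bij_betw k A B" and kp: "\<And>x. x \<in> A \<Longrightarrow> k (p x) = q (k x)" and p: "\<And>x. x \<in> A \<Longrightarrow> p x \<in> A"
  shows "young_class M A p = young_class M B q"
  unfolding young_class_def
proof (rule sum.reindex_bij_witness[of _ "\<lambda>h. \<lambda>x\<in>M. inv_into A k (h x)" "\<lambda>h. \<lambda>x\<in>M. k (h x)"])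
  have i: "inv_into A k x \<in> A" "k (inv_into A k x) = x" if "x \<in> B" for x
    using k that by (simp_all add: bij_betw_inv_into_right) (metis bij_betw_imp_surj_on inv_into_into)
  have j: "k x \<in> B" "inv_into A k (k x) = x" if "x \<in> A" for x
    using k that by (simp_all add: bij_betw_inv_into_left) (auto dest: bij_betwE)
  {
    fix h assume h: "h \<in> bijs M A"
    then have hA: "h x \<in> A" if "x \<in> M" for x using that by (auto simp: bijs_def)
    show "(\<lambda>x\<in>M. inv_into A k ((\<lambda>x\<in>M. k (h x)) x)) = h"
      using h hA j by (auto simp: fun_eq_iff bijs_def PiE_iff extensional_def)
    have "bij_betw (k \<circ> h) M B" using h by (intro bij_betw_trans[OF _ k]) (simp add: bijs_def)
    then have "bij_betw (\<lambda>x\<in>M. k (h x)) M B" by (simp add: o_def cong: bij_betw_cong)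
    then show "(\<lambda>x\<in>M. k (h x)) \<in> bijs M B" by (auto simp: bijs_def dest: bij_betwE)
    have "((\<lambda>x\<in>M. k (h x)) (s x) = q ((\<lambda>x\<in>M. k (h x)) x)) = (h (s x) = p (h x))" if s: "s permutes M" and x: "x \<in> M" for s x
    proof -
      have "s x \<in> M" using x permutes_in_image[OF s] by blast
      then have "((\<lambda>x\<in>M. k (h x)) (s x) = q ((\<lambda>x\<in>M. k (h x)) x)) = (k (h (s x)) = k (p (h x)))"
        using x kp hA by simp
      also have "\<dots> = (h (s x) = p (h x))"
        using bij_betw_imp_inj_on[OF k] hA \<open>s x \<in> M\<close> x p by (simp add: inj_on_eq_iff)
      finally show ?thesis .
    qed
    then show "young_pairing M (\<lambda>s. of_bool (\<forall>x\<in>M. (\<lambda>x\<in>M. k (h x)) (s x) = q ((\<lambda>x\<in>M. k (h x)) x))) =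
        young_pairing M (\<lambda>s. of_bool (\<forall>x\<in>M. h (s x) = p (h x)))"
      by (intro young_pairing_cong) simp
  next
    fix h assume h: "h \<in> bijs M B"
    then have hB: "h x \<in> B" if "x \<in> M" for x using that by (auto simp: bijs_def)
    show "(\<lambda>x\<in>M. k ((\<lambda>x\<in>M. inv_into A k (h x)) x)) = h"
      using h hB i by (auto simp: fun_eq_iff bijs_def PiE_iff extensional_def)
    have "bij_betw (inv_into A k \<circ> h) M A" using h by (intro bij_betw_trans[OF _ bij_betw_inv_into[OF k]]) (simp add: bijs_def)
    then have "bij_betw (\<lambda>x\<in>M. inv_into A k (h x)) M A" by (simp add: o_def cong: bij_betw_cong)
    then show "(\<lambda>x\<in>M. inv_into A k (h x)) \<in> bijs M A" by (auto simp: bijs_def dest: bij_betwE)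
  }
qed

lemma young_class_class_function: "class_function A (young_class M A)"
  unfolding class_function_def
proof (intro allI impI)
  fix p q assume p: "p permutes A" and q: "q permutes A"
  show "young_class M A (q \<circ> p) = young_class M A (p \<circ> q)"
    by (rule young_class_transport[of p])
      (use permutes_imp_bij[OF p] permutes_in_image[OF p] permutes_in_image[OF q] in auto)
qed

text \<open>For each \<open>h\<close> exactly one \<open>p\<close> matches \<open>q\<close>, namely
  its transport along \<open>h\<close>. If \<open>f\<close> is compatible with transports, all
  \<open>h\<close> therefore contribute the same amount.\<close>

lemma sum_young_class:
  assumes fin: "finite A" "finite M"
    and f: "\<And>h q p. h \<in> bijs M A \<Longrightarrow> q permutes M \<Longrightarrow> p permutes A \<Longrightarrow> \<forall>x\<in>M. h (q x) = p (h x) \<Longrightarrow> f p = f' q"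
  shows "(\<Sum>p | p permutes A. young_class M A p * f p) = of_nat (card (bijs M A)) * young_pairing M f'"
proof -
  have inner: "(\<Sum>p | p permutes A. of_bool (\<forall>x\<in>M. h (q x) = p (h x)) * f p) = f' q"
    if h: "h \<in> bijs M A" and q: "q permutes M" for h q
  proof -
    have hb: "bij_betw h M A" using h by (simp add: bijs_def)
    define p0 where "p0 = map_permutation M h q"
    have p0: "p0 permutes A" unfolding p0_def by (rule map_permutation_permutes[OF hb q])
    have ph: "h (q x) = p0 (h x)" if "x \<in> M" for x
      unfolding p0_def using map_permutation_apply[OF bij_betw_imp_inj_on[OF hb] that] by simp
    have uniq: "p = p0" if p: "p permutes A" and e: "\<forall>x\<in>M. h (q x) = p (h x)" for p
    proof
      fix y show "p y = p0 y"
      proof (cases "y \<in> A")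
        case True
        then obtain x where "x \<in> M" "y = h x" using bij_betw_imp_surj_on[OF hb] by blast
        then show ?thesis using e ph by simp
      next
        case False
        then show ?thesis using permutes_not_in[OF p] permutes_not_in[OF p0] by simp
      qed
    qed
    have "(\<Sum>p | p permutes A. of_bool (\<forall>x\<in>M. h (q x) = p (h x)) * f p) = (\<Sum>p | p permutes A. if p = p0 then f p else 0)"
      using uniq ph by (intro sum.cong refl) auto
    also have "\<dots> = f p0" using p0 fin by (simp add: finite_permutations)
    also have "\<dots> = f' q" using f[OF h q p0] ph by simp
    finally show ?thesis .
  qed
  have "(\<Sum>p | p permutes A. young_class M A p * f p) =
    (\<Sum>p | p permutes A. \<Sum>h\<in>bijs M A. young_pairing M (\<lambda>q. of_bool (\<forall>x\<in>M. h (q x) = p (h x)) * f p))"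
    unfolding young_class_def sum_distrib_right
    by (intro sum.cong refl) (simp add: mult.commute[of _ "f _"] young_pairing_scale)
  also have "\<dots> = (\<Sum>h\<in>bijs M A. \<Sum>p | p permutes A. young_pairing M (\<lambda>q. of_bool (\<forall>x\<in>M. h (q x) = p (h x)) * f p))"
    by (rule sum.swap)
  also have "\<dots> = (\<Sum>h\<in>bijs M A. young_pairing M f')"
    unfolding young_pairing_sum[symmetric]
    by (intro sum.cong refl young_pairing_cong inner)
  finally show ?thesis by simp
qed

subsection \<open>Positivity\<close>

lemma sum_rotate:
  "(\<Sum>a\<in>A. \<Sum>b\<in>B. \<Sum>c\<in>C. f a b c) = (\<Sum>b\<in>B. \<Sum>c\<in>C. \<Sum>a\<in>A. f a b c)"
  by (rule trans[OF sum.swap sum.cong[OF refl sum.swap]])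

text \<open>For symmetric \<open>P\<close> and \<open>Q\<close> with
  \<open>P\<^sup>2 = \<alpha> P\<close> and \<open>Q\<^sup>2 = \<beta> Q\<close>, the number
  \<open>\<alpha> \<beta> tr (P Q)\<close> is the sum of the squares of the entries of
  \<open>P Q\<close>.\<close>

lemma trace_product_nonneg:
  fixes P Q :: "'x \<Rightarrow> 'x \<Rightarrow> rat"
  assumes X: "finite X" and sym: "\<And>h g. h \<in> X \<Longrightarrow> g \<in> X \<Longrightarrow> P h g = P g h" "\<And>h g. h \<in> X \<Longrightarrow> g \<in> X \<Longrightarrow> Q h g = Q g h"
    and idem: "\<And>h g. h \<in> X \<Longrightarrow> g \<in> X \<Longrightarrow> (\<Sum>k\<in>X. P h k * P k g) = \<alpha> * P h g"
      "\<And>h g. h \<in> X \<Longrightarrow> g \<in> X \<Longrightarrow> (\<Sum>k\<in>X. Q h k * Q k g) = \<beta> * Q h g"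
    and pos: "0 < \<alpha>" "0 < \<beta>"
  shows "0 \<le> (\<Sum>h\<in>X. \<Sum>g\<in>X. P h g * Q g h)"
proof -
  have "(\<Sum>h\<in>X. \<Sum>g\<in>X. (\<Sum>k\<in>X. P h k * Q k g)\<^sup>2)
      = (\<Sum>h\<in>X. \<Sum>g\<in>X. \<Sum>k\<in>X. \<Sum>m\<in>X. (P k h * P h m) * (Q m g * Q g k))"
    unfolding power2_eq_square sum_product
    by (intro sum.cong refl) (simp add: sym mult_ac)
  also have "\<dots> = (\<Sum>h\<in>X. \<Sum>k\<in>X. \<Sum>m\<in>X. \<Sum>g\<in>X. (P k h * P h m) * (Q m g * Q g k))"
    by (rule sum.cong[OF refl sum_rotate])
  also have "\<dots> = (\<Sum>k\<in>X. \<Sum>m\<in>X. \<Sum>h\<in>X. \<Sum>g\<in>X. (P k h * P h m) * (Q m g * Q g k))"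
    by (rule sum_rotate)
  also have "\<dots> = (\<Sum>k\<in>X. \<Sum>m\<in>X. (\<Sum>h\<in>X. P k h * P h m) * (\<Sum>g\<in>X. Q m g * Q g k))"
    by (simp add: sum_product)
  also have "\<dots> = (\<Sum>k\<in>X. \<Sum>m\<in>X. \<alpha> * \<beta> * (P k m * Q m k))"
    by (intro sum.cong refl) (simp add: idem mult_ac)
  also have "\<dots> = \<alpha> * \<beta> * (\<Sum>k\<in>X. \<Sum>m\<in>X. P k m * Q m k)" by (simp add: sum_distrib_left)
  finally have "0 \<le> \<alpha> * \<beta> * (\<Sum>k\<in>X. \<Sum>m\<in>X. P k m * Q m k)"
    by (metis (no_types, lifting) sum_nonneg zero_le_power2)
  moreover have "0 < \<alpha> * \<beta>" using pos by simp
  ultimately show ?thesis by (meson linorder_not_less mult_pos_neg)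
qed

text \<open>The matrix, indexed by bijections from \<open>B\<close>, of the weighted sum of the
  operators \<open>h \<mapsto> s \<circ> h \<circ> s'^-1\<close>; the condition is multiplied out so
  that no inverse occurs.\<close>

definition stab_kernel ::
  "('a \<Rightarrow> 'a) set \<Rightarrow> ('b \<Rightarrow> 'b) set \<Rightarrow> (('a \<Rightarrow> 'a) \<Rightarrow> rat) \<Rightarrow> (('b \<Rightarrow> 'b) \<Rightarrow> rat) \<Rightarrow> 'b set \<Rightarrow> ('b \<Rightarrow> 'a) \<Rightarrow> ('b \<Rightarrow> 'a) \<Rightarrow> rat" where
  "stab_kernel S S' e e' B h g = (\<Sum>s\<in>S. \<Sum>s'\<in>S'. e s * e' s' * of_bool (\<forall>x\<in>B. s (h x) = g (s' x)))"

text \<open>Inverting the elements of both groups transposes the matrix.\<close>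

lemma stab_kernel_sym:
  assumes e: "\<And>s. s \<in> color_stab A c \<Longrightarrow> e (inv_into UNIV s) = e s"
    "\<And>s. s \<in> color_stab B c' \<Longrightarrow> e' (inv_into UNIV s) = e' s"
  shows "stab_kernel (color_stab A c) (color_stab B c') e e' B h g = stab_kernel (color_stab A c) (color_stab B c') e e' B g h"
proof -
  let ?i = "inv_into UNIV"
  let ?F = "\<lambda>s s'. e s * e' s' * of_bool (\<forall>x\<in>B. s (h x) = g (s' x)) :: rat"
  have eq: "(\<forall>x\<in>B. ?i s (h x) = g (?i s' x)) \<longleftrightarrow> (\<forall>x\<in>B. s (g x) = h (s' x))"
    if s: "s \<in> color_stab A c" "s' \<in> color_stab B c'" for s s'
  proof -
    have sp: "s permutes A" "s' permutes B" using s by (auto simp: color_stab_def)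
    have i: "s (?i s x) = x" "?i s (s x) = x" for x using sp by (simp_all add: permutes_inverses)
    have i': "s' (?i s' x) = x" "?i s' (s' x) = x" for x using sp by (simp_all add: permutes_inverses)
    have m: "s' x \<in> B \<longleftrightarrow> x \<in> B" "?i s' x \<in> B \<longleftrightarrow> x \<in> B" for x
      using permutes_in_image[OF sp(2)] permutes_in_image[OF permutes_inv[OF sp(2)]] by auto
    show ?thesis
    proof
      assume a: "\<forall>x\<in>B. ?i s (h x) = g (?i s' x)"
      show "\<forall>x\<in>B. s (g x) = h (s' x)"
      proof
        fix x assume "x \<in> B"
        then have "?i s (h (s' x)) = g x" using a[rule_format, of "s' x"] m i' by simp
        then show "s (g x) = h (s' x)" using i(1)[of "h (s' x)"] by simp
      qed
    next
      assume a: "\<forall>x\<in>B. s (g x) = h (s' x)"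
      show "\<forall>x\<in>B. ?i s (h x) = g (?i s' x)"
      proof
        fix x assume "x \<in> B"
        then have "s (g (?i s' x)) = h x" using a[rule_format, of "?i s' x"] m i' by simp
        then show "?i s (h x) = g (?i s' x)" using i(2)[of "g (?i s' x)"] by simp
      qed
    qed
  qed
  have "(\<Sum>s\<in>color_stab A c. \<Sum>s'\<in>color_stab B c'. ?F s s') = (\<Sum>s\<in>color_stab A c. \<Sum>s'\<in>color_stab B c'. ?F (?i s) (?i s'))"
    by (simp only: sum_color_stab_inv[of "\<lambda>s'. ?F _ s'"] sum_color_stab_inv[of "\<lambda>s. \<Sum>s'\<in>color_stab B c'. ?F s s'"])
  also have "\<dots> = (\<Sum>s\<in>color_stab A c. \<Sum>s'\<in>color_stab B c'. e s * e' s' * of_bool (\<forall>x\<in>B. s (g x) = h (s' x)))"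
    by (intro sum.cong refl) (simp only: eq e)
  finally show ?thesis unfolding stab_kernel_def .
qed

lemma stab_kernel_compose:
  assumes fin: "finite A" "finite B" and h: "h \<in> bijs B A"
    and S: "\<And>s. s \<in> S1 \<Longrightarrow> s permutes A" "\<And>s. s \<in> S1' \<Longrightarrow> s permutes B"
  shows "(\<Sum>k\<in>bijs B A. stab_kernel S1 S1' e1 e1' B h k * stab_kernel S2 S2' e2 e2' B k g) =
    (\<Sum>s1\<in>S1. \<Sum>s1'\<in>S1'. \<Sum>s2\<in>S2. \<Sum>s2'\<in>S2'. e1 s1 * e1' s1' * (e2 s2 * e2' s2') *
      of_bool (\<forall>x\<in>B. s2 (s1 (h x)) = g (s2' (s1' x))))"
proof -
  have inner: "(\<Sum>k\<in>bijs B A. of_bool (\<forall>x\<in>B. s1 (h x) = k (s1' x)) * of_bool (\<forall>x\<in>B. s2 (k x) = g (s2' x))) =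
     (of_bool (\<forall>x\<in>B. s2 (s1 (h x)) = g (s2' (s1' x))) :: rat)"
    if s: "s1 \<in> S1" "s1' \<in> S1'" for s1 s1' s2 s2'
  proof -
    define k0 where "k0 = (\<lambda>x\<in>B. s1 (h (inv_into UNIV s1' x)))"
    note k0 = bijs_ex1[OF h S(1)[OF s(1)] S(2)[OF s(2)], folded k0_def]
    have sp: "s1' permutes B" using S s by blast
    have "(\<forall>x\<in>B. s2 (k0 x) = g (s2' x)) \<longleftrightarrow> (\<forall>x\<in>s1' ` B. s2 (k0 x) = g (s2' x))"
      by (simp only: permutes_image[OF sp])
    also have "\<dots> \<longleftrightarrow> (\<forall>x\<in>B. s2 (s1 (h x)) = g (s2' (s1' x)))" using k0(2) by simp
    finally have eq: "(\<forall>x\<in>B. s2 (k0 x) = g (s2' x)) \<longleftrightarrow> (\<forall>x\<in>B. s2 (s1 (h x)) = g (s2' (s1' x)))" .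
    have "(\<Sum>k\<in>bijs B A. of_bool (\<forall>x\<in>B. s1 (h x) = k (s1' x)) * of_bool (\<forall>x\<in>B. s2 (k x) = g (s2' x))) =
      (\<Sum>k\<in>bijs B A. if k = k0 then of_bool (\<forall>x\<in>B. s2 (k0 x) = g (s2' x)) else (0::rat))"
    proof (rule sum.cong[OF refl])
      fix k assume k: "k \<in> bijs B A"
      show "of_bool (\<forall>x\<in>B. s1 (h x) = k (s1' x)) * of_bool (\<forall>x\<in>B. s2 (k x) = g (s2' x)) =
        (if k = k0 then of_bool (\<forall>x\<in>B. s2 (k0 x) = g (s2' x)) else (0::rat))"
        using k0(2) k0(3)[OF k] by (cases "k = k0") auto
    qed
    also have "\<dots> = of_bool (\<forall>x\<in>B. s2 (k0 x) = g (s2' x))"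
      using k0(1) finite_bijs[OF fin] by simp
    finally show ?thesis unfolding eq .
  qed
  have "(\<Sum>k\<in>bijs B A. stab_kernel S1 S1' e1 e1' B h k * stab_kernel S2 S2' e2 e2' B k g) =
    (\<Sum>k\<in>bijs B A. \<Sum>s1\<in>S1. \<Sum>s1'\<in>S1'. \<Sum>s2\<in>S2. \<Sum>s2'\<in>S2'. e1 s1 * e1' s1' * (e2 s2 * e2' s2') *
      (of_bool (\<forall>x\<in>B. s1 (h x) = k (s1' x)) * of_bool (\<forall>x\<in>B. s2 (k x) = g (s2' x))))"
    unfolding stab_kernel_def sum_distrib_right
    unfolding sum_distrib_left
    by (intro sum.cong refl) (simp add: mult_ac)
  also have "\<dots> = (\<Sum>s1\<in>S1. \<Sum>s1'\<in>S1'. \<Sum>s2\<in>S2. \<Sum>s2'\<in>S2'. \<Sum>k\<in>bijs B A. e1 s1 * e1' s1' * (e2 s2 * e2' s2') *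
      (of_bool (\<forall>x\<in>B. s1 (h x) = k (s1' x)) * of_bool (\<forall>x\<in>B. s2 (k x) = g (s2' x))))"
    by (rule trans[OF sum_rotate], rule sum.cong[OF refl], rule sum.cong[OF refl], rule sum_rotate)
  also have "\<dots> = (\<Sum>s1\<in>S1. \<Sum>s1'\<in>S1'. \<Sum>s2\<in>S2. \<Sum>s2'\<in>S2'. e1 s1 * e1' s1' * (e2 s2 * e2' s2') *
      of_bool (\<forall>x\<in>B. s2 (s1 (h x)) = g (s2' (s1' x))))"
    by (intro sum.cong refl) (simp only: sum_distrib_left[symmetric] inner)
  finally show ?thesis .
qed

text \<open>For multiplicative weights the first factor only translates the summation over the
  groups in the second, so squaring multiplies the kernel by the product of the group
  orders.\<close>

lemma stab_kernel_idem:
  assumes fin: "finite A" "finite B" and h: "h \<in> bijs B A"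
    and e: "\<And>s t. s \<in> color_stab A c \<Longrightarrow> t \<in> color_stab A c \<Longrightarrow> e (t \<circ> s) = e t * e s"
      "\<And>s t. s \<in> color_stab B c' \<Longrightarrow> t \<in> color_stab B c' \<Longrightarrow> e' (t \<circ> s) = e' t * e' s"
  defines "S \<equiv> color_stab A c" and "S' \<equiv> color_stab B c'"
  shows "(\<Sum>k\<in>bijs B A. stab_kernel S S' e e' B h k * stab_kernel S S' e e' B k g) =
    of_nat (card S * card S') * stab_kernel S S' e e' B h g"
proof -
  let ?F = "\<lambda>s s'. e s * e' s' * of_bool (\<forall>x\<in>B. s (h x) = g (s' x))"
  have "(\<Sum>k\<in>bijs B A. stab_kernel S S' e e' B h k * stab_kernel S S' e e' B k g) =
    (\<Sum>s1\<in>S. \<Sum>s1'\<in>S'. \<Sum>s2\<in>S. \<Sum>s2'\<in>S'. e s1 * e' s1' * (e s2 * e' s2') *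
      of_bool (\<forall>x\<in>B. s2 (s1 (h x)) = g (s2' (s1' x))))"
    by (rule stab_kernel_compose[OF fin h]) (auto simp: S_def S'_def color_stab_def)
  also have "\<dots> = (\<Sum>s1\<in>S. \<Sum>s1'\<in>S'. \<Sum>s2\<in>S. \<Sum>s2'\<in>S'. ?F (s2 \<circ> s1) (s2' \<circ> s1'))"
    by (intro sum.cong refl) (simp add: e S_def S'_def mult_ac)
  also have "\<dots> = (\<Sum>s1\<in>S. \<Sum>s1'\<in>S'. stab_kernel S S' e e' B h g)"
  proof (intro sum.cong refl)
    fix s1 s1' assume s: "s1 \<in> S" "s1' \<in> S'"
    have "(\<Sum>s2\<in>S. \<Sum>s2'\<in>S'. ?F (s2 \<circ> s1) (s2' \<circ> s1')) = (\<Sum>s2\<in>S. \<Sum>s2'\<in>S'. ?F (s2 \<circ> s1) s2')"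
      unfolding S'_def by (intro sum.cong refl sum_color_stab_right[OF s(2)[unfolded S'_def]])
    also have "\<dots> = (\<Sum>s2\<in>S. \<Sum>s2'\<in>S'. ?F s2 s2')"
      unfolding S_def by (rule sum_color_stab_right[OF s(1)[unfolded S_def], of "\<lambda>s. \<Sum>s2'\<in>S'. ?F s s2'"])
    finally show "(\<Sum>s2\<in>S. \<Sum>s2'\<in>S'. ?F (s2 \<circ> s1) (s2' \<circ> s1')) = stab_kernel S S' e e' B h g"
      by (simp add: stab_kernel_def)
  qed
  finally show ?thesis by simp
qed

text \<open>The weight is the trace of the product of two positive multiples of symmetric idempotents: symmetrizing
  over the rows, and antisymmetrizing over the columns, of both diagrams.\<close>

lemma young_pairing_young_class_nonneg:
  assumes fin: "finite M" "finite M'"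
  shows "0 \<le> young_pairing M (young_class M' M)"
proof -
  let ?R = "color_stab M fst" and ?C = "color_stab M snd"
  let ?R' = "color_stab M' fst" and ?C' = "color_stab M' snd"
  let ?s = "\<lambda>p. of_int (sign p) :: rat"
  let ?P = "stab_kernel ?R ?R' (\<lambda>_. 1) (\<lambda>_. 1) M'"
  let ?Q = "stab_kernel ?C ?C' ?s ?s M'"
  have perm: "permutation s" if "s \<in> color_stab A c" "finite A" for s :: "'x \<Rightarrow> 'x" and A and c :: "'x \<Rightarrow> 'y"
    using that permutes_imp_permutation by (auto simp: color_stab_def)
  have "young_pairing M (young_class M' M) = (\<Sum>\<sigma>\<in>?R. \<Sum>\<tau>\<in>?C. \<Sum>h\<in>bijs M' M. \<Sum>\<sigma>'\<in>?R'. \<Sum>\<tau>'\<in>?C'.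
      ?s \<tau> * ?s \<tau>' * of_bool (\<forall>x\<in>M'. h (\<tau>' (\<sigma>' x)) = \<tau> (\<sigma> (h x))))"
    unfolding young_pairing_def young_class_def sum_distrib_left by (simp add: mult.assoc)
  also have "\<dots> = (\<Sum>h\<in>bijs M' M. \<Sum>\<sigma>\<in>?R. \<Sum>\<tau>\<in>?C. \<Sum>\<sigma>'\<in>?R'. \<Sum>\<tau>'\<in>?C'.
      ?s \<tau> * ?s \<tau>' * of_bool (\<forall>x\<in>M'. h (\<tau>' (\<sigma>' x)) = \<tau> (\<sigma> (h x))))"
    by (rule sum_rotate[symmetric])
  \<comment> \<open>Both row elements are moved in front of both column elements: on either side of
    the equation rows act first, so the inner sums are the product of a row kernel and a column
    kernel.\<close>
  also have "\<dots> = (\<Sum>h\<in>bijs M' M. \<Sum>\<sigma>\<in>?R. \<Sum>\<sigma>'\<in>?R'. \<Sum>\<tau>\<in>?C. \<Sum>\<tau>'\<in>?C'.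
      1 * 1 * (?s \<tau> * ?s \<tau>') * of_bool (\<forall>x\<in>M'. \<tau> (\<sigma> (h x)) = h (\<tau>' (\<sigma>' x))))"
    by (rule sum.cong[OF refl], rule sum.cong[OF refl], rule trans[OF sum.swap], intro sum.cong refl)
      (auto simp: eq_commute)
  also have "\<dots> = (\<Sum>h\<in>bijs M' M. \<Sum>k\<in>bijs M' M. ?P h k * ?Q k h)"
    by (intro sum.cong refl stab_kernel_compose[symmetric] fin) (auto simp: color_stab_def)
  finally have eq: "young_pairing M (young_class M' M) = (\<Sum>h\<in>bijs M' M. \<Sum>k\<in>bijs M' M. ?P h k * ?Q k h)" .
  have si: "?s (inv_into UNIV s) = ?s s" if "s \<in> color_stab A c" "finite A" for s :: "'x \<Rightarrow> 'x" and A and c :: "'x \<Rightarrow> 'y"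
    using perm[OF that] by (simp add: sign_inverse)
  have sc: "?s (t \<circ> s) = ?s t * ?s s" if "s \<in> color_stab A c" "t \<in> color_stab A c" "finite A"
    for s t :: "'x \<Rightarrow> 'x" and A and c :: "'x \<Rightarrow> 'y"
    using perm[OF that(1,3)] perm[OF that(2,3)] by (simp add: sign_compose)
  show ?thesis unfolding eq
  proof (rule trace_product_nonneg[OF finite_bijs[OF fin]])
    show "?P h g = ?P g h" for h g by (rule stab_kernel_sym) auto
    show "?Q h g = ?Q g h" for h g by (rule stab_kernel_sym) (rule si[OF _ fin(1)] si[OF _ fin(2)], assumption)+
    show "(\<Sum>k\<in>bijs M' M. ?P h k * ?P k g) = of_nat (card ?R * card ?R') * ?P h g" if "h \<in> bijs M' M" for h g
      by (rule stab_kernel_idem[OF fin that]) auto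
    show "(\<Sum>k\<in>bijs M' M. ?Q h k * ?Q k g) = of_nat (card ?C * card ?C') * ?Q h g" if "h \<in> bijs M' M" for h g
      by (rule stab_kernel_idem[OF fin that]) (simp_all add: sc[OF _ _ fin(1)] sc[OF _ _ fin(2)])
    show "0 < (of_nat (card ?R * card ?R') :: rat)" "0 < (of_nat (card ?C * card ?C') :: rat)"
      using card_color_stab_pos[OF fin(1), of fst] card_color_stab_pos[OF fin(1), of snd]
        card_color_stab_pos[OF fin(2), of fst] card_color_stab_pos[OF fin(2), of snd] by simp_all
  qed
qed

subsection \<open>Young symmetrizers of Young diagrams\<close>

text \<open>Left multiplication by the transposition is a sign-reversing involution of the column
  group.\<close>

lemma alternating_sum_zero:
  fixes G :: "('a \<times> 'b \<Rightarrow> 'a \<times> 'b) \<Rightarrow> rat"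
  assumes M: "finite M" and xy: "x \<in> M" "y \<in> M" "x \<noteq> y" "snd x = snd y"
    and G: "\<And>\<tau>. \<tau> \<in> color_stab M snd \<Longrightarrow> G (transpose x y \<circ> \<tau>) = G \<tau>"
  shows "(\<Sum>\<tau>\<in>color_stab M snd. of_int (sign \<tau>) * G \<tau>) = 0"
proof -
  let ?t = "transpose x y"
  have t: "?t \<in> color_stab M snd"
    using xy by (auto simp: color_stab_def transpose_def intro: permutes_swap_id)
  have "of_int (sign (?t \<circ> \<tau>)) * G (?t \<circ> \<tau>) = - (of_int (sign \<tau>) * G \<tau>)" if \<tau>: "\<tau> \<in> color_stab M snd" for \<tau>
  proof -
    have "permutation \<tau>" using \<tau> permutes_imp_permutation[OF M] by (auto simp: color_stab_def)
    then have "sign (?t \<circ> \<tau>) = - sign \<tau>" using xy(3) by (simp add: sign_compose permutation_swap_id sign_swap_id)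
    then show ?thesis using G[OF \<tau>] by simp
  qed
  then have "(\<Sum>\<tau>\<in>color_stab M snd. of_int (sign (?t \<circ> \<tau>)) * G (?t \<circ> \<tau>)) = - (\<Sum>\<tau>\<in>color_stab M snd. of_int (sign \<tau>) * G \<tau>)"
    by (simp add: sum_negf)
  then show ?thesis using sum_color_stab_left[OF t, of "\<lambda>\<tau>. of_int (sign \<tau>) * G \<tau>"] by simp
qed

text \<open>If two boxes of a column share a color, their transposition fixes the coloring and the
  alternating sum over the column group vanishes. So only colorings that are injective on columns
  survive.\<close>

lemma young_pairing_frob_nonzero:
  fixes M :: "('a \<times> 'b) set"
  assumes M: "finite M" and nz: "young_pairing M (frob l \<kappa> M) \<noteq> 0"
  obtains c where "c \<in> M \<rightarrow>\<^sub>E {..<l}" "vdm_coeff l (\<lambda>i. \<kappa> i - int (color_count M c i)) \<noteq> 0"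
    "\<And>x y. x \<in> M \<Longrightarrow> y \<in> M \<Longrightarrow> x \<noteq> y \<Longrightarrow> snd x = snd y \<Longrightarrow> c x \<noteq> c y"
proof -
  let ?C = "M \<rightarrow>\<^sub>E {..<l}"
  let ?V = "\<lambda>c. vdm_coeff l (\<lambda>i. \<kappa> i - int (color_count M c i))"
  let ?I = "\<lambda>c q. of_bool (\<forall>x\<in>M. c (q x) = c x) :: rat"
  have finC: "finite ?C" using M by (simp add: finite_PiE)
  have "frob l \<kappa> M q = (\<Sum>c\<in>?C. ?V c * ?I c q)" for q
    unfolding frob_def fixed_colorings_def sum.inter_filter[OF finC] by (intro sum.cong) auto
  then have "young_pairing M (frob l \<kappa> M) = young_pairing M (\<lambda>q. \<Sum>c\<in>?C. ?V c * ?I c q)"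
    by (intro young_pairing_cong)
  also have "\<dots> = (\<Sum>c\<in>?C. ?V c * young_pairing M (?I c))"
    by (simp add: young_pairing_sum young_pairing_scale)
  finally have "(\<Sum>c\<in>?C. ?V c * young_pairing M (?I c)) \<noteq> 0" using nz by simp
  then obtain c where c: "c \<in> ?C" "?V c * young_pairing M (?I c) \<noteq> 0" by (meson sum.neutral)
  then have "young_pairing M (?I c) \<noteq> 0" by simp
  then obtain \<sigma> where \<sigma>: "(\<Sum>\<tau>\<in>color_stab M snd. of_int (sign \<tau>) * ?I c (\<tau> \<circ> \<sigma>)) \<noteq> 0"
    unfolding young_pairing_def by (meson sum.neutral)
  have "c x \<noteq> c y" if "x \<in> M" "y \<in> M" "x \<noteq> y" "snd x = snd y" for x y
  proof
    assume e: "c x = c y"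
    have ct: "c (transpose x y u) = c u" for u using e by (simp add: transpose_def)
    have "(\<Sum>\<tau>\<in>color_stab M snd. of_int (sign \<tau>) * ?I c (\<tau> \<circ> \<sigma>)) = 0"
      by (rule alternating_sum_zero[OF M that]) (simp add: ct)
    then show False using \<sigma> by simp
  qed
  then show ?thesis using c by (intro that[of c]) auto
qed

definition boxes :: "(nat \<Rightarrow> nat) \<Rightarrow> (nat \<times> nat) set" where
  "boxes L = {(i, j). j < L i}"

lemma boxes_Sigma: "L \<in> partition_rows l n \<Longrightarrow> boxes L = (SIGMA i:{..<l}. {..<L i})"
  unfolding boxes_def partition_rows_def by auto (metis not_le not_less0)

lemma finite_boxes: "L \<in> partition_rows l n \<Longrightarrow> finite (boxes L)"
  by (simp add: boxes_Sigma)

lemma card_boxes: "L \<in> partition_rows l n \<Longrightarrow> card (boxes L) = n"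
  by (simp add: boxes_Sigma) (simp add: partition_rows_def)

text \<open>A column of length \<open>m\<close> has at most \<open>min j m\<close> boxes of the first \<open>j\<close> colors.\<close>

lemma column_injective_dominated:
  assumes L: "L \<in> partition_rows l n"
    and inj: "\<And>x y. x \<in> boxes L \<Longrightarrow> y \<in> boxes L \<Longrightarrow> x \<noteq> y \<Longrightarrow> snd x = snd y \<Longrightarrow> c x \<noteq> c y"
  shows "dominated l (color_count (boxes L) c) L"
  unfolding dominated_def
proof (intro allI impI)
  fix j assume "j \<le> l"
  let ?B = "boxes L"
  have fin: "finite ?B" by (rule finite_boxes[OF L])
  define S where "S = {x \<in> ?B. c x < j}"
  have finS: "finite S" using fin by (simp add: S_def)
  have Lle: "L b \<le> L a" if "a \<le> b" for a b using partition_rows_le[OF L that] .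
  have "(\<Sum>i<j. color_count ?B c i) = card S"
  proof -
    have "c ` S \<subseteq> {..<j}" by (auto simp: S_def)
    then have "(\<Sum>i<j. card {x \<in> S. c x = i}) = card S"
      using sum.group[of S "{..<j}" c "\<lambda>_. 1::nat"] finS by simp
    moreover have "{x \<in> S. c x = i} = {x \<in> ?B. c x = i}" if "i < j" for i using that by (auto simp: S_def)
    ultimately show ?thesis by (simp add: color_count_def)
  qed
  also have "card S = (\<Sum>y<L 0. card {x \<in> S. snd x = y})"
  proof -
    have "snd ` S \<subseteq> {..<L 0}" using Lle[of 0] by (auto simp: S_def boxes_def intro: less_le_trans)
    then show ?thesis using sum.group[of S "{..<L 0}" snd "\<lambda>_. 1::nat"] finS by simp
  qed
  also have "\<dots> \<le> (\<Sum>y<L 0. card {i \<in> {..<j}. y < L i})"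
  proof (rule sum_mono)
    fix y
    let ?S = "{x \<in> S. snd x = y}"
    show "card ?S \<le> card {i \<in> {..<j}. y < L i}"
    proof (cases "\<forall>i<j. y < L i")
      case True
      have "inj_on c ?S" by (rule inj_onI) (use inj in \<open>auto simp: S_def\<close>)
      moreover have "c ` ?S \<subseteq> {..<j}" by (auto simp: S_def)
      ultimately have "card ?S \<le> card {..<j}" by (rule card_inj_on_le[OF _ _ finite_lessThan])
      also have "{..<j} = {i \<in> {..<j}. y < L i}" using True by auto
      finally show ?thesis .
    next
      case False
      then obtain i0 where i0: "i0 < j" "L i0 \<le> y" by (auto simp: not_less)
      have "inj_on fst ?S" by (auto simp: inj_on_def)
      moreover have "fst ` ?S \<subseteq> {i \<in> {..<j}. y < L i}"
      proof
        fix i assume "i \<in> fst ` ?S"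
        then have "y < L i" by (auto simp: S_def boxes_def)
        moreover have "i < j"
        proof (rule ccontr)
          assume "\<not> i < j"
          then have "L i \<le> L i0" using i0 by (intro Lle) simp
          then show False using \<open>y < L i\<close> i0 by simp
        qed
        ultimately show "i \<in> {i \<in> {..<j}. y < L i}" by simp
      qed
      ultimately show ?thesis by (intro card_inj_on_le[of fst]) auto
    qed
  qed
  also have "\<dots> = (\<Sum>i<j. L i)"
  proof -
    have "(\<Sum>y<L 0. card {i \<in> {..<j}. y < L i}) = (\<Sum>y<L 0. \<Sum>i<j. if y < L i then 1 else 0)"
      by (intro sum.cong refl) (simp flip: sum.inter_filter)
    also have "\<dots> = (\<Sum>i<j. \<Sum>y<L 0. if y < L i then 1 else 0)" by (rule sum.swap)
    also have "\<dots> = (\<Sum>i<j. L i)"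
    proof (rule sum.cong[OF refl])
      fix i
      have "{y \<in> {..<L 0}. y < L i} = {..<L i}" using Lle[of 0 i] by auto
      then show "(\<Sum>y<L 0. if y < L i then 1 else 0) = L i" by (simp flip: sum.inter_filter)
    qed
    finally show ?thesis .
  qed
  finally show "(\<Sum>i<j. color_count ?B c i) \<le> (\<Sum>i<j. L i)" .
qed

text \<open>The two factors may be exchanged under a class function. For
  \<open>young_pairing_young_class_dominated\<close> this puts the row element
  \<open>\<sigma>\<close> outermost, where it can absorb a transposition.\<close>

lemma young_pairing_class_function:
  assumes "class_function M f"
  shows "young_pairing M f = (\<Sum>\<sigma>\<in>color_stab M fst. \<Sum>\<tau>\<in>color_stab M snd. of_int (sign \<tau>) * f (\<sigma> \<circ> \<tau>))"
  using assms unfolding young_pairing_def class_function_def color_stab_def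
  by (intro sum.cong refl) auto

text \<open>Some bijection \<open>h\<close> from the boxes of \<open>L'\<close> to those of
  \<open>L\<close> has a nonzero contribution. It sends boxes of one column to different rows:
  otherwise their transposition is carried by \<open>h\<close> to one in the row group of
  \<open>L\<close>, \<open>\<sigma>\<close> absorbs it, and the alternating sum cancels. Coloring a
  box by the row of its image thus gives a coloring of \<open>L'\<close> that is injective on
  columns and has the counts \<open>L\<close>.\<close>

lemma young_pairing_young_class_dominated:
  assumes L: "L \<in> partition_rows l n" and L': "L' \<in> partition_rows l n'"
    and nz: "young_pairing (boxes L) (young_class (boxes L') (boxes L)) \<noteq> 0"
  shows "dominated l L L'"
proof -
  let ?M = "boxes L" and ?M' = "boxes L'"
  let ?R = "color_stab ?M fst" and ?C = "color_stab ?M snd"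
  let ?R' = "color_stab ?M' fst" and ?C' = "color_stab ?M' snd"
  let ?s = "\<lambda>p. of_int (sign p) :: rat"
  let ?I = "\<lambda>h \<sigma> \<tau> \<sigma>' \<tau>'. of_bool (\<forall>x\<in>?M'. h (\<tau>' (\<sigma>' x)) = \<sigma> (\<tau> (h x))) :: rat"
  have fin: "finite ?M'" by (rule finite_boxes[OF L'])
  have "young_pairing ?M (young_class ?M' ?M) = (\<Sum>\<sigma>\<in>?R. \<Sum>\<tau>\<in>?C. \<Sum>h\<in>bijs ?M' ?M. \<Sum>\<sigma>'\<in>?R'. \<Sum>\<tau>'\<in>?C'.
      ?s \<tau> * (?s \<tau>' * ?I h \<sigma> \<tau> \<sigma>' \<tau>'))"
    unfolding young_pairing_class_function[OF young_class_class_function]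
    unfolding young_class_def young_pairing_def sum_distrib_left by simp
  also have "\<dots> = (\<Sum>\<tau>\<in>?C. \<Sum>h\<in>bijs ?M' ?M. \<Sum>\<sigma>\<in>?R. \<Sum>\<sigma>'\<in>?R'. \<Sum>\<tau>'\<in>?C'. ?s \<tau> * (?s \<tau>' * ?I h \<sigma> \<tau> \<sigma>' \<tau>'))"
    by (rule sum_rotate)
  also have "\<dots> = (\<Sum>\<tau>\<in>?C. \<Sum>h\<in>bijs ?M' ?M. \<Sum>\<sigma>'\<in>?R'. \<Sum>\<tau>'\<in>?C'. \<Sum>\<sigma>\<in>?R. ?s \<tau> * (?s \<tau>' * ?I h \<sigma> \<tau> \<sigma>' \<tau>'))"
    by (rule sum.cong[OF refl], rule sum.cong[OF refl], rule sum_rotate)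
  also have "\<dots> = (\<Sum>\<tau>\<in>?C. \<Sum>h\<in>bijs ?M' ?M. \<Sum>\<sigma>'\<in>?R'. ?s \<tau> * (\<Sum>\<tau>'\<in>?C'. ?s \<tau>' * (\<Sum>\<sigma>\<in>?R. ?I h \<sigma> \<tau> \<sigma>' \<tau>')))"
    by (simp only: sum_distrib_left)
  finally have "(\<Sum>\<tau>\<in>?C. \<Sum>h\<in>bijs ?M' ?M. \<Sum>\<sigma>'\<in>?R'. ?s \<tau> * (\<Sum>\<tau>'\<in>?C'. ?s \<tau>' * (\<Sum>\<sigma>\<in>?R. ?I h \<sigma> \<tau> \<sigma>' \<tau>'))) \<noteq> 0"
    using nz by simp
  then obtain \<tau> where "\<tau> \<in> ?C" "(\<Sum>h\<in>bijs ?M' ?M. \<Sum>\<sigma>'\<in>?R'. ?s \<tau> * (\<Sum>\<tau>'\<in>?C'. ?s \<tau>' * (\<Sum>\<sigma>\<in>?R. ?I h \<sigma> \<tau> \<sigma>' \<tau>'))) \<noteq> 0"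
    by (meson sum.neutral)
  then obtain h where h: "h \<in> bijs ?M' ?M" and "(\<Sum>\<sigma>'\<in>?R'. ?s \<tau> * (\<Sum>\<tau>'\<in>?C'. ?s \<tau>' * (\<Sum>\<sigma>\<in>?R. ?I h \<sigma> \<tau> \<sigma>' \<tau>'))) \<noteq> 0"
    by (meson sum.neutral)
  then obtain \<sigma>' where \<sigma>': "\<sigma>' \<in> ?R'" and "?s \<tau> * (\<Sum>\<tau>'\<in>?C'. ?s \<tau>' * (\<Sum>\<sigma>\<in>?R. ?I h \<sigma> \<tau> \<sigma>' \<tau>')) \<noteq> 0"
    by (meson sum.neutral)
  then have nz': "(\<Sum>\<tau>'\<in>?C'. ?s \<tau>' * (\<Sum>\<sigma>\<in>?R. ?I h \<sigma> \<tau> \<sigma>' \<tau>')) \<noteq> 0" by simp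
  have hb: "bij_betw h ?M' ?M" using h by (simp add: bijs_def)
  have hM: "h x \<in> ?M" if "x \<in> ?M'" for x using hb that bij_betwE by blast
  have hinj: "h x = h y \<longleftrightarrow> x = y" if "x \<in> ?M'" "y \<in> ?M'" for x y
    using inj_on_eq_iff[OF bij_betw_imp_inj_on[OF hb] that] .
  have "fst (h x) \<noteq> fst (h y)" if xy: "x \<in> ?M'" "y \<in> ?M'" "x \<noteq> y" "snd x = snd y" for x y
  proof
    assume e: "fst (h x) = fst (h y)"
    let ?t = "transpose x y" and ?u = "transpose (h x) (h y)"
    have "?u permutes ?M" by (rule permutes_swap_id[OF hM[OF xy(1)] hM[OF xy(2)]])
    moreover have "fst (?u z) = fst z" for z using e by (simp add: transpose_def)
    ultimately have u: "?u \<in> ?R" by (simp add: color_stab_def)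
    have ht: "h (?t z) = ?u (h z)" if "z \<in> ?M'" for z
      using hinj that xy by (auto simp: transpose_def)
    have "(\<Sum>\<sigma>\<in>?R. ?I h \<sigma> \<tau> \<sigma>' (?t \<circ> \<tau>')) = (\<Sum>\<sigma>\<in>?R. ?I h \<sigma> \<tau> \<sigma>' \<tau>')" if \<tau>': "\<tau>' \<in> ?C'" for \<tau>'
    proof -
      have mem: "\<tau>' (\<sigma>' z) \<in> ?M'" if "z \<in> ?M'" for z
        using that \<sigma>' \<tau>' by (auto simp: color_stab_def permutes_in_image)
      have "(\<Sum>\<sigma>\<in>?R. ?I h \<sigma> \<tau> \<sigma>' (?t \<circ> \<tau>')) = (\<Sum>\<sigma>\<in>?R. ?I h (?u \<circ> \<sigma>) \<tau> \<sigma>' \<tau>')"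
      proof (rule sum.cong[OF refl])
        fix \<sigma>
        have "h ((?t \<circ> \<tau>') (\<sigma>' z)) = \<sigma> (\<tau> (h z)) \<longleftrightarrow> h (\<tau>' (\<sigma>' z)) = (?u \<circ> \<sigma>) (\<tau> (h z))" if z: "z \<in> ?M'" for z
        proof -
          have "h ((?t \<circ> \<tau>') (\<sigma>' z)) = ?u (h (\<tau>' (\<sigma>' z)))" using ht[OF mem[OF z]] by simp
          moreover have "?u a = b \<longleftrightarrow> a = ?u b" for a b using transpose_involutory[of "h x" "h y"] by metis
          ultimately show ?thesis by (simp only: comp_apply)
        qed
        then show "?I h \<sigma> \<tau> \<sigma>' (?t \<circ> \<tau>') = ?I h (?u \<circ> \<sigma>) \<tau> \<sigma>' \<tau>'" by simp
      qed
      also have "\<dots> = (\<Sum>\<sigma>\<in>?R. ?I h \<sigma> \<tau> \<sigma>' \<tau>')"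
        by (rule sum_color_stab_left[OF u, of "\<lambda>\<sigma>. ?I h \<sigma> \<tau> \<sigma>' \<tau>'"])
      finally show ?thesis .
    qed
    then have "(\<Sum>\<tau>'\<in>?C'. ?s \<tau>' * (\<Sum>\<sigma>\<in>?R. ?I h \<sigma> \<tau> \<sigma>' \<tau>')) = 0"
      by (rule alternating_sum_zero[OF fin xy, of "\<lambda>\<tau>'. \<Sum>\<sigma>\<in>?R. ?I h \<sigma> \<tau> \<sigma>' \<tau>'"])
    then show False using nz' by simp
  qed
  then have "dominated l (color_count ?M' (\<lambda>x. fst (h x))) L'"
    by (intro column_injective_dominated[OF L'])
  moreover have "color_count ?M' (\<lambda>x. fst (h x)) i = L i" for i
  proof -
    have "h ` {x \<in> ?M'. fst (h x) = i} = {x \<in> h ` ?M'. fst x = i}" by blast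
    then have "h ` {x \<in> ?M'. fst (h x) = i} = {x \<in> ?M. fst x = i}"
      by (simp only: bij_betw_imp_surj_on[OF hb])
    then have "card {x \<in> ?M'. fst (h x) = i} = card {x \<in> ?M. fst x = i}"
      using card_image[OF inj_on_subset[OF bij_betw_imp_inj_on[OF hb]], of "{x \<in> ?M'. fst (h x) = i}"] by auto
    also have "{x \<in> ?M. fst x = i} = {i} \<times> {..<L i}" by (auto simp: boxes_def)
    finally show ?thesis by (simp add: color_count_def)
  qed
  ultimately show ?thesis by (simp add: dominated_def)
qed

lemma sum_young_class_frob:
  assumes "finite A" "finite M"
  shows "(\<Sum>p | p permutes A. young_class M A p * frob l \<kappa> A p) = of_nat (card (bijs M A)) * young_pairing M (frob l \<kappa> M)"
proof (rule sum_young_class[OF assms])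
  fix h q p assume "h \<in> bijs M A" and q: "q permutes M" and "\<forall>x\<in>M. h (q x) = p (h x)"
  then show "frob l \<kappa> A p = frob l \<kappa> M q"
    by (intro frob_transport[symmetric, of h]) (auto simp: bijs_def permutes_in_image[OF q])
qed

lemma sum_young_class_young_class:
  assumes "finite A" "finite M"
  shows "(\<Sum>p | p permutes A. young_class M A p * young_class M' A p) = of_nat (card (bijs M A)) * young_pairing M (young_class M' M)"
proof (rule sum_young_class[OF assms])
  fix h q p assume "h \<in> bijs M A" and q: "q permutes M" and "\<forall>x\<in>M. h (q x) = p (h x)"
  then show "young_class M' A p = young_class M' M q"
    by (intro young_class_transport[symmetric, of h]) (auto simp: bijs_def permutes_in_image[OF q])
qed

lemma young_class_orthogonal:
  assumes A: "finite A" and L: "L \<in> partition_rows l n" "L' \<in> partition_rows l n'" "L \<noteq> L'"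
  shows "(\<Sum>p | p permutes A. young_class (boxes L) A p * young_class (boxes L') A p) = 0"
proof (rule ccontr)
  assume nz: "\<not> ?thesis"
  have "young_pairing (boxes L) (young_class (boxes L') (boxes L)) \<noteq> 0"
    using nz sum_young_class_young_class[OF A finite_boxes[OF L(1)], of "boxes L'"] by auto
  then have "dominated l L L'" by (rule young_pairing_young_class_dominated[OF L(1,2)])
  moreover have "young_pairing (boxes L') (young_class (boxes L) (boxes L')) \<noteq> 0"
    using nz sum_young_class_young_class[OF A finite_boxes[OF L(2)], of "boxes L"] by (auto simp: mult.commute)
  then have "dominated l L' L" by (rule young_pairing_young_class_dominated[OF L(2,1)])
  ultimately have "L = L'" using L(1,2) by (intro dominated_antisym) (auto simp: partition_rows_def)
  then show False using L(3) by simp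
qed

text \<open>\<open>\<sigma>\<close> keeps rows and \<open>\<tau>\<close> keeps columns, so
  \<open>\<tau> \<circ> \<sigma> = id\<close> forces both to be the identity: the symmetrizer has
  coefficient 1 at the identity.\<close>

lemma young_class_id:
  assumes A: "finite A" and M: "finite M"
  shows "young_class M A id = of_nat (card (bijs M A))"
proof -
  have "young_pairing M (\<lambda>q. of_bool (\<forall>x\<in>M. h (q x) = id (h x))) = 1" if h: "h \<in> bijs M A" for h
  proof -
    have hinj: "inj_on h M" using h by (auto simp: bijs_def bij_betw_def)
    have "of_int (sign \<tau>) * of_bool (\<forall>x\<in>M. h ((\<tau> \<circ> \<sigma>) x) = id (h x)) = (if \<tau> = id then if \<sigma> = id then 1 else 0 else (0::rat))"
      if s: "\<sigma> \<in> color_stab M fst" "\<tau> \<in> color_stab M snd" for \<sigma> \<tau>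
    proof (cases "\<forall>x\<in>M. h ((\<tau> \<circ> \<sigma>) x) = id (h x)")
      case True
      have sp: "\<sigma> permutes M" "\<tau> permutes M" using s by (auto simp: color_stab_def)
      have "\<sigma> x = x \<and> \<tau> x = x" if x: "x \<in> M" for x
      proof -
        have m: "\<sigma> x \<in> M" "\<tau> (\<sigma> x) \<in> M" using x sp by (simp_all add: permutes_in_image)
        then have e: "\<tau> (\<sigma> x) = x" using True x inj_on_eq_iff[OF hinj m(2) x] by simp
        have "fst (\<sigma> x) = fst x" using s x by (simp add: color_stab_def)
        moreover have "snd (\<tau> (\<sigma> x)) = snd (\<sigma> x)" using s m(1) by (simp add: color_stab_def)
        ultimately have "\<sigma> x = x" using e by (simp add: prod_eq_iff)
        then show ?thesis using e by simp
      qed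
      then have "\<sigma> x = x \<and> \<tau> x = x" for x using permutes_not_in[OF sp(1)] permutes_not_in[OF sp(2)] by (cases "x \<in> M") auto
      then have "\<sigma> = id" "\<tau> = id" by auto
      then show ?thesis by simp
    next
      case False
      then show ?thesis by auto
    qed
    then have "young_pairing M (\<lambda>q. of_bool (\<forall>x\<in>M. h (q x) = id (h x))) =
      (\<Sum>\<sigma>\<in>color_stab M fst. \<Sum>\<tau>\<in>color_stab M snd. if \<tau> = id then if \<sigma> = id then 1 else 0 else 0)"
      unfolding young_pairing_def by (intro sum.cong refl)
    also have "\<dots> = 1" using finite_color_stab[OF M, of fst] finite_color_stab[OF M, of snd]
      id_color_stab[of M fst] id_color_stab[of M snd] by (simp add: sum.delta)
    finally show ?thesis .
  qed
  then show ?thesis by (simp add: young_class_def)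
qed

text \<open>A numerical measure that grows strictly with dominance, for the induction in
  \<open>young_class_eq_frob\<close>.\<close>

lemma sum_dominated_less:
  assumes "dominated l K L" "K \<in> partition_rows l n" "L \<in> partition_rows l n'" "K \<noteq> L"
  shows "(\<Sum>j\<le>l. \<Sum>i<j. K i) < (\<Sum>j\<le>l. \<Sum>i<j. L i)"
proof (rule ccontr)
  assume n: "\<not> ?thesis"
  have le: "(\<Sum>i<j. K i) \<le> (\<Sum>i<j. L i)" if "j \<in> {..l}" for j using assms(1) that by (simp add: dominated_def)
  have "\<not> (\<exists>j\<in>{..l}. (\<Sum>i<j. K i) < (\<Sum>i<j. L i))"
  proof
    assume "\<exists>j\<in>{..l}. (\<Sum>i<j. K i) < (\<Sum>i<j. L i)"
    then have "(\<Sum>j\<le>l. \<Sum>i<j. K i) < (\<Sum>j\<le>l. \<Sum>i<j. L i)" using le by (intro sum_strict_mono_ex1) auto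
    then show False using n by simp
  qed
  then have "dominated l L K" unfolding dominated_def by (auto simp: not_less)
  then have "K = L" using assms by (intro dominated_antisym) (auto simp: partition_rows_def)
  then show False using assms by simp
qed

text \<open>Gram--Schmidt: both families are orthogonal, and by the induction hypothesis the expansion of the
  Young class function in the complete family \<open>frob\<close> has a single term.\<close>

theorem young_class_eq_frob:
  assumes L: "L \<in> partition_rows l n" and A: "finite A" "card A = n" "n \<le> l" and p: "p permutes A"
  shows "young_class (boxes L) A p = fact n / of_nat (skew_count n L (\<lambda>_. 0)) * frob l (shifted l L) A p"
  using L p
proof (induction "\<Sum>j\<le>l. \<Sum>i<j. L i" arbitrary: L p rule: less_induct)
  case (less L p)
  let ?F = "\<lambda>L. frob l (shifted l L) A" and ?Y = "\<lambda>L. young_class (boxes L) A"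
  let ?ip = "\<lambda>f g. \<Sum>p | p permutes A. f p * g p :: rat"
  have finP: "finite {p. p permutes A}" by (rule finite_permutations[OF A(1)])
  have Fid: "?F K id = of_nat (skew_count n K (\<lambda>_. 0))" "?F K id > 0" if "K \<in> partition_rows l n" for K
    using frob_id[OF A(1), of K l] skew_count_pos[OF that] that A(2) by simp_all
  have FF: "?ip (?F K) (?F K) > 0" if "K \<in> partition_rows l n" for K
    by (rule sum_pos2[OF finP, of id]) (use Fid[OF that] in auto)
  \<comment> \<open>The projection coefficient. Its value comes out at the end, from evaluation at
    the identity.\<close>
  define c where "c = ?ip (?Y L) (?F L) / ?ip (?F L) (?F L)"
  define \<psi> where "\<psi> p = ?Y L p - c * ?F L p" for p
  have ip\<psi>: "?ip \<psi> (?F N) = ?ip (?Y L) (?F N) - c * ?ip (?F L) (?F N)" for N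
    by (simp add: \<psi>_def left_diff_distrib sum_subtractf mult.assoc sum_distrib_left)
  have orth: "?ip \<psi> (?F N) = 0" if N: "N \<in> partition_rows l n" for N
  proof (cases "N = L")
    case True
    have "c * ?ip (?F L) (?F L) = ?ip (?Y L) (?F L)" using FF[OF less.prems(1)] unfolding c_def by simp
    then show ?thesis unfolding ip\<psi> True by simp
  next
    case False
    have "?ip (?F L) (?F N) = 0" using frob_orthogonal[OF A(1) less.prems(1) N] False by simp
    moreover have "?ip (?Y L) (?F N) = 0"
    proof (rule ccontr)
      \<comment> \<open>A nonzero pairing yields a coloring that is injective on columns, so
        \<open>N\<close> lies strictly below \<open>L\<close>. By induction \<open>?F N\<close> is
        then a multiple of \<open>?Y N\<close>, which is orthogonal to \<open>?Y L\<close>.\<close>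
      assume nz: "?ip (?Y L) (?F N) \<noteq> 0"
      then have "young_pairing (boxes L) (frob l (shifted l N) (boxes L)) \<noteq> 0"
        using sum_young_class_frob[OF A(1) finite_boxes[OF less.prems(1)]] by auto
      then obtain b where b: "vdm_coeff l (\<lambda>i. shifted l N i - int (color_count (boxes L) b i)) \<noteq> 0"
        "\<And>x y. x \<in> boxes L \<Longrightarrow> y \<in> boxes L \<Longrightarrow> x \<noteq> y \<Longrightarrow> snd x = snd y \<Longrightarrow> b x \<noteq> b y"
        by (rule young_pairing_frob_nonzero[OF finite_boxes[OF less.prems(1)]]) blast
      have "dominated l N (color_count (boxes L) b)" by (rule vdm_coeff_shifted_dominated[OF b(1)])
      moreover have "dominated l (color_count (boxes L) b) L" by (rule column_injective_dominated[OF less.prems(1) b(2)])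
      ultimately have "dominated l N L" unfolding dominated_def by (meson order_trans)
      then have lt: "(\<Sum>j\<le>l. \<Sum>i<j. N i) < (\<Sum>j\<le>l. \<Sum>i<j. L i)"
        by (rule sum_dominated_less[OF _ N less.prems(1) False])
      have "?Y N p = fact n / ?F N id * ?F N p" if "p permutes A" for p
        using less.hyps[OF lt N that] Fid(1)[OF N] by simp
      then have FY: "?F N p = ?F N id / fact n * ?Y N p" if "p permutes A" for p
        using that Fid(2)[OF N] by simp
      have "?ip (?Y L) (?F N) = ?F N id / fact n * ?ip (?Y L) (?Y N)"
        unfolding sum_distrib_left
      proof (rule sum.cong[OF refl])
        fix q assume "q \<in> {p. p permutes A}"
        then have "?F N q = ?F N id / fact n * ?Y N q" by (intro FY) simp
        then show "?Y L q * ?F N q = ?F N id / fact n * (?Y L q * ?Y N q)" by (simp only: mult.left_commute)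
      qed
      also have "\<dots> = 0" using young_class_orthogonal[OF A(1) less.prems(1) N] False by simp
      finally show False using nz by simp
    qed
    ultimately show ?thesis unfolding ip\<psi> by simp
  qed
  have cf: "class_function A \<psi>"
    using young_class_class_function[of A "boxes L"] frob_class_function[of A l "shifted l L"]
    unfolding class_function_def \<psi>_def by simp
  have zero: "\<psi> q = 0" if "q permutes A" for q
    by (rule frob_complete[OF A(1) _ cf _ that, of l]) (use A orth in auto)
  have "?Y L id = fact n"
    using young_class_id[OF A(1) finite_boxes[OF less.prems(1)]]
      card_bijs[OF A(1) finite_boxes[OF less.prems(1)]] card_boxes[OF less.prems(1)] A(2) by simp
  then have "c * ?F L id = fact n" using zero[OF permutes_id] by (simp add: \<psi>_def)
  then have "c = fact n / ?F L id" using Fid(2)[OF less.prems(1)] by (simp add: field_simps)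
  then show ?case using zero[OF less.prems(2)] Fid(1)[OF less.prems(1)] by (simp add: \<psi>_def)
qed

subsection \<open>A positive formula for normalized skew tableau counts\<close>

lemma ff_of_nat: "ff (of_nat n) k = of_nat (fact k * (n choose k))"
proof -
  have "of_nat (n choose k) = (\<Prod>i<k. of_nat n - of_nat i) / (fact k :: rat)"
    using gbinomial_prod_rev[of "of_nat n :: rat" k] by (simp add: binomial_gbinomial atLeast0LessThan)
  then show ?thesis by (simp add: ff_def)
qed

lemma partition_rows_mono:
  assumes "L \<in> partition_rows l n" "l \<le> l'"
  shows "L \<in> partition_rows l' n"
proof -
  have "(\<Sum>i<l'. L i) = (\<Sum>i<l. L i)"
    by (rule sum.mono_neutral_right) (use assms in \<open>auto simp: partition_rows_def\<close>)
  then show ?thesis using assms by (auto simp: partition_rows_def)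
qed

lemma permutes_subset_iff:
  assumes "p permutes B" "M \<subseteq> B"
  shows "p permutes M \<longleftrightarrow> (\<forall>x\<in>B - M. p x = x)"
  using permutes_superset[OF assms(1)] permutes_not_in by fastforce

text \<open>If the product of a row element and a column element of \<open>B\<close> fixes a box,
  then both factors fix it, because one keeps its row and the other its column. So a product that
  permutes \<open>M\<close> comes from the groups of \<open>M\<close>.\<close>

lemma young_pairing_subset:
  assumes B: "finite B" and M: "M \<subseteq> B"
  shows "young_pairing M f = young_pairing B (\<lambda>q. of_bool (q permutes M) * f q)"
proof -
  let ?s = "\<lambda>p. of_int (sign p) :: rat"
  have sub: "color_stab M c \<subseteq> color_stab B c" for c :: "'a \<times> 'b \<Rightarrow> 'c"
  proof
    fix p assume p: "p \<in> color_stab M c"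
    then have pM: "p permutes M" by (simp add: color_stab_def)
    have "c (p x) = c x" for x using p permutes_not_in[OF pM] by (cases "x \<in> M") (auto simp: color_stab_def)
    then show "p \<in> color_stab B c" using permutes_subset[OF pM M] by (simp add: color_stab_def)
  qed
  have stabs: "\<sigma> \<in> color_stab M fst \<and> \<tau> \<in> color_stab M snd"
    if s: "\<sigma> \<in> color_stab B fst" "\<tau> \<in> color_stab B snd" and q: "\<tau> \<circ> \<sigma> permutes M" for \<sigma> \<tau>
  proof -
    have sp: "\<sigma> permutes B" "\<tau> permutes B" using s by (auto simp: color_stab_def)
    have "\<sigma> x = x \<and> \<tau> x = x" if x: "x \<in> B - M" for x
    proof -
      have e: "\<tau> (\<sigma> x) = x" using permutes_not_in[OF q, of x] x by simp
      have "\<sigma> x \<in> B" using x permutes_in_image[OF sp(1)] by blast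
      then have "snd (\<tau> (\<sigma> x)) = snd (\<sigma> x)" using s(2) by (simp add: color_stab_def)
      moreover have "fst (\<sigma> x) = fst x" using s(1) x by (simp add: color_stab_def)
      ultimately have "\<sigma> x = x" using e by (simp add: prod_eq_iff)
      then show ?thesis using e by simp
    qed
    then have "\<sigma> permutes M" "\<tau> permutes M"
      using permutes_subset_iff[OF sp(1) M] permutes_subset_iff[OF sp(2) M] by auto
    then show ?thesis using s M by (auto simp: color_stab_def)
  qed
  have "young_pairing M f = (\<Sum>(\<sigma>,\<tau>)\<in>color_stab M fst \<times> color_stab M snd. ?s \<tau> * f (\<tau> \<circ> \<sigma>))"
    by (simp add: young_pairing_def sum.cartesian_product)
  also have "\<dots> = (\<Sum>(\<sigma>,\<tau>)\<in>color_stab B fst \<times> color_stab B snd. ?s \<tau> * (of_bool (\<tau> \<circ> \<sigma> permutes M) * f (\<tau> \<circ> \<sigma>)))"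
  proof (rule sum.mono_neutral_cong_left)
    show "finite (color_stab B fst \<times> color_stab B snd)" by (intro finite_cartesian_product finite_color_stab B)
    show "color_stab M fst \<times> color_stab M snd \<subseteq> color_stab B fst \<times> color_stab B snd" by (intro Sigma_mono sub)
    show "\<forall>st\<in>color_stab B fst \<times> color_stab B snd - color_stab M fst \<times> color_stab M snd.
      (case st of (\<sigma>, \<tau>) \<Rightarrow> ?s \<tau> * (of_bool (\<tau> \<circ> \<sigma> permutes M) * f (\<tau> \<circ> \<sigma>))) = 0"
    proof
      fix st assume st: "st \<in> color_stab B fst \<times> color_stab B snd - color_stab M fst \<times> color_stab M snd"
      obtain \<sigma> \<tau> where e: "st = (\<sigma>, \<tau>)" by (cases st)
      have "\<not> \<tau> \<circ> \<sigma> permutes M" using st stabs[of \<sigma> \<tau>] by (auto simp: e)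
      then show "(case st of (\<sigma>, \<tau>) \<Rightarrow> ?s \<tau> * (of_bool (\<tau> \<circ> \<sigma> permutes M) * f (\<tau> \<circ> \<sigma>))) = 0" by (simp add: e)
    qed
    fix st assume st: "st \<in> color_stab M fst \<times> color_stab M snd"
    obtain \<sigma> \<tau> where e: "st = (\<sigma>, \<tau>)" by (cases st)
    have "\<tau> \<circ> \<sigma> permutes M" using st by (auto simp: e color_stab_def intro: permutes_compose)
    then show "(case st of (\<sigma>, \<tau>) \<Rightarrow> ?s \<tau> * f (\<tau> \<circ> \<sigma>)) = (case st of (\<sigma>, \<tau>) \<Rightarrow> ?s \<tau> * (of_bool (\<tau> \<circ> \<sigma> permutes M) * f (\<tau> \<circ> \<sigma>)))"
      by (simp add: e)
  qed
  also have "\<dots> = young_pairing B (\<lambda>q. of_bool (q permutes M) * f q)"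
    by (simp add: young_pairing_def sum.cartesian_product)
  finally show ?thesis .
qed

text \<open>The pairing of the character of \<open>L\<close> with one function \<open>Q\<close> is
  evaluated twice: the symmetrizer of \<open>L\<close> gives the sum on the left, while branching
  and orthogonality leave only the multiplicity of \<open>K\<close>.\<close>

lemma sum_young_pairing_frob_subsets:
  assumes L: "L \<in> partition_rows l n" and K: "K \<in> partition_rows l k" and kn: "k \<le> n" "n \<le> l"
  shows "(\<Sum>M | M \<subseteq> boxes L \<and> card M = k. young_pairing M (frob l (shifted l K) M)) =
    of_nat (skew_count (n - k) L K) / of_nat (skew_count n L (\<lambda>_. 0)) *
    (\<Sum>M | M \<subseteq> boxes L \<and> card M = k. \<Sum>p | p permutes M. frob l (shifted l K) M p * frob l (shifted l K) M p)"
proof -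
  let ?B = "boxes L"
  let ?S = "{M. M \<subseteq> ?B \<and> card M = k}"
  let ?F = "\<lambda>M. frob l (shifted l K) M"
  let ?f = "of_nat (skew_count n L (\<lambda>_. 0)) :: rat"
  have B: "finite ?B" "card ?B = n" using finite_boxes[OF L] card_boxes[OF L] .
  have finS: "finite ?S" using B(1) by simp
  \<comment> \<open>Times \<open>fact (n - k)\<close> this is the character induced from that of
    \<open>K\<close> on a symmetric group of degree \<open>k\<close>.\<close>
  define Q where "Q p = (\<Sum>M\<in>?S. of_bool (p permutes M) * ?F M p)" for p
  have "Q p = Q q" if h: "h \<in> bijs ?B ?B" and q: "q permutes ?B" and p: "p permutes ?B"
    and e: "\<forall>x\<in>?B. h (q x) = p (h x)" for h q p
  proof -
    have hb: "bij_betw h ?B ?B" using h by (simp add: bijs_def)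
    have hi: "inj_on h ?B" by (rule bij_betw_imp_inj_on[OF hb])
    have hs: "h ` ?B = ?B" by (rule bij_betw_imp_surj_on[OF hb])
    have term': "of_bool (p permutes (h ` M)) * ?F (h ` M) p = of_bool (q permutes M) * ?F M q" if M: "M \<in> ?S" for M
    proof -
      have sub: "M \<subseteq> ?B" "h ` M \<subseteq> ?B" using M hs by auto
      have d: "?B - h ` M = h ` (?B - M)" using hs hi sub by (simp add: inj_on_image_set_diff)
      have "p permutes (h ` M) \<longleftrightarrow> (\<forall>x\<in>?B - M. p (h x) = h x)"
        unfolding permutes_subset_iff[OF p sub(2)] d by simp
      also have "\<dots> \<longleftrightarrow> (\<forall>x\<in>?B - M. h (q x) = h x)" using e by simp
      also have "\<dots> \<longleftrightarrow> (\<forall>x\<in>?B - M. q x = x)"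
        using hi permutes_in_image[OF q] by (auto simp: inj_on_eq_iff)
      also have "\<dots> \<longleftrightarrow> q permutes M" using permutes_subset_iff[OF q sub(1)] by simp
      finally have iff: "p permutes (h ` M) \<longleftrightarrow> q permutes M" .
      have "?F M q = ?F (h ` M) p" if qM: "q permutes M"
      proof (rule frob_transport[of h])
        show "bij_betw h M (h ` M)" using inj_on_subset[OF hi sub(1)] by (simp add: bij_betw_def)
      qed (use e sub permutes_in_image[OF qM] in auto)
      then show ?thesis using iff by auto
    qed
    have "Q p = (\<Sum>M\<in>(\<lambda>M. h ` M) ` ?S. of_bool (p permutes M) * ?F M p)"
    proof -
      have "(\<lambda>M. h ` M) ` ?S = ?S"
      proof
        show sub: "(\<lambda>M. h ` M) ` ?S \<subseteq> ?S"
          using hs hi by (auto simp: card_image inj_on_subset)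
        have "inj_on (\<lambda>M. h ` M) ?S" by (rule inj_on_subset[OF inj_on_image_Pow[OF hi]]) auto
        then show "?S \<subseteq> (\<lambda>M. h ` M) ` ?S" using endo_inj_surj[OF finS sub] by simp
      qed
      then show ?thesis by (simp add: Q_def)
    qed
    also have "\<dots> = (\<Sum>M\<in>?S. of_bool (p permutes (h ` M)) * ?F (h ` M) p)"
      by (subst sum.reindex) (auto intro: inj_on_subset[OF inj_on_image_Pow[OF hi]])
    also have "\<dots> = Q q" unfolding Q_def by (rule sum.cong[OF refl term'])
    finally show ?thesis .
  qed
  then have "(\<Sum>p | p permutes ?B. young_class ?B ?B p * Q p) = of_nat (card (bijs ?B ?B)) * young_pairing ?B Q"
    by (rule sum_young_class[OF B(1) B(1)])
  then have 1: "(\<Sum>p | p permutes ?B. young_class ?B ?B p * Q p) = fact n * young_pairing ?B Q"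
    by (simp add: card_bijs B)
  have "(\<Sum>p | p permutes ?B. young_class ?B ?B p * Q p) = (\<Sum>p | p permutes ?B. fact n / ?f * (frob l (shifted l L) ?B p * Q p))"
    by (rule sum.cong[OF refl]) (simp add: young_class_eq_frob[OF L B kn(2)])
  then have "fact n * young_pairing ?B Q = fact n / ?f * (\<Sum>p | p permutes ?B. frob l (shifted l L) ?B p * Q p)"
    by (simp add: 1 sum_distrib_left)
  also have "\<dots> = fact n * (1 / ?f * (\<Sum>p | p permutes ?B. frob l (shifted l L) ?B p * Q p))" by simp
  finally have 2: "young_pairing ?B Q = 1 / ?f * (\<Sum>p | p permutes ?B. frob l (shifted l L) ?B p * Q p)"
    unfolding mult_left_cancel[OF fact_nonzero] .
  have ip: "(\<Sum>p | p permutes ?B. frob l (shifted l L) ?B p * (of_bool (p permutes M) * ?F M p)) =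
      of_nat (skew_count (n - k) L K) * (\<Sum>p | p permutes M. ?F M p * ?F M p)" if M: "M \<in> ?S" for M
  proof -
    have sub: "M \<subseteq> ?B" and finM: "finite M" using M B(1) finite_subset by auto
    have cM: "card (?B - M) = n - k" using M B card_Diff_subset[OF finM sub] by simp
    have Lnk: "L \<in> partition_rows l (n - k + k)" using L kn by simp
    have "(\<Sum>p | p permutes ?B. frob l (shifted l L) ?B p * (of_bool (p permutes M) * ?F M p)) =
      (\<Sum>p | p permutes M. frob l (shifted l L) ?B p * ?F M p)"
      by (rule sum.mono_neutral_cong_right)
        (use finite_permutations[OF B(1)] permutes_subset[OF _ sub] in auto)
    also have "\<dots> = (\<Sum>p | p permutes M. \<Sum>N\<in>partition_rows l k.
        of_nat (skew_count (n - k) L N) * (frob l (shifted l N) M p * ?F M p))"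
      by (rule sum.cong[OF refl]) (simp add: frob_branching[OF B(1) sub cM _ Lnk] sum_distrib_right mult.assoc)
    also have "\<dots> = (\<Sum>N\<in>partition_rows l k. of_nat (skew_count (n - k) L N) * (\<Sum>p | p permutes M. frob l (shifted l N) M p * ?F M p))"
      by (subst sum.swap) (simp add: sum_distrib_left)
    also have "\<dots> = (\<Sum>N\<in>partition_rows l k. if N = K then of_nat (skew_count (n - k) L K) * (\<Sum>p | p permutes M. ?F M p * ?F M p) else 0)"
      by (rule sum.cong[OF refl]) (use frob_orthogonal[OF finM _ K] in auto)
    also have "\<dots> = of_nat (skew_count (n - k) L K) * (\<Sum>p | p permutes M. ?F M p * ?F M p)"
      using K by (simp add: finite_partition_rows)
    finally show ?thesis .
  qed
  have "(\<Sum>M\<in>?S. young_pairing M (?F M)) = (\<Sum>M\<in>?S. young_pairing ?B (\<lambda>q. of_bool (q permutes M) * ?F M q))"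
    by (rule sum.cong[OF refl], rule young_pairing_subset[OF B(1)]) simp
  also have "\<dots> = young_pairing ?B Q" unfolding Q_def young_pairing_sum ..
  also have "\<dots> = 1 / ?f * (\<Sum>M\<in>?S. \<Sum>p | p permutes ?B. frob l (shifted l L) ?B p * (of_bool (p permutes M) * ?F M p))"
    unfolding 2 Q_def sum_distrib_left by (subst sum.swap) (rule refl)
  also have "\<dots> = 1 / ?f * (\<Sum>M\<in>?S. of_nat (skew_count (n - k) L K) * (\<Sum>p | p permutes M. ?F M p * ?F M p))"
    by (simp only: sum.cong[OF refl ip])
  finally show ?thesis by (simp add: sum_distrib_left mult.assoc)
qed

definition normalized_skew_count :: "nat \<Rightarrow> nat \<Rightarrow> (nat \<Rightarrow> nat) \<Rightarrow> (nat \<Rightarrow> nat) \<Rightarrow> rat" where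
  "normalized_skew_count n k L K = (if k \<le> n
     then ff (of_nat n) k * of_nat (skew_count (n - k) L K) / of_nat (skew_count n L (\<lambda>_. 0)) else 0)"

theorem normalized_skew_count_eq_sum:
  assumes K: "K \<in> partition_rows l0 k"
  obtains C :: rat where "0 \<le> C"
    "\<And>L l n. L \<in> partition_rows l n \<Longrightarrow> normalized_skew_count n k L K =
       C * (\<Sum>M | M \<subseteq> boxes L \<and> card M = k. young_pairing M (young_class (boxes K) M))"
proof -
  let ?D = "boxes K"
  let ?g = "of_nat (skew_count k K (\<lambda>_. 0)) :: rat"
  let ?Y = "\<lambda>M. young_class ?D M"
  define T0 where "T0 = young_pairing ?D (young_class ?D ?D)"
  have D: "finite ?D" "card ?D = k" using finite_boxes[OF K] card_boxes[OF K] .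
  have g: "?g > 0" using skew_count_pos[OF K] by simp
  have YY: "(\<Sum>p | p permutes M. ?Y M p * ?Y M p) = fact k * T0" if "finite M" "card M = k" for M :: "(nat \<times> nat) set"
    using sum_young_class_young_class[OF that(1) D(1), of ?D] card_bijs[OF that(1) D(1)] that D by (simp add: T0_def)
  \<comment> \<open>The identity contributes the square of \<open>fact k\<close>, which makes the
    squared norm, and with it \<open>T0\<close>, strictly positive.\<close>
  have "(\<Sum>p | p permutes ?D. ?Y ?D p * ?Y ?D p) > 0"
    by (rule sum_pos2[of _ id]) (auto simp: finite_permutations D permutes_id young_class_id card_bijs)
  then have T0: "T0 > 0" using YY[OF D] by (simp add: zero_less_mult_iff)
  \<comment> \<open>The character of \<open>K\<close> is \<open>?g / fact k\<close> times
    \<open>?Y\<close>, and the squared norm of \<open>?Y\<close> is \<open>fact k * T0\<close>.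
    Hence the pairings with \<open>?Y\<close> add up to \<open>(n choose k) * ?g * T0\<close> times
    the quotient of the tableau counts, and \<open>C\<close> turns \<open>n choose k\<close> into
    the falling factorial.\<close>
  define C where "C = fact k / (?g * T0)"
  show ?thesis
  proof (rule that[of C])
    show "0 \<le> C" using g T0 by (simp add: C_def)
    fix L l n assume L: "L \<in> partition_rows l n"
    let ?S = "{M. M \<subseteq> boxes L \<and> card M = k}"
    let ?f = "of_nat (skew_count n L (\<lambda>_. 0)) :: rat"
    have B: "finite (boxes L)" "card (boxes L) = n" using finite_boxes[OF L] card_boxes[OF L] .
    show "normalized_skew_count n k L K = C * (\<Sum>M\<in>?S. young_pairing M (?Y M))"
    proof (cases "k \<le> n")
      case False
      then have S: "?S = {}" using B card_mono[OF B(1)] by auto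
      show ?thesis unfolding S using False by (simp add: normalized_skew_count_def)
    next
      case True
      \<comment> \<open>Enough variables for the identification of \<open>young_class\<close> with
        \<open>frob\<close>; \<open>C\<close> does not depend on this choice.\<close>
      define l' where "l' = max (max l l0) n"
      have L': "L \<in> partition_rows l' n" by (rule partition_rows_mono[OF L]) (simp add: l'_def)
      have K': "K \<in> partition_rows l' k" by (rule partition_rows_mono[OF K]) (simp add: l'_def)
      have nl: "n \<le> l'" by (simp add: l'_def)
      let ?F = "\<lambda>M. frob l' (shifted l' K) M"
      have FY: "?F M p = ?g / fact k * ?Y M p" if M: "finite M" "card M = k" "p permutes M" for M :: "(nat \<times> nat) set" and p
        using young_class_eq_frob[OF K' M(1,2) _ M(3)] True nl g by simp
      have finM: "finite M" "card M = k" if "M \<in> ?S" for M using that B(1) finite_subset by auto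
      have 1: "(\<Sum>M\<in>?S. young_pairing M (?F M)) = ?g / fact k * (\<Sum>M\<in>?S. young_pairing M (?Y M))"
        unfolding sum_distrib_left
      proof (rule sum.cong[OF refl])
        fix M assume M: "M \<in> ?S"
        have "young_pairing M (?F M) = young_pairing M (\<lambda>p. ?g / fact k * ?Y M p)"
          by (rule young_pairing_cong) (rule FY[OF finM[OF M]])
        then show "young_pairing M (?F M) = ?g / fact k * young_pairing M (?Y M)" by (simp only: young_pairing_scale)
      qed
      have 2: "(\<Sum>M\<in>?S. \<Sum>p | p permutes M. ?F M p * ?F M p) = of_nat (n choose k) * ((?g / fact k)\<^sup>2 * (fact k * T0))"
      proof -
        have "(\<Sum>p | p permutes M. ?F M p * ?F M p) = (?g / fact k)\<^sup>2 * (fact k * T0)" if M: "M \<in> ?S" for M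
        proof -
          have "(\<Sum>p | p permutes M. ?F M p * ?F M p) = (\<Sum>p | p permutes M. (?g / fact k)\<^sup>2 * (?Y M p * ?Y M p))"
            by (rule sum.cong[OF refl]) (simp add: FY[OF finM[OF M]] power2_eq_square)
          then show ?thesis unfolding sum_distrib_left[symmetric] YY[OF finM[OF M]] .
        qed
        then have "(\<Sum>M\<in>?S. \<Sum>p | p permutes M. ?F M p * ?F M p) = of_nat (card ?S) * ((?g / fact k)\<^sup>2 * (fact k * T0))"
          by simp
        then show ?thesis using n_subsets[OF B(1), of k] B(2) by simp
      qed
      have gk: "?g / fact k \<noteq> 0" using g by simp
      have "?g / fact k * (\<Sum>M\<in>?S. young_pairing M (?Y M)) = of_nat (skew_count (n - k) L K) / ?f *
          (of_nat (n choose k) * ((?g / fact k)\<^sup>2 * (fact k * T0)))"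
        using sum_young_pairing_frob_subsets[OF L' K' True nl] unfolding 1 2 .
      also have "\<dots> = ?g / fact k * (of_nat (skew_count (n - k) L K) / ?f * (of_nat (n choose k) * (?g * T0)))"
        by (simp add: power2_eq_square mult_ac)
      finally have "(\<Sum>M\<in>?S. young_pairing M (?Y M)) = of_nat (skew_count (n - k) L K) / ?f * (of_nat (n choose k) * (?g * T0))"
        unfolding mult_left_cancel[OF gk] .
      then show ?thesis using True g T0 by (simp add: normalized_skew_count_def C_def ff_of_nat)
    qed
  qed
qed

subsection \<open>Determinants of falling factorials\<close>

definition list_rows :: "nat list \<Rightarrow> nat \<Rightarrow> nat" where
  "list_rows xs i = (if i < length xs then xs ! i else 0)"

lemma list_rows_partition_rows:
  assumes "is_partition xs" "length xs \<le> l"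
  shows "list_rows xs \<in> partition_rows l (sum_list xs)"
proof -
  have "(\<Sum>i<l. list_rows xs i) = (\<Sum>i<length xs. list_rows xs i)"
    by (rule sum.mono_neutral_right) (use assms in \<open>auto simp: list_rows_def\<close>)
  also have "\<dots> = sum_list xs" by (simp add: list_rows_def sum_list_sum_nth atLeast0LessThan)
  finally show ?thesis using assms by (auto simp: partition_rows_def list_rows_def is_partition_def)
qed

text \<open>The extension of \<open>1 / (x - y)!\<close> by 0 makes a falling factorial equal to
  \<open>x!\<close> times it, so that the \<open>x!\<close> leave the determinant as row
  factors.\<close>

definition recip_fact :: "nat \<Rightarrow> nat \<Rightarrow> rat" where
  "recip_fact x y = (if y \<le> x then 1 / fact (x - y) else 0)"

text \<open>The Leibniz sum of the determinant with entries \<open>1 / (a i - b j)!\<close>. For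
  partitions shifted by the staircase it is Aitken's determinant for skew standard tableaux.\<close>

definition recip_fact_det :: "nat \<Rightarrow> (nat \<Rightarrow> nat) \<Rightarrow> (nat \<Rightarrow> nat) \<Rightarrow> rat" where
  "recip_fact_det l a b = (\<Sum>w | w permutes {..<l}. of_int (sign w) * (\<Prod>i<l. recip_fact (a i) (b (w i))))"

lemma ff_recip_fact: "ff (of_nat x) y = fact x * recip_fact x y"
  by (cases "y \<le> x") (simp_all add: ff_of_nat recip_fact_def binomial_fact binomial_eq_0)

lemma det_ff:
  "det (mat l l (\<lambda>(i,j). ff (of_nat (a i)) (b j))) = (\<Prod>i<l. fact (a i)) * recip_fact_det l a b"
proof -
  have "det (mat l l (\<lambda>(i,j). ff (of_nat (a i)) (b j))) =
    (\<Sum>w | w permutes {..<l}. of_int (sign w) * (\<Prod>i<l. mat l l (\<lambda>(i,j). ff (of_nat (a i)) (b j)) $$ (i, w i)))"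
    by (subst det_def'[of _ l]) (auto simp: atLeast0LessThan)
  also have "\<dots> = (\<Sum>w | w permutes {..<l}. (\<Prod>i<l. fact (a i)) * (of_int (sign w) * (\<Prod>i<l. recip_fact (a i) (b (w i)))))"
  proof (rule sum.cong[OF refl])
    fix w assume w: "w \<in> {w. w permutes {..<l}}"
    have wl: "w i < l" if "i < l" for i using w that permutes_in_image[of w "{..<l}" i] by auto
    have "(\<Prod>i<l. mat l l (\<lambda>(i,j). ff (of_nat (a i)) (b j)) $$ (i, w i)) = (\<Prod>i<l. fact (a i) * recip_fact (a i) (b (w i)))"
      by (rule prod.cong[OF refl]) (simp add: wl ff_recip_fact)
    then show "of_int (sign w) * (\<Prod>i<l. mat l l (\<lambda>(i,j). ff (of_nat (a i)) (b j)) $$ (i, w i)) =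
      (\<Prod>i<l. fact (a i)) * (of_int (sign w) * (\<Prod>i<l. recip_fact (a i) (b (w i))))"
      by (simp add: prod.distrib)
  qed
  finally show ?thesis by (simp add: recip_fact_det_def sum_distrib_left)
qed

lemma recip_fact_det_cong:
  "(\<And>i. i < l \<Longrightarrow> a i = a' i) \<Longrightarrow> recip_fact_det l a b = recip_fact_det l a' b"
  unfolding recip_fact_det_def by (intro sum.cong refl arg_cong2[where f = "(*)"] prod.cong) auto

lemma recip_fact_det_repeated:
  assumes ij: "i < l" "j < l" "i \<noteq> j" "a i = a j"
  shows "recip_fact_det l a b = 0"
proof -
  let ?t = "transpose i j"
  let ?f = "\<lambda>w. of_int (sign w) * (\<Prod>i<l. recip_fact (a i) (b (w i)))"
  have t: "?t permutes {..<l}" using ij by (intro permutes_swap_id) auto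
  have at: "a (?t x) = a x" for x using ij(4) by (simp add: transpose_def)
  have "?f (w \<circ> ?t) = - ?f w" if w: "w permutes {..<l}" for w
  proof -
    have "permutation w" by (rule permutes_imp_permutation[OF _ w]) simp
    then have sg: "sign (w \<circ> ?t) = - sign w" using ij(3) by (simp add: sign_compose permutation_swap_id sign_swap_id)
    have "(\<Prod>x<l. recip_fact (a x) (b (w (?t x)))) = (\<Prod>x<l. recip_fact (a x) (b (w x)))"
      using prod.permute[OF t, of "\<lambda>x. recip_fact (a x) (b (w x))"] by (simp add: o_def at)
    then show ?thesis by (simp add: sg)
  qed
  then have "(\<Sum>w | w permutes {..<l}. ?f (w \<circ> ?t)) = - recip_fact_det l a b"
    unfolding recip_fact_det_def sum_negf[symmetric] by (intro sum.cong) auto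
  then show ?thesis using sum_permutations_compose_right[OF t, of ?f] by (simp add: recip_fact_det_def)
qed

lemma recip_fact_step:
  "(of_nat x - of_nat y) * recip_fact x y = (if x = 0 then 0 else recip_fact (x - 1) y)"
proof (cases "y < x")
  case True
  then obtain d where d: "x = y + Suc d" using less_imp_add_positive[OF True] by (metis Suc_pred)
  have "(of_nat x - of_nat y) * recip_fact x y = of_nat (Suc d) * (1 / fact (Suc d))"
    by (simp add: d recip_fact_def)
  also have "\<dots> = 1 / fact d" unfolding fact_Suc by (simp del: of_nat_Suc)
  finally show ?thesis by (simp add: d recip_fact_def)
qed (auto simp: recip_fact_def)

text \<open>Each term of the Leibniz sum is multiplied by the same number, the sum of all
  \<open>a i - b (w i)\<close>. Each of these differences cancels against its factorial and lowers
  one \<open>a i\<close>, as in \<open>m / m! = 1 / (m - 1)!\<close>.\<close>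

lemma recip_fact_det_step:
  "(of_nat (\<Sum>i<l. a i) - of_nat (\<Sum>i<l. b i)) * recip_fact_det l a b =
    (\<Sum>i<l. if a i = 0 then 0 else recip_fact_det l (a(i := a i - 1)) b)"
proof -
  let ?P = "\<lambda>a w. \<Prod>i<l. recip_fact (a i) (b (w i))"
  have key: "(of_nat (\<Sum>i<l. a i) - of_nat (\<Sum>i<l. b i)) * ?P a w = (\<Sum>i<l. if a i = 0 then 0 else ?P (a(i := a i - 1)) w)"
    if w: "w permutes {..<l}" for w
  proof -
    have "(\<Sum>i<l. b i) = (\<Sum>i<l. b (w i))" using sum.permute[OF w, of b] by (simp add: o_def)
    then have "(of_nat (\<Sum>i<l. a i) - of_nat (\<Sum>i<l. b i)) * ?P a w = (\<Sum>i<l. (of_nat (a i) - of_nat (b (w i))) * ?P a w)"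
      by (simp add: sum_subtractf sum_distrib_right[symmetric])
    also have "\<dots> = (\<Sum>i<l. if a i = 0 then 0 else ?P (a(i := a i - 1)) w)"
    proof (rule sum.cong[OF refl])
      fix i assume i: "i \<in> {..<l}"
      have 1: "?P a w = recip_fact (a i) (b (w i)) * (\<Prod>j\<in>{..<l}-{i}. recip_fact (a j) (b (w j)))"
        using i by (intro prod.remove) auto
      have "?P (a(i := a i - 1)) w = recip_fact (a i - 1) (b (w i)) * (\<Prod>j\<in>{..<l}-{i}. recip_fact ((a(i := a i - 1)) j) (b (w j)))"
        using i by (subst prod.remove[of _ i]) auto
      also have "(\<Prod>j\<in>{..<l}-{i}. recip_fact ((a(i := a i - 1)) j) (b (w j))) = (\<Prod>j\<in>{..<l}-{i}. recip_fact (a j) (b (w j)))"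
        by (rule prod.cong) auto
      finally show "(of_nat (a i) - of_nat (b (w i))) * ?P a w = (if a i = 0 then 0 else ?P (a(i := a i - 1)) w)"
        unfolding 1 mult.assoc[symmetric] recip_fact_step by simp
    qed
    finally show ?thesis .
  qed
  have "(of_nat (\<Sum>i<l. a i) - of_nat (\<Sum>i<l. b i)) * recip_fact_det l a b =
    (\<Sum>w | w permutes {..<l}. \<Sum>i<l. if a i = 0 then 0 else of_int (sign w) * ?P (a(i := a i - 1)) w)"
    unfolding recip_fact_det_def sum_distrib_left
  proof (rule sum.cong[OF refl])
    fix w assume "w \<in> {w. w permutes {..<l}}"
    then have k: "(of_nat (\<Sum>i<l. a i) - of_nat (\<Sum>i<l. b i)) * ?P a w = (\<Sum>i<l. if a i = 0 then 0 else ?P (a(i := a i - 1)) w)"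
      using key by blast
    show "(of_nat (\<Sum>i<l. a i) - of_nat (\<Sum>i<l. b i)) * (of_int (sign w) * ?P a w) =
        (\<Sum>i<l. if a i = 0 then 0 else of_int (sign w) * ?P (a(i := a i - 1)) w)"
      unfolding mult.left_commute[of _ "of_int (sign w)"] k sum_distrib_left by (intro sum.cong) auto
  qed
  also have "\<dots> = (\<Sum>i<l. \<Sum>w | w permutes {..<l}. if a i = 0 then 0 else of_int (sign w) * ?P (a(i := a i - 1)) w)"
    by (rule sum.swap)
  also have "\<dots> = (\<Sum>i<l. if a i = 0 then 0 else recip_fact_det l (a(i := a i - 1)) b)"
    unfolding recip_fact_det_def by (intro sum.cong refl) auto
  finally show ?thesis .
qed

lemma recip_fact_det_nonzeroD:
  assumes "recip_fact_det l a b \<noteq> 0"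
  obtains w where "w permutes {..<l}" "\<And>i. i < l \<Longrightarrow> b (w i) \<le> a i"
proof -
  obtain w where w: "w \<in> {w. w permutes {..<l}}" "of_int (sign w) * (\<Prod>i<l. recip_fact (a i) (b (w i))) \<noteq> 0"
    using assms unfolding recip_fact_det_def by (meson sum.neutral)
  have "b (w i) \<le> a i" if i: "i < l" for i
  proof (rule ccontr)
    assume "\<not> b (w i) \<le> a i"
    then have "recip_fact (a i) (b (w i)) = 0" by (simp add: recip_fact_def)
    then have "(\<Prod>i<l. recip_fact (a i) (b (w i))) = 0" using i by (intro prod_zero) auto
    then show False using w by simp
  qed
  then show ?thesis using w that by blast
qed

lemma recip_fact_det_zero:
  assumes "(\<Sum>i<l. a i) < (\<Sum>i<l. b i)"
  shows "recip_fact_det l a b = 0"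
proof (rule ccontr)
  assume "recip_fact_det l a b \<noteq> 0"
  then obtain w where w: "w permutes {..<l}" "\<And>i. i < l \<Longrightarrow> b (w i) \<le> a i" by (rule recip_fact_det_nonzeroD) blast
  have "(\<Sum>i<l. b i) = (\<Sum>i<l. b (w i))" using sum.permute[OF w(1), of b] by (simp add: o_def)
  also have "\<dots> \<le> (\<Sum>i<l. a i)" using w(2) by (intro sum_mono) auto
  finally show False using assms by simp
qed

definition staircase_add :: "nat \<Rightarrow> (nat \<Rightarrow> nat) \<Rightarrow> nat \<Rightarrow> nat" where
  "staircase_add l L i = L i + l - Suc i"

lemma sum_staircase_add:
  assumes "L \<in> partition_rows l n"
  shows "(\<Sum>i<l. staircase_add l L i) = n + (\<Sum>i<l. l - Suc i)"
proof -
  have "(\<Sum>i<l. staircase_add l L i) = (\<Sum>i<l. L i + (l - Suc i))"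
    by (intro sum.cong) (auto simp: staircase_add_def)
  also have "\<dots> = (\<Sum>i<l. L i) + (\<Sum>i<l. l - Suc i)" by (rule sum.distrib)
  finally show ?thesis using assms by (simp add: partition_rows_def)
qed

lemma staircase_add_strict:
  assumes "L \<in> partition_rows l n" "i < j" "j < l"
  shows "staircase_add l L j < staircase_add l L i"
  using partition_rows_le[OF assms(1), of i j] assms by (simp add: staircase_add_def)

text \<open>In a nonzero term \<open>b (w i) \<le> a i\<close> for all \<open>i\<close>. The totals
  agree, so these are equalities, and as both sequences decrease strictly, \<open>w\<close> is
  increasing and hence the identity.\<close>

lemma recip_fact_det_delta:
  assumes L: "L \<in> partition_rows l k" and K: "K \<in> partition_rows l k"
  shows "recip_fact_det l (staircase_add l L) (staircase_add l K) = of_bool (L = K)"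
proof -
  let ?a = "staircase_add l L" and ?b = "staircase_add l K"
  have w_id: "w = id \<and> L = K" if w: "w permutes {..<l}" and le: "\<And>i. i < l \<Longrightarrow> ?b (w i) \<le> ?a i" for w
  proof -
    have "(\<Sum>i<l. ?b (w i)) = (\<Sum>i<l. ?b i)" using sum.permute[OF w, of ?b] by (simp add: o_def)
    then have sums: "(\<Sum>i<l. ?b (w i)) = (\<Sum>i<l. ?a i)" by (simp add: sum_staircase_add[OF L] sum_staircase_add[OF K])
    have eq: "?b (w i) = ?a i" if "i < l" for i
      by (rule sum_mono_inv[OF sums]) (use le that in auto)
    have wl: "w i < l" if "i < l" for i using that permutes_in_image[OF w, of i] by auto
    have mono: "w i < w j" if "i < j" "j < l" for i j
    proof (rule ccontr)
      assume "\<not> w i < w j"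
      then have "w j \<le> w i" by simp
      then have "?b (w i) \<le> ?b (w j)"
        using staircase_add_strict[OF K, of "w j" "w i"] wl[of i] that by (cases "w j = w i") auto
      then show False using eq[of i] eq[of j] staircase_add_strict[OF L that] that by simp
    qed
    have "i \<le> w i" if "i < l" for i
      using that
    proof (induction i)
      case (Suc i)
      then have "i \<le> w i" "w i < w (Suc i)" using mono[of i "Suc i"] by auto
      then show ?case by simp
    qed simp
    then have id: "w = id" using permutes_natset_ge[OF w] by auto
    have "L i = K i" for i
    proof (cases "i < l")
      case True
      then show ?thesis using eq[of i] by (simp add: id staircase_add_def)
    next
      case False
      then show ?thesis using L K by (simp add: partition_rows_def)
    qed
    then show ?thesis using id by blast
  qed
  show ?thesis
  proof (cases "L = K")
    case False
    have "recip_fact_det l ?a ?b = 0"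
    proof (rule ccontr)
      assume "recip_fact_det l ?a ?b \<noteq> 0"
      then obtain w where "w permutes {..<l}" "\<And>i. i < l \<Longrightarrow> ?b (w i) \<le> ?a i" by (rule recip_fact_det_nonzeroD) blast
      then show False using w_id False by blast
    qed
    then show ?thesis using False by simp
  next
    case True
    have "of_int (sign w) * (\<Prod>i<l. recip_fact (?a i) (?b (w i))) = (if w = id then 1 else 0)" if w: "w permutes {..<l}" for w
    proof (cases "w = id")
      case True
      then show ?thesis using \<open>L = K\<close> by (simp add: recip_fact_def)
    next
      case False
      then obtain i where i: "i < l" "\<not> ?b (w i) \<le> ?a i" using w_id[OF w] by blast
      then have "(\<Prod>i<l. recip_fact (?a i) (?b (w i))) = 0"
        by (intro prod_zero bexI[of _ i]) (auto simp: recip_fact_def)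
      then show ?thesis using False by simp
    qed
    then have "recip_fact_det l ?a ?b = (\<Sum>w | w permutes {..<l}. if w = id then 1 else 0)"
      unfolding recip_fact_det_def by (intro sum.cong) auto
    then show ?thesis using True by (simp add: finite_permutations permutes_id)
  qed
qed

text \<open>Aitken's formula, by the recursion of \<open>skew_count\<close>. As in branching,
  lowering a row without a corner gives a determinant with two equal rows, unless the row is the
  last one and empty, where the argument is already 0.\<close>

lemma recip_fact_det_skew_count:
  assumes K: "K \<in> partition_rows l k"
  shows "L \<in> partition_rows l (m + k) \<Longrightarrow>
    recip_fact_det l (staircase_add l L) (staircase_add l K) = of_nat (skew_count m L K) / fact m"
proof (induction m arbitrary: L)
  case 0
  then show ?case using recip_fact_det_delta[OF _ K] by simp
next
  case (Suc m)
  let ?a = "staircase_add l L" and ?b = "staircase_add l K"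
  let ?R = "{i. L (Suc i) < L i}"
  have L: "L \<in> partition_rows l (Suc (m + k))" using Suc.prems by simp
  have R: "?R \<subseteq> {..<l}" using partition_rows_remove(1)[OF L] by auto
  have zero: "(if ?a i = 0 then 0 else recip_fact_det l (?a(i := ?a i - 1)) ?b) = 0" if i: "i < l" "i \<notin> ?R" for i
  proof (cases "Suc i < l")
    case True
    have "L (Suc i) = L i" using i L unfolding partition_rows_def by (simp add: le_antisym)
    then have "recip_fact_det l (?a(i := ?a i - 1)) ?b = 0"
      using True by (intro recip_fact_det_repeated[of i l "Suc i"]) (auto simp: staircase_add_def)
    then show ?thesis by simp
  next
    case False
    then have "i = l - 1" "L i = 0" using i L unfolding partition_rows_def by auto
    then have "?a i = 0" using i by (simp add: staircase_add_def)
    then show ?thesis by simp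
  qed
  have nz: "(if ?a i = 0 then 0 else recip_fact_det l (?a(i := ?a i - 1)) ?b) = of_nat (skew_count m (L(i := L i - 1)) K) / fact m"
    if i: "i \<in> ?R" for i
  proof -
    have il: "i < l" using i R by auto
    have "?a i \<noteq> 0" using i il by (auto simp: staircase_add_def)
    moreover have "recip_fact_det l (?a(i := ?a i - 1)) ?b = recip_fact_det l (staircase_add l (L(i := L i - 1))) ?b"
      by (rule recip_fact_det_cong) (use i il in \<open>auto simp: staircase_add_def\<close>)
    ultimately show ?thesis using Suc.IH[OF partition_rows_remove(2)[OF L, of i]] i by (simp del: fun_upd_apply)
  qed
  have "of_nat (Suc m) * recip_fact_det l ?a ?b = (\<Sum>i<l. if ?a i = 0 then 0 else recip_fact_det l (?a(i := ?a i - 1)) ?b)"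
    using recip_fact_det_step[where l = l and a = "?a" and b = "?b"] by (simp add: sum_staircase_add[OF L] sum_staircase_add[OF K])
  also have "\<dots> = (\<Sum>i\<in>?R. if ?a i = 0 then 0 else recip_fact_det l (?a(i := ?a i - 1)) ?b)"
    by (rule sum.mono_neutral_right[OF finite_lessThan R]) (use zero in blast)
  also have "\<dots> = (\<Sum>i\<in>?R. of_nat (skew_count m (L(i := L i - 1)) K) / fact m)"
    by (rule sum.cong[OF refl nz])
  also have "\<dots> = of_nat (skew_count (Suc m) L K) / fact m" by (simp add: sum_divide_distrib)
  also have "\<dots> = of_nat (Suc m) * (of_nat (skew_count (Suc m) L K) / fact (Suc m))"
    unfolding fact_Suc by (simp del: of_nat_Suc skew_count.simps)
  finally show ?case unfolding mult_left_cancel[OF of_nat_neq_0] .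
qed

theorem shifted_schur_eq:
  assumes "is_partition mu" "is_partition lam"
  shows "shifted_schur mu lam =
    normalized_skew_count (sum_list lam) (sum_list mu) (list_rows lam) (list_rows mu)"
proof -
  define l where "l = max (length lam) (length mu)"
  define L where "L = list_rows lam"
  define K where "K = list_rows mu"
  define n where "n = sum_list lam"
  define k where "k = sum_list mu"
  have L: "L \<in> partition_rows l n" unfolding L_def n_def by (rule list_rows_partition_rows[OF assms(2)]) (simp add: l_def)
  have K: "K \<in> partition_rows l k" unfolding K_def k_def by (rule list_rows_partition_rows[OF assms(1)]) (simp add: l_def)
  have Z: "(\<lambda>_. 0) \<in> partition_rows l 0" by (simp add: partition_rows_def)
  let ?a = "staircase_add l L" and ?b = "staircase_add l K" and ?z = "staircase_add l (\<lambda>_. 0)"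
  have "shifted_schur mu lam = det (mat l l (\<lambda>(i,j). ff (of_nat (?a i)) (?b j))) / det (mat l l (\<lambda>(i,j). ff (of_nat (?a i)) (?z j)))"
    unfolding shifted_schur_def shifted_schur_n_def l_def[symmetric]
    by (simp add: staircase_add_def L_def K_def list_rows_def)
  \<comment> \<open>The row factors cancel, and the denominator is the same determinant for the
    empty partition.\<close>
  also have "\<dots> = recip_fact_det l ?a ?b / recip_fact_det l ?a ?z"
    unfolding det_ff by simp
  also have z: "recip_fact_det l ?a ?z = of_nat (skew_count n L (\<lambda>_. 0)) / fact n"
    by (rule recip_fact_det_skew_count[OF Z]) (use L in simp)
  also have "recip_fact_det l ?a ?b / (of_nat (skew_count n L (\<lambda>_. 0)) / fact n) = normalized_skew_count n k L K"
  proof (cases "k \<le> n")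
    case True
    have "recip_fact_det l ?a ?b = of_nat (skew_count (n - k) L K) / fact (n - k)"
      by (rule recip_fact_det_skew_count[OF K]) (use L True in simp)
    moreover have "ff (of_nat n) k = fact n / fact (n - k)"
      using True by (simp add: ff_recip_fact recip_fact_def)
    ultimately show ?thesis using True by (simp add: normalized_skew_count_def)
  next
    case False
    then have "recip_fact_det l ?a ?b = 0"
      by (intro recip_fact_det_zero) (simp add: sum_staircase_add[OF L] sum_staircase_add[OF K])
    then show ?thesis using False by (simp add: normalized_skew_count_def)
  qed
  finally show ?thesis by (simp add: n_def k_def L_def K_def)
qed

subsection \<open>Kostka numbers\<close>

text \<open>Row lengths as a function instead of a list: removing a corner is then a function
  update, even when the row becomes empty, and the sums over \<open>partition_rows\<close>
  apply.\<close>

definition ssyt_rows :: "(nat \<Rightarrow> nat) \<Rightarrow> nat list \<Rightarrow> (nat \<Rightarrow> nat \<Rightarrow> nat) set" where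
  "ssyt_rows L tau = {T.
     (\<forall>i j. j < L i \<longrightarrow> 1 \<le> T i j \<and> T i j \<le> length tau) \<and>
     (\<forall>i j. \<not> j < L i \<longrightarrow> T i j = 0) \<and>
     (\<forall>i j. Suc j < L i \<longrightarrow> T i j \<le> T i (Suc j)) \<and>
     (\<forall>i j. j < L (Suc i) \<longrightarrow> T i j < T (Suc i) j) \<and>
     (\<forall>k < length tau. card {(i,j). j < L i \<and> T i j = Suc k} = tau ! k)}"

lemma kostka_eq_card: "kostka lam tau = card (ssyt_rows (list_rows lam) tau)"
proof -
  have e1: "(i < length lam \<and> j < lam ! i) = (j < list_rows lam i)" for i j
    by (simp add: list_rows_def)
  have e2: "(i < length lam \<and> j < lam ! i \<and> R) = (j < list_rows lam i \<and> R)" for i j R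
    by (simp add: list_rows_def)
  show ?thesis unfolding kostka_def ssyt_def ssyt_rows_def e1 e2 ..
qed

lemma finite_ssyt_rows:
  assumes "finite {(i,j). j < L i}"
  shows "finite (ssyt_rows L tau)"
proof (rule finite_imageD)
  let ?f = "\<lambda>T (x :: nat \<times> nat). T (fst x) (snd x) :: nat"
  show "inj_on ?f (ssyt_rows L tau)" by (rule inj_onI) (metis fst_conv snd_conv ext)
  have "?f ` ssyt_rows L tau \<subseteq> {f. \<forall>x. (x \<in> {(i,j). j < L i} \<longrightarrow> f x \<in> {..length tau}) \<and> (x \<notin> {(i,j). j < L i} \<longrightarrow> f x = 0)}"
    by (auto simp: ssyt_rows_def)
  then show "finite (?f ` ssyt_rows L tau)"
    by (rule finite_subset) (rule finite_set_of_finite_funs[OF assms finite_atMost])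
qed

text \<open>The unique box containing the largest entry is a corner, and removing it is a bijection.\<close>

lemma card_ssyt_rows_snoc:
  assumes L: "L \<in> partition_rows l n"
  shows "card (ssyt_rows L (tau @ [1])) = (\<Sum>i | L (Suc i) < L i. card (ssyt_rows (L(i := L i - 1)) tau))"
proof -
  define m where "m = Suc (length tau)"
  let ?S = "ssyt_rows L (tau @ [1])"
  let ?R = "{i. L (Suc i) < L i}"
  have finb: "finite {(i,j). j < L i}" using finite_boxes[OF L] by (simp add: boxes_def)
  have finR: "finite ?R"
  proof (rule finite_subset)
    show "?R \<subseteq> {..<l}"
    proof
      fix i assume "i \<in> ?R"
      then show "i \<in> {..<l}" using L by (cases "i < l") (auto simp: partition_rows_def)
    qed
  qed simp
  have unique: "\<exists>i j. {(i,j). j < L i \<and> T i j = m} = {(i,j)}" if "T \<in> ?S" for T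
  proof -
    have "card {(i,j). j < L i \<and> T i j = m} = 1"
      using that unfolding ssyt_rows_def m_def by (simp add: nth_append)
    then obtain c where "{(i,j). j < L i \<and> T i j = m} = {c}" by (auto simp: card_1_singleton_iff)
    then show ?thesis by (cases c) auto
  qed
  have corner: "\<exists>i\<in>?R. {(i,j). j < L i \<and> T i j = m} = {(i, L i - 1)}" if T: "T \<in> ?S" for T
  proof -
    obtain i j where ij: "{(i,j). j < L i \<and> T i j = m} = {(i,j)}" using unique[OF T] by blast
    then have jL: "j < L i" "T i j = m" by auto
    have le: "T a b \<le> m" if "b < L a" for a b using T that by (simp add: ssyt_rows_def m_def)
    have "\<not> Suc j < L i"
    proof
      assume s: "Suc j < L i"
      then have "T i j \<le> T i (Suc j)" using T by (simp add: ssyt_rows_def)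
      then have "T i (Suc j) = m" using le[OF s] jL by simp
      then have "(i, Suc j) \<in> {(i,j). j < L i \<and> T i j = m}" using s by simp
      then show False unfolding ij by simp
    qed
    then have j: "j = L i - 1" using jL by simp
    have "\<not> j < L (Suc i)"
    proof
      assume s: "j < L (Suc i)"
      then have "T i j < T (Suc i) j" using T by (simp add: ssyt_rows_def)
      then show False using le[OF s] jL by simp
    qed
    then have "i \<in> ?R" using jL by simp
    then show ?thesis using ij j by blast
  qed
  define S where "S i = {T \<in> ?S. T i (L i - 1) = m}" for i
  have "?S = (\<Union>i\<in>?R. S i)"
  proof
    show "?S \<subseteq> (\<Union>i\<in>?R. S i)"
    proof
      fix T assume T: "T \<in> ?S"
      obtain i where i: "i \<in> ?R" "{(i,j). j < L i \<and> T i j = m} = {(i, L i - 1)}" using corner[OF T] by blast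
      then have "T i (L i - 1) = m" by auto
      then show "T \<in> (\<Union>i\<in>?R. S i)" using i T by (auto simp: S_def)
    qed
  qed (auto simp: S_def)
  moreover have "S i \<inter> S i' = {}" if "i \<in> ?R" "i' \<in> ?R" "i \<noteq> i'" for i i'
  proof (rule ccontr)
    assume "S i \<inter> S i' \<noteq> {}"
    then obtain T where T: "T \<in> ?S" "T i (L i - 1) = m" "T i' (L i' - 1) = m" by (auto simp: S_def)
    obtain a b where "{(i,j). j < L i \<and> T i j = m} = {(a,b)}" using unique[OF T(1)] by blast
    moreover have "(i, L i - 1) \<in> {(i,j). j < L i \<and> T i j = m}" "(i', L i' - 1) \<in> {(i,j). j < L i \<and> T i j = m}"
      using that T by auto
    ultimately show False using that(3) by auto
  qed
  moreover have "finite (S i)" for i using finite_ssyt_rows[OF finb] by (simp add: S_def)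
  ultimately have "card ?S = (\<Sum>i\<in>?R. card (S i))"
    using finR by (simp add: card_UN_disjoint)
  also have "\<dots> = (\<Sum>i\<in>?R. card (ssyt_rows (L(i := L i - 1)) tau))"
  proof (rule sum.cong[OF refl])
    fix i assume i: "i \<in> ?R"
    define L' where "L' = L(i := L i - 1)"
    have L': "b < L' a \<longleftrightarrow> b < L a \<and> (a,b) \<noteq> (i, L i - 1)" for a b
      using i by (auto simp: L'_def)
    have corner_below: "L (Suc i) \<le> L i - 1" "L i - 1 < L i" using i by auto
    have Ldec: "L (Suc a) \<le> L a" for a using L by (simp add: partition_rows_def)
    \<comment> \<open>Removal writes the default 0 of boxes outside the shape into the corner;
      insertion writes the largest entry \<open>m\<close>.\<close>
    let ?f = "\<lambda>T. T(i := (T i)(L i - 1 := 0))" and ?g = "\<lambda>T. T(i := (T i)(L i - 1 := m))"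
    have upd: "(T(i := (T i)(L i - 1 := v))) a b = (if (a,b) = (i, L i - 1) then v else T a b)" for T :: "nat \<Rightarrow> nat \<Rightarrow> nat" and v a b
      by simp
    have "bij_betw ?f (S i) (ssyt_rows L' tau)"
    proof (rule bij_betw_byWitness[of _ ?g])
      show "\<forall>T\<in>S i. ?g (?f T) = T" by (auto simp: S_def fun_eq_iff)
      show "\<forall>T\<in>ssyt_rows L' tau. ?f (?g T) = T"
      proof
        fix T assume "T \<in> ssyt_rows L' tau"
        then have "T i (L i - 1) = 0" using L'[of "L i - 1" i] by (simp add: ssyt_rows_def)
        then show "?f (?g T) = T" by (auto simp: fun_eq_iff)
      qed
      show "?f ` S i \<subseteq> ssyt_rows L' tau"
      proof (rule image_subsetI)
        fix T assume TS: "T \<in> S i"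
        then have T: "T \<in> ?S" and Ti: "T i (L i - 1) = m" by (auto simp: S_def)
        have T1: "\<And>a b. b < L a \<Longrightarrow> 1 \<le> T a b \<and> T a b \<le> m"
          and T2: "\<And>a b. \<not> b < L a \<Longrightarrow> T a b = 0"
          and T3: "\<And>a b. Suc b < L a \<Longrightarrow> T a b \<le> T a (Suc b)"
          and T4: "\<And>a b. b < L (Suc a) \<Longrightarrow> T a b < T (Suc a) b"
          and T5: "\<And>k. k < m \<Longrightarrow> card {(a,b). b < L a \<and> T a b = Suc k} = (tau @ [1]) ! k"
          using T by (auto simp: ssyt_rows_def m_def)
        have uniq: "T a b \<noteq> m" if "b < L' a" for a b
        proof
          assume "T a b = m"
          obtain x y where "{(i,j). j < L i \<and> T i j = m} = {(x,y)}" using unique[OF T] by blast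
          moreover have "(i, L i - 1) \<in> {(i,j). j < L i \<and> T i j = m}" "(a, b) \<in> {(i,j). j < L i \<and> T i j = m}"
            using that \<open>T a b = m\<close> Ti i by (auto simp: L')
          ultimately show False using that L' by auto
        qed
        have fT: "?f T a b = T a b" if "b < L' a" for a b using that L' by (simp only: upd if_False)
        have c1: "1 \<le> ?f T a b \<and> ?f T a b \<le> length tau" if b: "b < L' a" for a b
          unfolding fT[OF b] using T1[of b a] uniq[OF b] b L' by (simp add: m_def)
        have c2: "?f T a b = 0" if "\<not> b < L' a" for a b
          using that T2[of b a] unfolding upd L' by auto
        have c3: "?f T a b \<le> ?f T a (Suc b)" if b: "Suc b < L' a" for a b
        proof -
          have "b < L' a" using b by simp
          then show ?thesis unfolding fT[OF b] fT[OF \<open>b < L' a\<close>] using T3[of b a] b L' by simp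
        qed
        have c4: "?f T a b < ?f T (Suc a) b" if b: "b < L' (Suc a)" for a b
        proof -
          have "b < L (Suc a)" using b L' by simp
          \<comment> \<open>The removed corner has no box below it, so it is not
            \<open>(a, b)\<close>.\<close>
          moreover have "b < L' a" unfolding L'
            using \<open>b < L (Suc a)\<close> Ldec[of a] corner_below by auto
          ultimately show ?thesis unfolding fT[OF b] fT[OF \<open>b < L' a\<close>] by (intro T4)
        qed
        have c5: "card {(a,b). b < L' a \<and> ?f T a b = Suc k} = tau ! k" if k: "k < length tau" for k
        proof -
          have "{(a,b). b < L' a \<and> ?f T a b = Suc k} = {(a,b). b < L a \<and> T a b = Suc k}"
            using Ti k fT unfolding L' by (auto simp: m_def)
          then show ?thesis using T5[of k] k by (simp add: m_def nth_append)
        qed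
        show "?f T \<in> ssyt_rows L' tau"
          unfolding ssyt_rows_def using c1 c2 c3 c4 c5 by blast
      qed
      show "?g ` ssyt_rows L' tau \<subseteq> S i"
      proof (rule image_subsetI)
        fix T assume T: "T \<in> ssyt_rows L' tau"
        have T1: "\<And>a b. b < L' a \<Longrightarrow> 1 \<le> T a b \<and> T a b < m"
          and T2: "\<And>a b. \<not> b < L' a \<Longrightarrow> T a b = 0"
          and T3: "\<And>a b. Suc b < L' a \<Longrightarrow> T a b \<le> T a (Suc b)"
          and T4: "\<And>a b. b < L' (Suc a) \<Longrightarrow> T a b < T (Suc a) b"
          and T5: "\<And>k. k < length tau \<Longrightarrow> card {(a,b). b < L' a \<and> T a b = Suc k} = tau ! k"
          using T by (auto simp: ssyt_rows_def m_def less_Suc_eq_le)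
        have gT: "?g T a b = T a b" if "b < L' a" for a b using that L' by (simp only: upd if_False)
        have gi: "?g T i (L i - 1) = m" by simp
        have split: "b < L' a \<or> (a = i \<and> b = L i - 1)" if "b < L a" for a b using that L' by auto
        have Tlt: "T a b < m" for a b using T1[of b a] T2[of b a] by (cases "b < L' a") (auto simp: m_def)
        have c1: "1 \<le> ?g T a b \<and> ?g T a b \<le> length (tau @ [1])" if b: "b < L a" for a b
          using split[OF b] T1[of b a] gT[of b a] gi by (auto simp: m_def)
        have c2: "?g T a b = 0" if "\<not> b < L a" for a b
          using that T2[of b a] corner_below L' unfolding upd by auto
        have c3: "?g T a b \<le> ?g T a (Suc b)" if b: "Suc b < L a" for a b
        proof -
          have b': "b < L' a" unfolding L' using b by auto
          show ?thesis using split[OF b]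
          proof
            assume "Suc b < L' a"
            then show ?thesis unfolding gT[OF b'] gT[OF \<open>Suc b < L' a\<close>] by (rule T3)
          next
            assume "a = i \<and> Suc b = L i - 1"
            then have "?g T a (Suc b) = m" using gi by simp
            then show ?thesis unfolding gT[OF b'] using Tlt[of a b] by simp
          qed
        qed
        have c4: "?g T a b < ?g T (Suc a) b" if b: "b < L (Suc a)" for a b
        proof -
          have b': "b < L' a" unfolding L' using b Ldec[of a] corner_below by auto
          show ?thesis using split[OF b]
          proof
            assume "b < L' (Suc a)"
            then show ?thesis unfolding gT[OF b'] gT[OF \<open>b < L' (Suc a)\<close>] by (rule T4)
          next
            assume "Suc a = i \<and> b = L i - 1"
            then have "?g T (Suc a) b = m" using gi by simp
            then show ?thesis unfolding gT[OF b'] using Tlt[of a b] by simp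
          qed
        qed
        have c5: "card {(a,b). b < L a \<and> ?g T a b = Suc k} = (tau @ [1]) ! k" if k: "k < length (tau @ [1])" for k
        proof (cases "k < length tau")
          case True
          have "{(a,b). b < L a \<and> ?g T a b = Suc k} = {(a,b). b < L' a \<and> T a b = Suc k}"
            using True unfolding upd L' by (auto simp: m_def)
          then show ?thesis using T5[OF True] True by (simp add: nth_append)
        next
          case False
          then have k: "Suc k = m" "k = length tau" using k by (auto simp: m_def)
          have "{(a,b). b < L a \<and> ?g T a b = Suc k} = {(i, L i - 1)}"
            using Tlt corner_below unfolding upd k(1) by (auto simp: nat_neq_iff)
          then show ?thesis using k by simp
        qed
        have "?g T \<in> ?S" unfolding ssyt_rows_def using c1 c2 c3 c4 c5 by blast
        then show "?g T \<in> S i" by (simp add: S_def)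
      qed
    qed
    then show "card (S i) = card (ssyt_rows (L(i := L i - 1)) tau)"
      unfolding L'_def by (rule bij_betw_same_card)
  qed
  finally show ?thesis .
qed

text \<open>Each of the \<open>m\<close> largest entries occurs once, so they are stripped off by a
  chain of corner removals that ends in a shape of size \<open>k\<close>.\<close>

lemma card_ssyt_rows_ones:
  "L \<in> partition_rows l (m + k) \<Longrightarrow> card (ssyt_rows L (mu @ replicate m 1)) =
    (\<Sum>N\<in>partition_rows l k. skew_count m L N * card (ssyt_rows N mu))"
proof (induction m arbitrary: L)
  case 0
  have "(\<Sum>N\<in>partition_rows l k. skew_count 0 L N * card (ssyt_rows N mu)) =
    (\<Sum>N\<in>partition_rows l k. if N = L then card (ssyt_rows L mu) else 0)"
    by (intro sum.cong) auto
  then show ?case using 0 by (simp add: finite_partition_rows)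
next
  case (Suc m)
  have L: "L \<in> partition_rows l (Suc (m + k))" using Suc.prems by simp
  have "mu @ replicate (Suc m) 1 = (mu @ replicate m 1) @ [1]" by (simp add: replicate_append_same)
  then have "card (ssyt_rows L (mu @ replicate (Suc m) 1)) =
      (\<Sum>i | L (Suc i) < L i. card (ssyt_rows (L(i := L i - 1)) (mu @ replicate m 1)))"
    using card_ssyt_rows_snoc[OF L, of "mu @ replicate m 1"] by simp
  also have "\<dots> = (\<Sum>i | L (Suc i) < L i. \<Sum>N\<in>partition_rows l k. skew_count m (L(i := L i - 1)) N * card (ssyt_rows N mu))"
    by (intro sum.cong refl Suc.IH partition_rows_remove(2)[OF L]) simp
  also have "\<dots> = (\<Sum>N\<in>partition_rows l k. skew_count (Suc m) L N * card (ssyt_rows N mu))"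
    by (subst sum.swap) (simp add: sum_distrib_right)
  finally show ?case .
qed

lemma card_ssyt_rows_empty: "card (ssyt_rows (\<lambda>_. 0) []) = 1"
proof -
  have "ssyt_rows (\<lambda>_. 0) [] = {\<lambda>_ _. 0}" by (auto simp: ssyt_rows_def fun_eq_iff)
  then show ?thesis by simp
qed

text \<open>A partition of \<open>k\<close> has at most \<open>k\<close> rows, so the expansion of
  \<open>Ko\<close> ranges over shapes that do not depend on the diagram.\<close>

lemma partition_rows_stable:
  assumes "k \<le> l"
  shows "partition_rows l k = partition_rows k k"
proof
  show "partition_rows l k \<subseteq> partition_rows k k"
  proof
    fix L assume L: "L \<in> partition_rows l k"
    have "L k = 0"
    proof (rule ccontr)
      assume nz: "L k \<noteq> 0"
      then have kl: "k < l" using L by (cases "k < l") (auto simp: partition_rows_def)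
      have "Suc k = (\<Sum>i<Suc k. 1)" by simp
      also have "\<dots> \<le> (\<Sum>i<Suc k. L i)"
      proof (rule sum_mono)
        fix i assume "i \<in> {..<Suc k}"
        then have "L k \<le> L i" by (intro partition_rows_le[OF L]) simp
        then show "1 \<le> L i" using nz by simp
      qed
      also have "\<dots> \<le> (\<Sum>i<l. L i)" using kl by (intro sum_mono2) auto
      finally show False using L by (simp add: partition_rows_def)
    qed
    then have z: "L i = 0" if "k \<le> i" for i using partition_rows_le[OF L that] by simp
    have "(\<Sum>i<l. L i) = (\<Sum>i<k. L i)"
      by (rule sum.mono_neutral_right) (use assms z in auto)
    then show "L \<in> partition_rows k k" using L z by (simp add: partition_rows_def)
  qed
  show "partition_rows k k \<subseteq> partition_rows l k" using partition_rows_mono[OF _ assms] by blast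
qed

theorem Ko_eq:
  assumes "is_partition lam" "k = sum_list mu"
  shows "Ko mu lam = (\<Sum>N\<in>partition_rows k k.
    of_nat (card (ssyt_rows N mu)) * normalized_skew_count (sum_list lam) k (list_rows lam) N)"
proof -
  define l where "l = max (length lam) k"
  define L where "L = list_rows lam"
  define n where "n = sum_list lam"
  have L: "L \<in> partition_rows l n"
    unfolding L_def n_def by (rule list_rows_partition_rows[OF assms(1)]) (simp add: l_def)
  have P: "partition_rows l k = partition_rows k k" by (rule partition_rows_stable) (simp add: l_def)
  \<comment> \<open>The same chain of removals, with the empty shape as its only possible
    end.\<close>
  have "kostka lam (replicate n 1) = skew_count n L (\<lambda>_. 0)"
    using card_ssyt_rows_ones[of L l n 0 "[]"] L
    by (simp add: kostka_eq_card L_def[symmetric] partition_rows_0 card_ssyt_rows_empty[simplified])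
  moreover have "kostka lam (mu @ replicate (n - k) 1) = (\<Sum>N\<in>partition_rows k k. skew_count (n - k) L N * card (ssyt_rows N mu))"
    if "k \<le> n"
    using card_ssyt_rows_ones[of L l "n - k" k mu] L that by (simp add: kostka_eq_card L_def[symmetric] P)
  ultimately show ?thesis
    unfolding Ko_def Let_def assms(2)[symmetric] n_def[symmetric] L_def[symmetric] normalized_skew_count_def
    by (simp add: sum_distrib_left sum_divide_distrib mult_ac)
qed

subsection \<open>Multirectangular coordinates\<close>

lemma color_stab_map_permutation:
  assumes g: "bij_betw g M B" and c: "\<And>x y. x \<in> M \<Longrightarrow> y \<in> M \<Longrightarrow> c x = c y \<Longrightarrow> c' (g x) = c' (g y)"
    and p: "p \<in> color_stab M c"
  shows "map_permutation M g p \<in> color_stab B c'"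
proof -
  have pM: "p permutes M" using p by (simp add: color_stab_def)
  have "c' (map_permutation M g p y) = c' y" if "y \<in> B" for y
  proof -
    obtain x where x: "x \<in> M" "y = g x" using bij_betw_imp_surj_on[OF g] \<open>y \<in> B\<close> by blast
    have "p x \<in> M" using permutes_in_image[OF pM] x by blast
    then have "c' (g (p x)) = c' (g x)" using x p by (intro c) (auto simp: color_stab_def)
    then show ?thesis unfolding x(2) map_permutation_apply[OF bij_betw_imp_inj_on[OF g] x(1)] .
  qed
  then show ?thesis using map_permutation_permutes[OF g pM] by (simp add: color_stab_def)
qed

lemma sum_color_stab_transport:
  assumes g: "bij_betw g M B" and c: "\<And>x y. x \<in> M \<Longrightarrow> y \<in> M \<Longrightarrow> c x = c y \<longleftrightarrow> c' (g x) = c' (g y)"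
  shows "(\<Sum>p\<in>color_stab M c. F (map_permutation M g p)) = (\<Sum>q\<in>color_stab B c'. F q)"
proof (rule sum.reindex_bij_witness[of _ "map_permutation B (inv_into M g)" "map_permutation M g"])
  let ?i = "inv_into M g"
  have gi: "?i (g x) = x" if "x \<in> M" for x by (rule bij_betw_inv_into_left[OF g that])
  fix p assume p: "p \<in> color_stab M c"
  show "map_permutation B ?i (map_permutation M g p) = p"
    by (rule map_permutation_compose_inv[OF g _ gi]) (use p in \<open>auto simp: color_stab_def\<close>)
  show "map_permutation M g p \<in> color_stab B c'"
    by (rule color_stab_map_permutation[OF g _ p]) (use c in blast)
next
  let ?i = "inv_into M g"
  have i: "bij_betw ?i B M" by (rule bij_betw_inv_into[OF g])
  have ig: "g (?i y) = y" if "y \<in> B" for y by (rule bij_betw_inv_into_right[OF g that])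
  have iM: "?i y \<in> M" if "y \<in> B" for y using bij_betwE[OF i] that by blast
  fix q assume q: "q \<in> color_stab B c'"
  show "map_permutation M g (map_permutation B ?i q) = q"
    by (rule map_permutation_compose_inv[OF i _ ig]) (use q in \<open>auto simp: color_stab_def\<close>)
  show "map_permutation B ?i q \<in> color_stab M c"
    by (rule color_stab_map_permutation[OF i _ q]) (simp add: c iM ig)
qed simp

text \<open>Row and column groups depend only on which boxes share a row or a column.\<close>

lemma young_pairing_transport:
  assumes M: "finite M" and g: "bij_betw g M B"
    and fs: "\<And>x y. x \<in> M \<Longrightarrow> y \<in> M \<Longrightarrow> fst x = fst y \<longleftrightarrow> fst (g x) = fst (g y)"
    and sn: "\<And>x y. x \<in> M \<Longrightarrow> y \<in> M \<Longrightarrow> snd x = snd y \<longleftrightarrow> snd (g x) = snd (g y)"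
    and f: "\<And>p q. p permutes M \<Longrightarrow> q permutes B \<Longrightarrow> \<forall>x\<in>M. g (p x) = q (g x) \<Longrightarrow> f p = f' q"
  shows "young_pairing M f = young_pairing B f'"
proof -
  let ?m = "map_permutation M g"
  have inj: "inj_on g M" by (rule bij_betw_imp_inj_on[OF g])
  have "young_pairing M f = (\<Sum>\<sigma>\<in>color_stab M fst. \<Sum>\<tau>\<in>color_stab M snd. of_int (sign (?m \<tau>)) * f' (?m \<tau> \<circ> ?m \<sigma>))"
    unfolding young_pairing_def
  proof (intro sum.cong refl)
    fix \<sigma> \<tau> assume "\<sigma> \<in> color_stab M fst" "\<tau> \<in> color_stab M snd"
    then have s: "\<sigma> permutes M" "\<tau> permutes M" by (auto simp: color_stab_def)
    have "f (\<tau> \<circ> \<sigma>) = f' (?m \<tau> \<circ> ?m \<sigma>)"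
    proof (rule f)
      show "\<tau> \<circ> \<sigma> permutes M" by (rule permutes_compose[OF s])
      show "?m \<tau> \<circ> ?m \<sigma> permutes B" by (intro permutes_compose map_permutation_permutes[OF g] s)
      show "\<forall>x\<in>M. g ((\<tau> \<circ> \<sigma>) x) = (?m \<tau> \<circ> ?m \<sigma>) (g x)"
        using permutes_in_image[OF s(1)] by (simp add: map_permutation_apply[OF inj])
    qed
    then show "of_int (sign \<tau>) * f (\<tau> \<circ> \<sigma>) = of_int (sign (?m \<tau>)) * f' (?m \<tau> \<circ> ?m \<sigma>)"
      by (simp add: sign_map_permutation[OF inj s(2) M])
  qed
  also have "\<dots> = (\<Sum>\<sigma>\<in>color_stab M fst. \<Sum>\<tau>\<in>color_stab B snd. of_int (sign \<tau>) * f' (\<tau> \<circ> ?m \<sigma>))"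
    by (rule sum.cong[OF refl], rule sum_color_stab_transport[where c = snd and c' = snd, OF g sn])
  also have "\<dots> = young_pairing B f'" unfolding young_pairing_def
    by (rule sum_color_stab_transport[where c = fst and c' = fst, OF g fs])
  finally show ?thesis .
qed

section \<open>Weights of sets of boxes up to renaming of rows and columns\<close>

text \<open>Polymorphic in \<open>M\<close>, so that boxes can be pairs of numbers as well as pairs
  of block labels.\<close>

definition young_weight :: "(nat \<times> nat) set \<Rightarrow> ('a \<times> 'b) set \<Rightarrow> rat" where
  "young_weight D M = young_pairing M (young_class D M)"

lemma young_weight_nonneg: "finite D \<Longrightarrow> finite M \<Longrightarrow> 0 \<le> young_weight D M"
  unfolding young_weight_def by (rule young_pairing_young_class_nonneg)

lemma inj_on_map_prod_sides:
  assumes "inj_on \<rho> A" "inj_on \<gamma> B" "M \<subseteq> A \<times> B"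
  shows "inj_on (map_prod \<rho> \<gamma>) M"
  by (rule inj_on_subset[OF map_prod_inj_on[OF assms(1,2)] assms(3)])

text \<open>Rows and columns may be renamed injectively, without regard to their order. This allows
  the passage from diagrams to block labels and, within these, to normal forms.\<close>

lemma young_weight_map_prod:
  assumes M: "finite M" "M \<subseteq> A \<times> B" and r: "inj_on \<rho> A" and c: "inj_on \<gamma> B"
  shows "young_weight D (map_prod \<rho> \<gamma> ` M) = young_weight D M"
proof -
  let ?g = "map_prod \<rho> \<gamma>"
  have g: "bij_betw ?g M (?g ` M)" using inj_on_map_prod_sides[OF r c M(2)] by (simp add: bij_betw_def)
  have "young_pairing M (young_class D M) = young_pairing (?g ` M) (young_class D (?g ` M))"
  proof (rule young_pairing_transport[OF M(1) g])
    fix x y assume xy: "x \<in> M" "y \<in> M"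
    have "fst x \<in> A" "fst y \<in> A" "snd x \<in> B" "snd y \<in> B" using xy M(2) by auto
    then show "fst x = fst y \<longleftrightarrow> fst (?g x) = fst (?g y)" "snd x = snd y \<longleftrightarrow> snd (?g x) = snd (?g y)"
      using r c by (simp_all add: inj_on_eq_iff)
  next
    fix p q assume p: "p permutes M" and e: "\<forall>x\<in>M. ?g (p x) = q (?g x)"
    show "young_class D M p = young_class D (?g ` M) q"
      by (rule young_class_transport[OF g]) (use e permutes_in_image[OF p] in auto)
  qed
  then show ?thesis by (simp add: young_weight_def)
qed

text \<open>A row or column is labelled by its block and its position in the block; a box lies in the diagram
  iff the block of its row does not exceed the block of its column.\<close>

definition block_labels :: "nat list \<Rightarrow> (nat \<times> nat) set" where
  "block_labels a = (SIGMA s:{..<length a}. {..<a ! s})"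

definition block_boxes :: "(nat \<times> nat) set \<Rightarrow> (nat \<times> nat) set \<Rightarrow> ((nat \<times> nat) \<times> (nat \<times> nat)) set" where
  "block_boxes A B = {(x, y) \<in> A \<times> B. fst x \<le> fst y}"

lemma finite_block_labels: "finite (block_labels a)"
  by (simp add: block_labels_def)

lemma finite_block_boxes: "finite A \<Longrightarrow> finite B \<Longrightarrow> finite (block_boxes A B)"
  unfolding block_boxes_def by (rule finite_subset[of _ "A \<times> B"]) auto

definition spanning_subsets :: "nat \<Rightarrow> (nat \<times> nat) set \<Rightarrow> (nat \<times> nat) set \<Rightarrow> ((nat \<times> nat) \<times> (nat \<times> nat)) set set" where
  "spanning_subsets k A B = {M. M \<subseteq> block_boxes A B \<and> card M = k \<and> fst ` M = A \<and> snd ` M = B}"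

lemma spanning_subsets_map_prod:
  assumes r: "bij_betw \<rho> A A'" "\<And>x. x \<in> A \<Longrightarrow> fst (\<rho> x) = fst x"
    and c: "bij_betw \<gamma> B B'" "\<And>x. x \<in> B \<Longrightarrow> fst (\<gamma> x) = fst x"
    and M: "M \<in> spanning_subsets k A B"
  shows "map_prod \<rho> \<gamma> ` M \<in> spanning_subsets k A' B'"
proof -
  let ?g = "map_prod \<rho> \<gamma>"
  have sub: "M \<subseteq> A \<times> B" using M by (auto simp: spanning_subsets_def block_boxes_def)
  have "inj_on ?g M" by (rule inj_on_map_prod_sides[OF _ _ sub]) (use r c in \<open>auto simp: bij_betw_def\<close>)
  then have "card (?g ` M) = k" using M by (simp add: card_image spanning_subsets_def)
  moreover have "?g ` M \<subseteq> block_boxes A' B'"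
  proof (rule image_subsetI)
    fix x assume x: "x \<in> M"
    then have "fst x \<in> A" "snd x \<in> B" "fst (fst x) \<le> fst (snd x)"
      using M by (auto simp: spanning_subsets_def block_boxes_def)
    moreover have "?g x = (\<rho> (fst x), \<gamma> (snd x))" by (simp add: map_prod_def case_prod_unfold)
    ultimately show "?g x \<in> block_boxes A' B'"
      using r(2) c(2) bij_betwE[OF r(1)] bij_betwE[OF c(1)] by (simp add: block_boxes_def)
  qed
  moreover have "fst ` ?g ` M = \<rho> ` fst ` M" "snd ` ?g ` M = \<gamma> ` snd ` M" by (auto simp: image_image)
  then have "fst ` ?g ` M = A'" "snd ` ?g ` M = B'"
    using M bij_betw_imp_surj_on[OF r(1)] bij_betw_imp_surj_on[OF c(1)] by (simp_all add: spanning_subsets_def)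
  ultimately show ?thesis by (simp add: spanning_subsets_def)
qed

text \<open>Renamings that respect the blocks preserve both the shape condition and the weights, so
  the sum depends on \<open>A\<close> and \<open>B\<close> only through the numbers of labels in
  each block.\<close>

lemma sum_spanning_subsets:
  assumes fin: "finite A" "finite B"
    and r: "bij_betw \<rho> A A'" "\<And>x. x \<in> A \<Longrightarrow> fst (\<rho> x) = fst x"
    and c: "bij_betw \<gamma> B B'" "\<And>x. x \<in> B \<Longrightarrow> fst (\<gamma> x) = fst x"
  shows "(\<Sum>M\<in>spanning_subsets k A B. young_weight D M) = (\<Sum>M\<in>spanning_subsets k A' B'. young_weight D M)"
proof -
  let ?g = "map_prod \<rho> \<gamma>"
  define r' where "r' = inv_into A \<rho>"
  define c' where "c' = inv_into B \<gamma>"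
  have r': "bij_betw r' A' A" "\<And>x. x \<in> A \<Longrightarrow> r' (\<rho> x) = x" "\<And>y. y \<in> A' \<Longrightarrow> \<rho> (r' y) = y"
    unfolding r'_def using r(1) by (auto simp: bij_betw_inv_into bij_betw_inv_into_left bij_betw_inv_into_right)
  have c': "bij_betw c' B' B" "\<And>x. x \<in> B \<Longrightarrow> c' (\<gamma> x) = x" "\<And>y. y \<in> B' \<Longrightarrow> \<gamma> (c' y) = y"
    unfolding c'_def using c(1) by (auto simp: bij_betw_inv_into bij_betw_inv_into_left bij_betw_inv_into_right)
  have fr': "fst (r' y) = fst y" if "y \<in> A'" for y
    using r(2)[of "r' y"] r'(3)[OF that] bij_betwE[OF r'(1)] that by simp
  have fc': "fst (c' y) = fst y" if "y \<in> B'" for y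
    using c(2)[of "c' y"] c'(3)[OF that] bij_betwE[OF c'(1)] that by simp
  have sub: "M \<subseteq> X \<times> Y" if "M \<in> spanning_subsets k X Y" for M X Y
    using that by (auto simp: spanning_subsets_def block_boxes_def)
  show ?thesis
  proof (rule sum.reindex_bij_witness[of _ "\<lambda>M. map_prod r' c' ` M" "\<lambda>M. ?g ` M"])
    fix M assume M: "M \<in> spanning_subsets k A B"
    have "map_prod r' c' (?g x) = x" if x: "x \<in> M" for x
    proof -
      have "fst x \<in> A" "snd x \<in> B" using sub[OF M] x by auto
      then show ?thesis using r'(2) c'(2) by (simp add: map_prod_def case_prod_unfold)
    qed
    then show "map_prod r' c' ` ?g ` M = M" by (simp add: image_image)
    show "?g ` M \<in> spanning_subsets k A' B'" by (rule spanning_subsets_map_prod[OF r c M])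
    show "young_weight D (?g ` M) = young_weight D M"
      by (rule young_weight_map_prod[OF finite_subset[OF sub[OF M]] sub[OF M]])
        (use fin r(1) c(1) in \<open>auto simp: bij_betw_def\<close>)
  next
    fix M assume M: "M \<in> spanning_subsets k A' B'"
    have "?g (map_prod r' c' x) = x" if x: "x \<in> M" for x
    proof -
      have "fst x \<in> A'" "snd x \<in> B'" using sub[OF M] x by auto
      then show ?thesis using r'(3) c'(3) by (simp add: map_prod_def case_prod_unfold)
    qed
    then show "?g ` map_prod r' c' ` M = M" by (simp add: image_image)
    show "map_prod r' c' ` M \<in> spanning_subsets k A B" by (rule spanning_subsets_map_prod[OF r'(1) fr' c'(1) fc' M])
  qed
qed

section \<open>Counting rows and columns by blocks\<close>

definition block_profile :: "nat \<Rightarrow> (nat \<times> nat) set \<Rightarrow> nat list" where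
  "block_profile d A = map (\<lambda>s. card {i. (s, i) \<in> A}) [0..<d]"

lemma length_block_profile [simp]: "length (block_profile d A) = d"
  by (simp add: block_profile_def)

lemma block_slice_subset:
  assumes "A \<subseteq> block_labels p" "s < length p"
  shows "{i. (s, i) \<in> A} \<subseteq> {..<p ! s}"
  using assms by (auto simp: block_labels_def)

lemma block_profile_bij:
  assumes A: "A \<subseteq> block_labels p" "length p = d"
  obtains \<rho> where "bij_betw \<rho> A (block_labels (block_profile d A))" "\<And>x. x \<in> A \<Longrightarrow> fst (\<rho> x) = fst x"
proof -
  let ?S = "\<lambda>s. {i. (s, i) \<in> A}"
  have "\<exists>h. bij_betw h (?S s) {0..<card (?S s)}" if "s < d" for s
    by (rule ex_bij_betw_finite_nat) (use finite_subset[OF block_slice_subset[OF A(1)]] A(2) that in auto)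
  then have "\<forall>s. \<exists>h. s < d \<longrightarrow> bij_betw h (?S s) {0..<card (?S s)}" by blast
  from choice[OF this] obtain h where h: "\<And>s. s < d \<Longrightarrow> bij_betw (h s) (?S s) {0..<card (?S s)}" by blast
  let ?r = "\<lambda>x. (fst x, h (fst x) (snd x))"
  have Ad: "s < d" if "(s, i) \<in> A" for s i using that A by (auto simp: block_labels_def)
  have "inj_on ?r A"
  proof (rule inj_onI)
    fix x y assume xy: "x \<in> A" "y \<in> A" "?r x = ?r y"
    then have e: "fst x = fst y" "h (fst x) (snd x) = h (fst x) (snd y)" by auto
    have I: "inj_on (h (fst x)) (?S (fst x))"
      by (rule bij_betw_imp_inj_on[OF h]) (use Ad[of "fst x" "snd x"] xy(1) in simp)
    have m: "snd x \<in> ?S (fst x)" using xy(1) by simp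
    have "(fst x, snd y) \<in> A" unfolding e(1) using xy(2) by simp
    then have "snd x = snd y" by (intro inj_onD[OF I e(2) m]) simp
    then show "x = y" using e by (simp add: prod_eq_iff)
  qed
  moreover have "?r ` A = block_labels (block_profile d A)"
  proof
    show "?r ` A \<subseteq> block_labels (block_profile d A)"
    proof (rule image_subsetI)
      fix x assume x: "x \<in> A"
      have d: "fst x < d" using Ad[of "fst x" "snd x"] x by simp
      have "h (fst x) (snd x) \<in> {0..<card (?S (fst x))}" using bij_betwE[OF h[OF d]] x by auto
      then show "?r x \<in> block_labels (block_profile d A)" using d by (simp add: block_labels_def block_profile_def)
    qed
    show "block_labels (block_profile d A) \<subseteq> ?r ` A"
    proof
      fix y assume "y \<in> block_labels (block_profile d A)"
      then obtain s j where y: "y = (s, j)" "s < d" "j < card (?S s)" by (auto simp: block_labels_def block_profile_def)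
      then have "j \<in> h s ` ?S s" unfolding bij_betw_imp_surj_on[OF h[OF y(2)]] by simp
      then obtain i where "i \<in> ?S s" "h s i = j" by blast
      then show "y \<in> ?r ` A" using y(1) by (intro image_eqI[of _ _ "(s, i)"]) auto
    qed
  qed
  ultimately show ?thesis by (intro that[of ?r]) (auto simp: bij_betw_def)
qed

lemma card_block_profile:
  assumes p: "length p = d" and a: "length a = d"
  shows "card {A. A \<subseteq> block_labels p \<and> block_profile d A = a} = (\<Prod>s<d. p ! s choose (a ! s))"
proof -
  let ?T = "{A. A \<subseteq> block_labels p \<and> block_profile d A = a}"
  let ?P = "PiE {..<d} (\<lambda>s. {I. I \<subseteq> {..<p ! s} \<and> card I = a ! s})"
  have prof: "card {i. (s, i) \<in> A} = a ! s" if "block_profile d A = a" "s < d" for A s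
    using that by (auto simp: block_profile_def)
  have "bij_betw (\<lambda>A. \<lambda>s\<in>{..<d}. {i. (s, i) \<in> A}) ?T ?P"
  proof (rule bij_betw_byWitness[of _ "\<lambda>I. SIGMA s:{..<d}. I s"])
    show "\<forall>A\<in>?T. (SIGMA s:{..<d}. (\<lambda>s\<in>{..<d}. {i. (s, i) \<in> A}) s) = A"
      using p by (auto simp: block_labels_def)
    show "\<forall>I\<in>?P. (\<lambda>s\<in>{..<d}. {i. (s, i) \<in> (SIGMA s:{..<d}. I s)}) = I"
      by (auto simp: fun_eq_iff PiE_iff extensional_def)
    show "(\<lambda>A. \<lambda>s\<in>{..<d}. {i. (s, i) \<in> A}) ` ?T \<subseteq> ?P"
      using prof p by (auto simp: block_labels_def)
    show "(\<lambda>I. SIGMA s:{..<d}. I s) ` ?P \<subseteq> ?T"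
    proof (rule image_subsetI)
      fix I assume I: "I \<in> ?P"
      have "block_profile d (SIGMA s:{..<d}. I s) = a"
        by (rule nth_equalityI) (use I a in \<open>auto simp: block_profile_def PiE_iff\<close>)
      then show "(SIGMA s:{..<d}. I s) \<in> ?T" using I p by (auto simp: block_labels_def PiE_iff)
    qed
  qed
  then have "card ?T = card ?P" by (rule bij_betw_same_card)
  also have "\<dots> = (\<Prod>s<d. card {I. I \<subseteq> {..<p ! s} \<and> card I = a ! s})" by (simp add: card_PiE)
  also have "\<dots> = (\<Prod>s<d. p ! s choose (a ! s))" by (simp add: n_subsets)
  finally show ?thesis .
qed

text \<open>The profiles that matter, since \<open>k\<close> boxes meet at most \<open>k\<close>
  rows and \<open>k\<close> columns. This range is independent of \<open>p\<close> and
  \<open>r\<close>, which is what makes the final sum a polynomial.\<close>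

definition bounded_lists :: "nat \<Rightarrow> nat \<Rightarrow> nat list set" where
  "bounded_lists d k = {a. set a \<subseteq> {..k} \<and> length a = d}"

lemma finite_bounded_lists: "finite (bounded_lists d k)"
  unfolding bounded_lists_def by (rule finite_lists_length_eq) simp

lemma spanning_subsets_profile:
  assumes "M \<in> spanning_subsets k A B" "finite A" "finite B"
  shows "block_profile d A \<in> bounded_lists d k" "block_profile d B \<in> bounded_lists d k"
proof -
  have sub: "M \<subseteq> block_boxes A B" and M: "card M = k" "fst ` M = A" "snd ` M = B"
    using assms(1) by (auto simp: spanning_subsets_def)
  have fM: "finite M" by (rule finite_subset[OF sub finite_block_boxes[OF assms(2,3)]])
  have "card A \<le> k" "card B \<le> k" using card_image_le[OF fM, of fst] card_image_le[OF fM, of snd] M by simp_all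
  moreover have "card {i. (s, i) \<in> X} \<le> card X" if "finite X" for s :: nat and X :: "(nat \<times> nat) set"
  proof -
    have "{i. (s, i) \<in> X} \<subseteq> snd ` X" by force
    then have "card {i. (s, i) \<in> X} \<le> card (snd ` X)" using that by (intro card_mono) auto
    then show ?thesis using card_image_le[OF that, of snd] by linarith
  qed
  ultimately show "block_profile d A \<in> bounded_lists d k" "block_profile d B \<in> bounded_lists d k"
    using assms(2,3) by (auto simp: bounded_lists_def block_profile_def intro: order_trans)
qed

text \<open>The sets of boxes are grouped by the rows and columns they meet, and these by profile.
  For each pair of profiles the weights add up to a constant, and the row sets and column sets with
  these profiles are counted by binomials, block by block.\<close>

lemma sum_block_boxes:
  assumes p: "length p = d" and r: "length r = d" and D: "finite D"
  shows "(\<Sum>M | M \<subseteq> block_boxes (block_labels p) (block_labels r) \<and> card M = k. young_weight D M) =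
    (\<Sum>(a,b)\<in>bounded_lists d k \<times> bounded_lists d k.
       (\<Sum>M\<in>spanning_subsets k (block_labels a) (block_labels b). young_weight D M) *
       of_nat (\<Prod>s<d. p ! s choose (a ! s)) * of_nat (\<Prod>s<d. r ! s choose (b ! s)))"
proof -
  let ?P = "block_labels p" and ?R = "block_labels r"
  let ?X = "block_boxes ?P ?R"
  let ?S = "{M. M \<subseteq> ?X \<and> card M = k}"
  let ?L = "bounded_lists d k"
  let ?G = "\<lambda>a b. \<Sum>M\<in>spanning_subsets k (block_labels a) (block_labels b). young_weight D M"
  let ?pr = "block_profile d"
  have fP: "finite ?P" and fR: "finite ?R" by (rule finite_block_labels)+
  have fX: "finite ?X" by (rule finite_block_boxes[OF fP fR])
  have fS: "finite ?S" using fX by simp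
  have img: "(\<lambda>M. (fst ` M, snd ` M)) ` ?S \<subseteq> Pow ?P \<times> Pow ?R" by (force simp: block_boxes_def)
  have fL: "finite (?L \<times> ?L)" using finite_bounded_lists by simp
  have "(\<Sum>M\<in>?S. young_weight D M) = (\<Sum>AB\<in>Pow ?P \<times> Pow ?R. \<Sum>M | M \<in> ?S \<and> (fst ` M, snd ` M) = AB. young_weight D M)"
    by (rule sum.group[symmetric, OF fS _ img]) (use fP fR in simp)
  also have "\<dots> = (\<Sum>(A,B)\<in>Pow ?P \<times> Pow ?R. \<Sum>(a,b)\<in>?L \<times> ?L. of_bool (?pr A = a) * of_bool (?pr B = b) * ?G a b)"
  proof (rule sum.cong[OF refl])
    fix AB assume AB: "AB \<in> Pow ?P \<times> Pow ?R"
    obtain A B where e: "AB = (A, B)" by (cases AB)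
    have sub: "A \<subseteq> ?P" "B \<subseteq> ?R" using AB e by auto
    have fin: "finite A" "finite B" using finite_subset[OF sub(1) fP] finite_subset[OF sub(2) fR] .
    have "block_boxes A B \<subseteq> ?X" using sub by (auto simp: block_boxes_def)
    moreover have "M \<subseteq> block_boxes A B" if "M \<subseteq> ?X" "fst ` M = A" "snd ` M = B" for M
    proof
      fix z assume z: "z \<in> M"
      then have "fst z \<in> A" "snd z \<in> B" using that(2,3) by auto
      moreover have "fst (fst z) \<le> fst (snd z)" using z that(1) by (auto simp: block_boxes_def)
      ultimately show "z \<in> block_boxes A B" by (simp add: block_boxes_def case_prod_unfold mem_Times_iff)
    qed
    ultimately have "{M. M \<in> ?S \<and> (fst ` M, snd ` M) = (A,B)} = spanning_subsets k A B"
      unfolding spanning_subsets_def by (intro Collect_cong) auto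
    then have "(\<Sum>M | M \<in> ?S \<and> (fst ` M, snd ` M) = (A,B). young_weight D M) = (\<Sum>M\<in>spanning_subsets k A B. young_weight D M)" by simp
    also have G: "\<dots> = ?G (?pr A) (?pr B)"
    proof -
      obtain \<rho> where "bij_betw \<rho> A (block_labels (?pr A))" "\<And>x. x \<in> A \<Longrightarrow> fst (\<rho> x) = fst x"
        using block_profile_bij[OF sub(1) p] by blast
      moreover obtain \<gamma> where "bij_betw \<gamma> B (block_labels (?pr B))" "\<And>x. x \<in> B \<Longrightarrow> fst (\<gamma> x) = fst x"
        using block_profile_bij[OF sub(2) r] by blast
      ultimately show ?thesis by (rule sum_spanning_subsets[OF fin])
    qed
    also have "\<dots> = (\<Sum>(a,b)\<in>?L \<times> ?L. of_bool (?pr A = a) * of_bool (?pr B = b) * ?G a b)"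
    \<comment> \<open>If nothing spans \<open>A\<close> and \<open>B\<close>, their profiles may lie
      outside \<open>bounded_lists\<close>, but then the constant that would be missed is 0.\<close>
    proof (cases "spanning_subsets k A B = {}")
      case False
      then have m: "(?pr A, ?pr B) \<in> ?L \<times> ?L" using spanning_subsets_profile[OF _ fin] by blast
      have "(\<Sum>(a,b)\<in>?L \<times> ?L. of_bool (?pr A = a) * of_bool (?pr B = b) * ?G a b) =
        (\<Sum>ab\<in>?L \<times> ?L. if ab = (?pr A, ?pr B) then ?G (?pr A) (?pr B) else 0)"
        by (intro sum.cong refl) auto
      also have "\<dots> = ?G (?pr A) (?pr B)" using m fL by (simp add: sum.delta)
      finally show ?thesis by simp
    next
      case True
      have z: "?G (?pr A) (?pr B) = 0"
        using G unfolding True by simp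
      have "(\<Sum>(a,b)\<in>?L \<times> ?L. of_bool (?pr A = a) * of_bool (?pr B = b) * ?G a b) = 0"
        by (rule sum.neutral) (use z in \<open>auto split: if_splits\<close>)
      then show ?thesis using z by simp
    qed
    finally show "(\<Sum>M | M \<in> ?S \<and> (fst ` M, snd ` M) = AB. young_weight D M) =
      (case AB of (A, B) \<Rightarrow> \<Sum>(a,b)\<in>?L \<times> ?L. of_bool (?pr A = a) * of_bool (?pr B = b) * ?G a b)"
      by (simp add: e)
  qed
  also have "\<dots> = (\<Sum>ab\<in>?L \<times> ?L. \<Sum>AB\<in>Pow ?P \<times> Pow ?R.
      of_bool (?pr (fst AB) = fst ab) * of_bool (?pr (snd AB) = snd ab) * ?G (fst ab) (snd ab))"
    unfolding case_prod_unfold by (rule sum.swap)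
  also have "\<dots> = (\<Sum>(a,b)\<in>?L \<times> ?L. ?G a b * of_nat (\<Prod>s<d. p ! s choose (a ! s)) * of_nat (\<Prod>s<d. r ! s choose (b ! s)))"
  proof (rule sum.cong[OF refl])
    fix ab assume ab: "ab \<in> ?L \<times> ?L"
    obtain a b where e: "ab = (a, b)" by (cases ab)
    have len: "length a = d" "length b = d" using ab by (auto simp: e bounded_lists_def)
    have cnt: "(\<Sum>A\<in>Pow (block_labels q). of_bool (?pr A = x)) = (of_nat (\<Prod>s<d. q ! s choose (x ! s)) :: rat)"
      if "length q = d" "length x = d" for q x
    proof -
      have "(\<Sum>A\<in>Pow (block_labels q). of_bool (?pr A = x)) = (of_nat (card {A \<in> Pow (block_labels q). ?pr A = x}) :: rat)"
        using finite_block_labels[of q] by (simp add: sum_of_bool_eq Int_def)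
      then show ?thesis using card_block_profile[OF that] by simp
    qed
    have rect: "(\<Sum>AB\<in>Pow ?P \<times> Pow ?R. of_bool (?pr (fst AB) = a) * of_bool (?pr (snd AB) = b) * g) =
       (\<Sum>A\<in>Pow ?P. of_bool (?pr A = a)) * (\<Sum>B\<in>Pow ?R. of_bool (?pr B = b)) * g" for g :: rat
      unfolding sum_product unfolding sum.cartesian_product sum_distrib_right[symmetric] by (simp add: case_prod_unfold)
    show "(\<Sum>AB\<in>Pow ?P \<times> Pow ?R. of_bool (?pr (fst AB) = fst ab) * of_bool (?pr (snd AB) = snd ab) * ?G (fst ab) (snd ab)) =
      (case ab of (a,b) \<Rightarrow> ?G a b * of_nat (\<Prod>s<d. p ! s choose (a ! s)) * of_nat (\<Prod>s<d. r ! s choose (b ! s)))"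
      unfolding e prod.case fst_conv snd_conv rect cnt[OF p len(1)] cnt[OF r len(2)] by (simp only: mult_ac)
  qed
  finally show ?thesis .
qed

section \<open>The boxes of a multirectangular diagram\<close>

text \<open>The row lengths before \<open>multirect\<close> drops the zeros, with the number of
  blocks as a parameter for induction.\<close>

definition block_rows :: "nat list \<Rightarrow> (nat \<Rightarrow> nat) \<Rightarrow> nat \<Rightarrow> nat list" where
  "block_rows p R d = concat (map (\<lambda>s. replicate (p ! s) (R s)) [0..<d])"

lemma block_rows_Suc: "block_rows p R (Suc d) = block_rows p R d @ replicate (p ! d) (R d)"
  by (simp add: block_rows_def)

lemma length_block_rows: "length (block_rows p R d) = (\<Sum>u<d. p ! u)"
  by (induction d) (simp_all add: block_rows_Suc, simp add: block_rows_def)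

lemma block_rows_nth:
  "s < d \<Longrightarrow> i < p ! s \<Longrightarrow> block_rows p R d ! ((\<Sum>u<s. p ! u) + i) = R s"
proof (induction d)
  case (Suc d)
  show ?case
  proof (cases "s < d")
    case True
    have "(\<Sum>u<s. p ! u) + i < (\<Sum>u<Suc s. p ! u)" using Suc.prems by simp
    also have "\<dots> \<le> (\<Sum>u<d. p ! u)" using True by (intro sum_mono2) auto
    finally show ?thesis using Suc.IH True Suc.prems by (simp add: block_rows_Suc nth_append length_block_rows)
  next
    case False
    then have "s = d" using Suc.prems by simp
    then show ?thesis using Suc.prems by (simp add: block_rows_Suc nth_append length_block_rows)
  qed
qed simp

lemma sorted_block_rows:
  assumes "\<And>s t. s \<le> t \<Longrightarrow> R t \<le> R s"
  shows "sorted_wrt (\<ge>) (block_rows p R d)"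
proof (induction d)
  case (Suc d)
  have "R d \<le> x" if "x \<in> set (block_rows p R d)" for x
    using that assms by (auto simp: block_rows_def)
  moreover have "sorted_wrt (\<ge>) (replicate n (R d))" for n by (induction n) auto
  ultimately show ?case using Suc by (simp add: block_rows_Suc sorted_wrt_append)
qed (simp add: block_rows_def)

text \<open>In a decreasing list the zeros stand at the end, where \<open>list_rows\<close> is 0
  anyway.\<close>

lemma list_rows_filter:
  "sorted_wrt (\<ge>) xs \<Longrightarrow> list_rows (filter (\<lambda>x. 0 < x) xs) = list_rows xs"
proof (induction xs)
  case (Cons a xs)
  have C: "list_rows (b # ys) i = (case i of 0 \<Rightarrow> b | Suc j \<Rightarrow> list_rows ys j)" for b ys i
    by (cases i) (simp_all add: list_rows_def)
  show ?case
  proof (cases "0 < a")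
    case True
    then show ?thesis using Cons by (auto simp: fun_eq_iff C split: nat.splits)
  next
    case False
    have z: "\<forall>x\<in>set (a # xs). x = 0" using Cons.prems False by auto
    then have "filter (\<lambda>x. 0 < x) (a # xs) = []" by (auto simp: filter_empty_conv)
    moreover have "list_rows (a # xs) i = 0" for i
      using z nth_mem[of i "a # xs"] unfolding list_rows_def by auto
    ultimately show ?thesis by (simp add: fun_eq_iff list_rows_def del: filter.simps)
  qed
qed simp

lemma is_partition_filter:
  assumes "sorted_wrt (\<ge>) (xs :: nat list)"
  shows "is_partition (filter (\<lambda>x. 0 < x) xs)"
proof -
  have "sorted_wrt (\<ge>) (filter (\<lambda>x. 0 < x) xs)" by (rule sorted_wrt_filter[OF assms])
  then show ?thesis unfolding is_partition_def by (auto simp: sorted_wrt_iff_nth_less)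
qed

lemma sum_list_drop_Suc: "s < length r \<Longrightarrow> sum_list (drop s r) = r ! s + sum_list (drop (Suc s) (r :: nat list))"
  by (simp flip: Cons_nth_drop_Suc)

lemma sum_list_drop_antimono: "s \<le> t \<Longrightarrow> sum_list (drop t (r :: nat list)) \<le> sum_list (drop s r)"
proof (rule lift_Suc_antimono_le[of "\<lambda>s. sum_list (drop s r)"])
  fix s show "sum_list (drop (Suc s) r) \<le> sum_list (drop s r)"
    by (cases "s < length r") (simp_all add: sum_list_drop_Suc)
qed

lemma locate_row:
  fixes d :: nat
  shows "x < (\<Sum>u<d. p u) \<Longrightarrow> \<exists>s<d. \<exists>i<p s. x = (\<Sum>u<s. p u) + (i :: nat)"
proof (induction d)
  case (Suc d)
  show ?case
  proof (cases "x < (\<Sum>u<d. p u)")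
    case True
    then show ?thesis using Suc.IH less_SucI by blast
  next
    case False
    then show ?thesis using Suc.prems by (intro exI[of _ d] conjI exI[of _ "x - (\<Sum>u<d. p u)"]) auto
  qed
qed simp

lemma locate_column:
  "y < sum_list (drop s r) \<Longrightarrow> \<exists>t\<ge>s. t < length r \<and> (\<exists>j<r ! t. y = sum_list (drop (Suc t) r) + (j :: nat))"
proof (induction "length r - s" arbitrary: s)
  case 0
  then show ?case by simp
next
  case (Suc n)
  show ?case
  proof (cases "y < sum_list (drop (Suc s) r)")
    case True
    have "n = length r - Suc s" using Suc.hyps(2) by simp
    then show ?thesis using Suc.hyps(1) True Suc_leD by blast
  next
    case False
    then show ?thesis using Suc.prems Suc.hyps(2) sum_list_drop_Suc[of s r]
      by (intro exI[of _ s] conjI exI[of _ "y - sum_list (drop (Suc s) r)"]) auto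
  qed
qed

lemma multirect_block_rows:
  "multirect p r = filter (\<lambda>x. 0 < x) (block_rows p (\<lambda>s. sum_list (drop s r)) (length p))"
  by (simp add: multirect_def block_rows_def)

lemma multirect_is_partition: "is_partition (multirect p r)"
  unfolding multirect_block_rows
  by (intro is_partition_filter sorted_block_rows sum_list_drop_antimono)

definition row_index :: "nat list \<Rightarrow> nat \<times> nat \<Rightarrow> nat" where
  "row_index p x = (\<Sum>u<fst x. p ! u) + snd x"

text \<open>Row lengths are sums over the blocks from \<open>s\<close> on, so the columns of the
  last block stand leftmost: block \<open>t\<close> begins after the columns of all later
  blocks.\<close>

definition column_index :: "nat list \<Rightarrow> nat \<times> nat \<Rightarrow> nat" where
  "column_index r x = sum_list (drop (Suc (fst x)) r) + snd x"

lemma inj_row_index: "inj_on (row_index p) (block_labels p)"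
proof -
  have lt: "row_index p x < row_index p y"
    if "x \<in> block_labels p" "y \<in> block_labels p" "fst x < fst y" for x y
  proof -
    have "row_index p x < (\<Sum>u<Suc (fst x). p ! u)" using that(1) by (auto simp: row_index_def block_labels_def)
    also have "\<dots> \<le> (\<Sum>u<fst y. p ! u)" using that(3) by (intro sum_mono2) auto
    finally show ?thesis by (simp add: row_index_def)
  qed
  show ?thesis
  proof (rule inj_onI)
    fix x y assume xy: "x \<in> block_labels p" "y \<in> block_labels p" "row_index p x = row_index p y"
    then have "fst x = fst y" using lt[of x y] lt[of y x] by (metis nat_neq_iff)
    then show "x = y" using xy(3) by (simp add: row_index_def prod_eq_iff)
  qed
qed

lemma inj_column_index: "inj_on (column_index r) (block_labels r)"
proof -
  have lt: "column_index r y < column_index r x"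
    if "x \<in> block_labels r" "y \<in> block_labels r" "fst x < fst y" for x y
  proof -
    have "column_index r y < sum_list (drop (fst y) r)"
      using that(2) sum_list_drop_Suc[of "fst y" r] by (auto simp: column_index_def block_labels_def)
    also have "\<dots> \<le> sum_list (drop (Suc (fst x)) r)" using that(3) by (intro sum_list_drop_antimono) simp
    finally show ?thesis by (simp add: column_index_def)
  qed
  show ?thesis
  proof (rule inj_onI)
    fix x y assume xy: "x \<in> block_labels r" "y \<in> block_labels r" "column_index r x = column_index r y"
    then have "fst x = fst y" using lt[of x y] lt[of y x] by (metis nat_neq_iff)
    then show "x = y" using xy(3) by (simp add: column_index_def prod_eq_iff)
  qed
qed

text \<open>A row of block \<open>s\<close> ends with the last column of block \<open>s\<close>, so
  it meets exactly the columns of the blocks \<open>t \<ge> s\<close>.\<close>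

lemma boxes_multirect:
  assumes "length p = length r"
  shows "boxes (list_rows (multirect p r)) =
    map_prod (row_index p) (column_index r) ` block_boxes (block_labels p) (block_labels r)"
proof -
  define d where "d = length p"
  let ?R = "\<lambda>s. sum_list (drop s r)"
  let ?l = "block_rows p ?R d"
  have rows: "list_rows (multirect p r) = list_rows ?l"
    unfolding multirect_block_rows d_def by (intro list_rows_filter sorted_block_rows sum_list_drop_antimono)
  have len: "length ?l = (\<Sum>u<d. p ! u)" by (rule length_block_rows)
  have val: "list_rows ?l ((\<Sum>u<s. p ! u) + i) = ?R s" if "s < d" "i < p ! s" for s i
  proof -
    have "(\<Sum>u<s. p ! u) + i < (\<Sum>u<Suc s. p ! u)" using that by simp
    also have "\<dots> \<le> (\<Sum>u<d. p ! u)" using that by (intro sum_mono2) auto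
    finally show ?thesis using block_rows_nth[OF that] by (simp add: list_rows_def len)
  qed
  show ?thesis
  proof (intro equalityI subsetI)
    fix z assume z: "z \<in> boxes (list_rows (multirect p r))"
    obtain x y where xy: "z = (x, y)" by (cases z)
    have y: "y < list_rows ?l x" using z by (simp add: xy boxes_def rows)
    then have "x < (\<Sum>u<d. p ! u)" by (auto simp: list_rows_def len split: if_splits)
    then obtain s i where si: "s < d" "i < p ! s" "x = (\<Sum>u<s. p ! u) + i" using locate_row by blast
    then have "y < ?R s" using y val by simp
    then obtain t j where tj: "s \<le> t" "t < length r" "j < r ! t" "y = ?R (Suc t) + j" using locate_column by blast
    have "z = map_prod (row_index p) (column_index r) ((s, i), (t, j))"
      by (simp add: xy si tj row_index_def column_index_def)
    moreover have "((s, i), (t, j)) \<in> block_boxes (block_labels p) (block_labels r)"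
      using si tj by (simp add: block_boxes_def block_labels_def d_def)
    ultimately show "z \<in> map_prod (row_index p) (column_index r) ` block_boxes (block_labels p) (block_labels r)" by blast
  next
    fix z assume "z \<in> map_prod (row_index p) (column_index r) ` block_boxes (block_labels p) (block_labels r)"
    then obtain s i t j where st: "((s, i), (t, j)) \<in> block_boxes (block_labels p) (block_labels r)"
      and z: "z = ((\<Sum>u<s. p ! u) + i, ?R (Suc t) + j)"
      by (force simp: row_index_def column_index_def)
    have si: "s < d" "i < p ! s" and tj: "t < length r" "j < r ! t" "s \<le> t"
      using st by (auto simp: block_boxes_def block_labels_def d_def)
    have "?R (Suc t) + j < ?R t" using tj sum_list_drop_Suc[of t r] by simp
    also have "\<dots> \<le> ?R s" by (rule sum_list_drop_antimono[OF tj(3)])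
    finally show "z \<in> boxes (list_rows (multirect p r))" using val[OF si] by (simp add: z boxes_def rows)
  qed
qed

lemma sum_boxes_multirect:
  assumes "length p = length r"
  shows "(\<Sum>M | M \<subseteq> boxes (list_rows (multirect p r)) \<and> card M = k. young_weight D M) =
    (\<Sum>M | M \<subseteq> block_boxes (block_labels p) (block_labels r) \<and> card M = k. young_weight D M)"
proof -
  let ?g = "map_prod (row_index p) (column_index r)"
  let ?X = "block_boxes (block_labels p) (block_labels r)"
  have X: "?X \<subseteq> block_labels p \<times> block_labels r" by (auto simp: block_boxes_def)
  have fX: "finite ?X" by (intro finite_block_boxes finite_block_labels)
  have inj: "inj_on ?g ?X" by (rule inj_on_map_prod_sides[OF inj_row_index inj_column_index X])
  have cd: "card (?g ` M) = card M" if "M \<subseteq> ?X" for M using card_image[OF inj_on_subset[OF inj that]] .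
  have "{M. M \<subseteq> ?g ` ?X \<and> card M = k} = (\<lambda>M. ?g ` M) ` {M. M \<subseteq> ?X \<and> card M = k}"
  proof (intro equalityI subsetI)
    fix M assume M: "M \<in> {M. M \<subseteq> ?g ` ?X \<and> card M = k}"
    then obtain M' where "M' \<subseteq> ?X" "M = ?g ` M'" by (auto simp: subset_image_iff)
    then show "M \<in> (\<lambda>M. ?g ` M) ` {M. M \<subseteq> ?X \<and> card M = k}" using M cd by auto
  qed (use cd in auto)
  then have "(\<Sum>M | M \<subseteq> boxes (list_rows (multirect p r)) \<and> card M = k. young_weight D M) =
    (\<Sum>M\<in>(\<lambda>M. ?g ` M) ` {M. M \<subseteq> ?X \<and> card M = k}. young_weight D M)"
    unfolding boxes_multirect[OF assms] by simp
  also have "\<dots> = (\<Sum>M | M \<subseteq> ?X \<and> card M = k. young_weight D (?g ` M))"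
    by (rule sum.reindex_cong[OF _ refl refl]) (rule inj_on_subset[OF inj_on_image_Pow[OF inj]], auto)
  also have "\<dots> = (\<Sum>M | M \<subseteq> ?X \<and> card M = k. young_weight D M)"
  proof (rule sum.cong[OF refl])
    fix M assume "M \<in> {M. M \<subseteq> ?X \<and> card M = k}"
    then have "M \<subseteq> ?X" by simp
    then show "young_weight D (?g ` M) = young_weight D M"
      using X finite_subset[OF _ fX]
      by (intro young_weight_map_prod[OF _ _ inj_row_index inj_column_index]) auto
  qed
  finally show ?thesis .
qed

section \<open>Expansion in the falling factorial basis\<close>

definition ff_basis_sum :: "nat \<Rightarrow> nat \<Rightarrow> (nat list \<times> nat list \<Rightarrow> rat) \<Rightarrow> nat list \<Rightarrow> nat list \<Rightarrow> rat" where
  "ff_basis_sum d k c p r = (\<Sum>(a,b)\<in>bounded_lists d k \<times> bounded_lists d k. c (a,b) *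
      (\<Prod>i<d. ff (of_nat (p ! i)) (a ! i)) * (\<Prod>i<d. ff (of_nat (r ! i)) (b ! i)))"

lemma nonneg_ff_polyI:
  assumes "\<And>ab. 0 \<le> c ab" "\<And>p r. length p = d \<Longrightarrow> length r = d \<Longrightarrow> f p r = ff_basis_sum d k c p r"
  shows "nonneg_ff_poly d f"
  unfolding nonneg_ff_poly_def
proof (intro exI conjI)
  show "finite (bounded_lists d k \<times> bounded_lists d k)" using finite_bounded_lists by simp
  show "\<forall>(a, b)\<in>bounded_lists d k \<times> bounded_lists d k. length a = d \<and> length b = d \<and> 0 \<le> c (a, b)"
    using assms(1) by (auto simp: bounded_lists_def)
qed (use assms(2) in \<open>auto simp: ff_basis_sum_def\<close>)

lemma normalized_skew_count_ff_basis:
  assumes N: "N \<in> partition_rows l0 k"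
  obtains c where "\<And>ab. 0 \<le> c ab"
    "\<And>p r. length p = d \<Longrightarrow> length r = d \<Longrightarrow>
      normalized_skew_count (sum_list (multirect p r)) k (list_rows (multirect p r)) N = ff_basis_sum d k c p r"
proof -
  let ?D = "boxes N"
  have D: "finite ?D" by (rule finite_boxes[OF N])
  obtain C :: rat where C: "0 \<le> C"
    "\<And>L l n. L \<in> partition_rows l n \<Longrightarrow> normalized_skew_count n k L N =
       C * (\<Sum>M | M \<subseteq> boxes L \<and> card M = k. young_weight ?D M)"
    using normalized_skew_count_eq_sum[OF N] unfolding young_weight_def by blast
  define G where "G a b = (\<Sum>M\<in>spanning_subsets k (block_labels a) (block_labels b). young_weight ?D M)" for a b
  have G: "0 \<le> G a b" for a b unfolding G_def
  proof (rule sum_nonneg)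
    fix M assume "M \<in> spanning_subsets k (block_labels a) (block_labels b)"
    then have "M \<subseteq> block_boxes (block_labels a) (block_labels b)" by (simp add: spanning_subsets_def)
    then have "finite M" by (rule finite_subset) (intro finite_block_boxes finite_block_labels)
    then show "0 \<le> young_weight ?D M" by (rule young_weight_nonneg[OF D])
  qed
  \<comment> \<open>Each binomial is a falling factorial divided by a factorial; the denominators
    are collected here.\<close>
  define c where "c ab = C * G (fst ab) (snd ab) / ((\<Prod>i<d. fact (fst ab ! i)) * (\<Prod>i<d. fact (snd ab ! i)))" for ab
  show ?thesis
  proof (rule that[of c])
    show "0 \<le> c ab" for ab unfolding c_def using C(1) G by (intro divide_nonneg_nonneg mult_nonneg_nonneg prod_nonneg) auto
    fix p r :: "nat list" assume pr: "length p = d" "length r = d"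
    let ?lam = "multirect p r"
    have ch: "of_nat (\<Prod>i<d. q ! i choose (a ! i)) = (\<Prod>i<d. ff (of_nat (q ! i)) (a ! i)) / (\<Prod>i<d. fact (a ! i) :: rat)"
      for q a :: "nat list"
      unfolding prod_dividef[symmetric] of_nat_prod by (intro prod.cong refl) (simp add: ff_of_nat)
    have "list_rows ?lam \<in> partition_rows (length ?lam) (sum_list ?lam)"
      by (rule list_rows_partition_rows[OF multirect_is_partition]) simp
    then have "normalized_skew_count (sum_list ?lam) k (list_rows ?lam) N =
       C * (\<Sum>M | M \<subseteq> boxes (list_rows ?lam) \<and> card M = k. young_weight ?D M)" by (rule C(2))
    also have "\<dots> = C * (\<Sum>(a,b)\<in>bounded_lists d k \<times> bounded_lists d k.
       G a b * of_nat (\<Prod>s<d. p ! s choose (a ! s)) * of_nat (\<Prod>s<d. r ! s choose (b ! s)))"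
      unfolding sum_boxes_multirect[OF trans[OF pr(1) pr(2)[symmetric]]] sum_block_boxes[OF pr D] G_def ..
    also have "\<dots> = ff_basis_sum d k c p r"
      unfolding ff_basis_sum_def sum_distrib_left c_def ch
      by (intro sum.cong refl) (auto simp: mult_ac)
    finally show "normalized_skew_count (sum_list ?lam) k (list_rows ?lam) N = ff_basis_sum d k c p r" .
  qed
qed

theorem theorem1p2:
  fixes d :: nat and mu :: "nat list"
  assumes "1 \<le> d" and "is_partition mu"
  shows "nonneg_ff_poly d (\<lambda>p r. shifted_schur mu (multirect p r))
       \<and> nonneg_ff_poly d (\<lambda>p r. Ko mu (multirect p r))"
proof
  define k where "k = sum_list mu"
  let ?X = "\<lambda>N p r. normalized_skew_count (sum_list (multirect p r)) k (list_rows (multirect p r)) N"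
  have "list_rows mu \<in> partition_rows (length mu) k"
    unfolding k_def by (rule list_rows_partition_rows[OF assms(2)]) simp
  then obtain c where c: "\<And>ab. 0 \<le> c ab"
    "\<And>p r. length p = d \<Longrightarrow> length r = d \<Longrightarrow> ?X (list_rows mu) p r = ff_basis_sum d k c p r"
    using normalized_skew_count_ff_basis[where d = d] by blast
  show "nonneg_ff_poly d (\<lambda>p r. shifted_schur mu (multirect p r))"
    by (rule nonneg_ff_polyI[of c, OF c(1)])
      (simp add: shifted_schur_eq[OF assms(2) multirect_is_partition] c(2) flip: k_def)
  have "\<forall>N\<in>partition_rows k k. \<exists>c. (\<forall>ab. 0 \<le> c ab) \<and>
    (\<forall>p r. length p = d \<longrightarrow> length r = d \<longrightarrow> ?X N p r = ff_basis_sum d k c p r)"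
  proof
    fix N assume "N \<in> partition_rows k k"
    then obtain c where "\<And>ab. 0 \<le> c ab"
      "\<And>p r. length p = d \<Longrightarrow> length r = d \<Longrightarrow> ?X N p r = ff_basis_sum d k c p r"
      using normalized_skew_count_ff_basis[where d = d] by blast
    then show "\<exists>c. (\<forall>ab. 0 \<le> c ab) \<and>
      (\<forall>p r. length p = d \<longrightarrow> length r = d \<longrightarrow> ?X N p r = ff_basis_sum d k c p r)" by blast
  qed
  from bchoice[OF this] obtain e where e: "\<And>N ab. N \<in> partition_rows k k \<Longrightarrow> 0 \<le> e N ab"
    "\<And>N p r. N \<in> partition_rows k k \<Longrightarrow> length p = d \<Longrightarrow> length r = d \<Longrightarrow> ?X N p r = ff_basis_sum d k (e N) p r"
    by blast
  \<comment> \<open>Non-negativity is inherited because the coefficients for the shapes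
    \<open>N\<close> are combined with Kostka numbers.\<close>
  let ?c = "\<lambda>ab. \<Sum>N\<in>partition_rows k k. of_nat (card (ssyt_rows N mu)) * e N ab"
  show "nonneg_ff_poly d (\<lambda>p r. Ko mu (multirect p r))"
  proof (rule nonneg_ff_polyI[of ?c _ _ k])
    show "0 \<le> ?c ab" for ab using e(1) by (intro sum_nonneg mult_nonneg_nonneg) auto
    fix p r :: "nat list" assume pr: "length p = d" "length r = d"
    have "Ko mu (multirect p r) = (\<Sum>N\<in>partition_rows k k. of_nat (card (ssyt_rows N mu)) * ff_basis_sum d k (e N) p r)"
      unfolding Ko_eq[OF multirect_is_partition k_def] by (intro sum.cong refl) (simp add: e(2) pr)
    also have "\<dots> = ff_basis_sum d k ?c p r"
      unfolding ff_basis_sum_def case_prod_unfold sum_distrib_left sum_distrib_right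
      by (subst sum.swap) (simp add: mult.assoc)
    finally show "Ko mu (multirect p r) = ff_basis_sum d k ?c p r" .
  qed
qed

end
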